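(* Let $V$ be an oriented Euclidean vector space of dimension $d$ with oriented orthonormal basis $(e_1,\dots,e_d)$ and coordinates $x_k=\langle e_k,x\rangle$. Let $\epsilon_d:=(-1)^{d(d-1)/2}\pi^{d/2}$, and let $T:\wedge V\to\mathbb{R}$ be the Berezin integral. For $X\in\mathfrak{so}(V)$ let $$f_t(X)=-t^2\|x\|^2+t\sum_k dx_k\,e_k+\frac12\sum_{k<l}\langle Xe_k,e_l\rangle\,e_k\wedge e_l,$$ $$\eta^t_\wedge(X)=-T\Big(\big(\sum_k x_ke_k\big)e^{f_t(X)}\Big),\qquad \beta_\wedge(X)=\int_0^\infty\eta^t_\wedge(X)\,dt ,$$ where $\beta_\wedge(X)$ is a form on $V\setminus\{0\}$. Then: (1) The pair $$\mathrm{Th}_{\rm rel}(V)(X)=\frac1{\epsilon_d}\big(\mathrm{Pf}(X/2),\beta_\wedge(X)\big),\quad X\in\mathfrak{so}(V),$$ is a Thom form in $\mathcal{A}^{\rm pol}(\mathfrak{so}(V),V,V\setminus\{0\})$; it defines a Thom class in $\mathcal{H}^{\rm pol}(\mathfrak{so}(V),V,V\setminus\{0\})$. (2) Let $\chi\in C^\infty(V)^{SO(V)}$ be an invariant function with compact support, equal to $1$ in a neighborhood of $0$. Then $$\mathrm{Th}_{c}(V)(X)=\frac1{\epsilon_d}\big(\chi\,\mathrm{Pf}(X/2)+d\chi\wedge\beta_\wedge(X)\big),\quad X\in\mathfrak{so}(V),$$ is a Thom form in $\mathcal{A}^{\rm pol}_c(\mathfrak{so}(V),V)$; it defines a Thom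 class in $\mathcal{H}^{\rm pol}_c(\mathfrak{so}(V),V)$. (3) The Mathai–Quillen form $$\mathrm{Th}_{\rm MQ}(V)(X)=\frac1{\epsilon_d}T\big(e^{f_1(X)}\big),\quad X\in\mathfrak{so}(V),$$ is a Thom form in $\mathcal{A}^{\rm pol}_{\text{dec-rap}}(\mathfrak{so}(V),V)$; it defines a Thom class in $\mathcal{H}^{\rm pol}_{\text{dec-rap}}(\mathfrak{so}(V),V)$.
   Context: Equivariant forms: for a compact Lie group $K$ with Lie algebra $\mathfrak{k}$ acting on a manifold $N$, $VX$ ($X\in\mathfrak{k}$) is the vector field $V_nX=\frac{d}{d\epsilon}\exp(-\epsilon X)\cdot n|_{\epsilon=0}$. $\mathcal{A}(N)$ is the algebra of differential forms, $\mathcal{A}^{\rm pol}(\mathfrak{k},N)=(C^{\rm pol}(\mathfrak{k})\otimes\mathcal{A}(N))^K$ is the algebra of $K$-equivariant polynomial maps $\mathfrak{k}\to\mathcal{A}(N)$, with differential $(D\alpha)(X)=d(\alpha(X))-\iota(VX)\alpha(X)$. Here $K=SO(V)$ and $N=V$ or $V\setminus\{0\}$. $\mathcal{A}^{\rm pol}_c$ and $\mathcal{A}^{\rm pol}_{\text{dec-rap}}$ denote the subcomplexes of forms on $V$ with compact support, respectively all of whose partial derivatives are rapidly decreasing on $V$; $\mathcal{H}$ denotes the corresponding cohomology. Relative forms: $\mathcal{A}^{\rm pol}(\mathfrak{so}(V),V,V\setminus\{0\})=\mathcal{A}^{\rm pol}(\mathfrak{so}(V),V)\oplus\mathcal{A}^{\rm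 pol}(\mathfrak{so}(V),V\setminus\{0\})$ with $D_{\rm rel}(\alpha,\beta)=(D\alpha,\alpha|_{V\setminus\{0\}}-D\beta)$, with cohomology $\mathcal{H}^{\rm pol}(\mathfrak{so}(V),V,V\setminus\{0\})$. The integral of a closed relative form is $\int_V(\alpha,\beta):=\int_V(\chi\alpha+d\chi\wedge\beta)$, with $\chi$ an invariant compactly supported function equal to $1$ near $0$ (independent of $\chi$). The orientation of $V$ is given by $dx_1\wedge\dots\wedge dx_d$. A Thom form in any of the three complexes is a closed form (for $D_{\rm rel}$ in the relative case, $D$ otherwise) whose integral over $V$ is the constant function $1$ on $\mathfrak{so}(V)$; a Thom class is the cohomology class of a Thom form. Berezin integral: $T:\wedge V\to\mathbb{R}$ is the linear map that vanishes on $\wedge^jV$ for $j<d$ and satisfies $T(e_1\wedge\dots\wedge e_d)=1$, extended to $\mathcal{A}(V)\otimes\wedge V$ by $T(\alpha\otimes\xi)=\alpha T(\xi)$. Exponentials are computed in the super (graded-commutative) tensor product algebra $\mathcal{A}(V)\otimes\wedge V$ (so the $dx_k$ and $e_l$ anticommute). The Pfaffian is $\mathrm{Pf}(X)=T\big(\exp(\sum_{k<l}\langle Xe_k,e_l\rangle e_k\wedge e_l)\big)$, viewed also as a function constant on $V$. *)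

theory Defs
  imports "HOL-Analysis.Analysis"
begin

text \<open>
  The oriented Euclidean space \<open>V\<close> is the whole of a type \<open>'a :: real_inner\<close> together with an
  oriented orthonormal basis \<open>e 0, ..., e (d - 1)\<close> (indices start at \<open>0\<close>). The class
  \<open>euclidean_space\<close> would exclude \<open>d = 0\<close>.
\<close>

definition orthonormal_basis :: "nat \<Rightarrow> (nat \<Rightarrow> 'a::real_inner) \<Rightarrow> bool" where
  "orthonormal_basis d e \<longleftrightarrow>
     (\<forall>i<d. \<forall>j<d. inner (e i) (e j) = (if i = j then 1 else 0)) \<and> span (e ` {..<d}) = UNIV"


section \<open>Exterior algebras, the super tensor product and the Berezin integral\<close>

text \<open>
  An element of the exterior algebra on generators \<open>\<theta> 0, ..., \<theta> (d - 1)\<close> is given by its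
  coefficients: \<open>a\<close> stands for the sum over \<open>I \<subseteq> {..<d}\<close> of \<open>a I\<close> times the product of the
  \<open>\<theta> i\<close>, \<open>i \<in> I\<close>, in increasing order. Values at other sets \<open>I\<close> are irrelevant. The generators
  are the \<open>e k\<close> for \<open>\<Lambda>V\<close> and the \<open>dx k\<close> for differential forms at a point.
\<close>

type_synonym ext = "nat set \<Rightarrow> real"

definition monom_ext :: "nat set \<Rightarrow> ext" where
  "monom_ext K = (\<lambda>I. if I = K then 1 else 0)"

text \<open>For disjoint \<open>K\<close>, \<open>L\<close>: \<open>monom_ext K \<and> monom_ext L = shuffle_sign K L * monom_ext (K \<union> L)\<close>.\<close>

definition shuffle_sign :: "nat set \<Rightarrow> nat set \<Rightarrow> real" where
  "shuffle_sign K L = (-1) ^ card {(k, l). k \<in> K \<and> l \<in> L \<and> l < k}"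

definition wedge :: "ext \<Rightarrow> ext \<Rightarrow> ext" where
  "wedge a b = (\<lambda>I. \<Sum>K\<in>Pow I. shuffle_sign K (I - K) * a K * b (I - K))"

text \<open>
  The tensor product of two exterior algebras with the super product
  \<open>(\<alpha> \<otimes> \<xi>)(\<beta> \<otimes> \<zeta>) = (-1)\<^bsup>|\<xi>||\<beta>|\<^esup> (\<alpha> \<and> \<beta>) \<otimes> (\<xi> \<and> \<zeta>)\<close>; \<open>u (I, J)\<close> is the coefficient of
  \<open>dx\<^sub>I \<otimes> e\<^sub>J\<close>.
\<close>

type_synonym sext = "nat set \<times> nat set \<Rightarrow> real"

definition monom_sext :: "nat set \<Rightarrow> nat set \<Rightarrow> sext" where
  "monom_sext K L = (\<lambda>IJ. if IJ = (K, L) then 1 else 0)"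

definition super_mult :: "sext \<Rightarrow> sext \<Rightarrow> sext" where
  "super_mult u v = (\<lambda>(I, J). \<Sum>K\<in>Pow I. \<Sum>L\<in>Pow J.
     (-1) ^ (card L * card (I - K)) * shuffle_sign K (I - K) * shuffle_sign L (J - L)
       * u (K, L) * v (I - K, J - L))"

abbreviation dx_gen :: "nat \<Rightarrow> sext" where "dx_gen k \<equiv> monom_sext {k} {}"
abbreviation e_gen :: "nat \<Rightarrow> sext" where "e_gen k \<equiv> monom_sext {} {k}"

definition exp_series :: "('i \<Rightarrow> real) \<Rightarrow> (('i \<Rightarrow> real) \<Rightarrow> ('i \<Rightarrow> real) \<Rightarrow> 'i \<Rightarrow> real)
    \<Rightarrow> ('i \<Rightarrow> real) \<Rightarrow> 'i \<Rightarrow> real" where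
  "exp_series unit prd u = (\<lambda>i. \<Sum>n. ((prd u ^^ n) unit) i / fact n)"

definition ext_exp :: "ext \<Rightarrow> ext" where
  "ext_exp = exp_series (monom_ext {}) wedge"

definition sext_exp :: "sext \<Rightarrow> sext" where
  "sext_exp = exp_series (monom_sext {} {}) super_mult"

definition berezin :: "nat \<Rightarrow> ext \<Rightarrow> real" where
  "berezin d \<xi> = \<xi> {..<d}"

definition berezin_form :: "nat \<Rightarrow> sext \<Rightarrow> ext" where
  "berezin_form d u = (\<lambda>I. berezin d (\<lambda>J. u (I, J)))"


section \<open>Smooth functions and differential forms\<close>

text \<open>\<open>C\<^sup>n\<close> functions on an open set; \<open>frechet_derivative f (at x) v\<close> is the derivative along \<open>v\<close>.\<close>

primrec cont_diff_on :: "nat \<Rightarrow> 'a::real_normed_vector set \<Rightarrow> ('a \<Rightarrow> real) \<Rightarrow> bool" where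
  "cont_diff_on 0 U f \<longleftrightarrow> continuous_on U f"
| "cont_diff_on (Suc n) U f \<longleftrightarrow> (\<forall>x\<in>U. f differentiable (at x)) \<and>
     (\<forall>v. cont_diff_on n U (\<lambda>x. frechet_derivative f (at x) v))"

definition smooth_on :: "'a::real_normed_vector set \<Rightarrow> ('a \<Rightarrow> real) \<Rightarrow> bool" where
  "smooth_on U f \<longleftrightarrow> (\<forall>n. cont_diff_on n U f)"

definition partial :: "(nat \<Rightarrow> 'a::real_normed_vector) \<Rightarrow> nat \<Rightarrow> ('a \<Rightarrow> real) \<Rightarrow> 'a \<Rightarrow> real" where
  "partial e k f = (\<lambda>x. frechet_derivative f (at x) (e k))"

definition rapidly_decreasing ::
    "nat \<Rightarrow> (nat \<Rightarrow> 'a::real_normed_vector) \<Rightarrow> ('a \<Rightarrow> real) \<Rightarrow> bool" where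
  "rapidly_decreasing d e f \<longleftrightarrow>
     (\<forall>ks N. set ks \<subseteq> {..<d} \<longrightarrow>
        (\<exists>C. \<forall>x. (1 + norm x) ^ N * \<bar>foldr (partial e) ks f x\<bar> \<le> C))"

text \<open>
  A form maps a point to its coefficients with respect to the \<open>dx\<^sub>I\<close>, \<open>I \<subseteq> {..<d}\<close>, where
  \<open>x\<^sub>k = \<langle>e k, x\<rangle>\<close>. A form on an open subset \<open>N\<close> of \<open>V\<close> is a function on all of \<open>V\<close> whose values
  outside \<open>N\<close> are irrelevant. Forms need not be homogeneous.
\<close>

type_synonym 'a form = "'a \<Rightarrow> ext"

definition smooth_form :: "nat \<Rightarrow> 'a::real_normed_vector set \<Rightarrow> 'a form \<Rightarrow> bool" where
  "smooth_form d N \<omega> \<longleftrightarrow> (\<forall>I\<subseteq>{..<d}. smooth_on N (\<lambda>x. \<omega> x I))"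

definition fun_form :: "('a \<Rightarrow> real) \<Rightarrow> 'a form" where
  "fun_form f = (\<lambda>x I. f x * monom_ext {} I)"

text \<open>\<open>d\<omega> = \<Sum>\<^sub>k dx\<^sub>k \<and> \<partial>\<^sub>k\<omega>\<close>\<close>

definition ext_d :: "nat \<Rightarrow> (nat \<Rightarrow> 'a::real_normed_vector) \<Rightarrow> 'a form \<Rightarrow> 'a form" where
  "ext_d d e \<omega> = (\<lambda>x I. \<Sum>k<d.
     wedge (monom_ext {k}) (\<lambda>J. partial e k (\<lambda>y. \<omega> y J) x) I)"

text \<open>
  Contraction with a vector field \<open>v\<close>: for \<open>k \<notin> I\<close>, \<open>dx\<^sub>I\<close> occurs in \<open>\<iota>(e k) dx\<^bsub>I \<union> {k}\<^esub>\<close> with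
  sign \<open>(-1)\<^bsup>m\<^esup>\<close>, where \<open>m\<close> is the number of \<open>j \<in> I\<close> with \<open>j < k\<close>.
\<close>

definition contract :: "nat \<Rightarrow> (nat \<Rightarrow> 'a::real_inner) \<Rightarrow> ('a \<Rightarrow> 'a) \<Rightarrow> 'a form \<Rightarrow> 'a form" where
  "contract d e v \<omega> = (\<lambda>x I. \<Sum>k\<in>{..<d} - I.
     (-1) ^ card {j\<in>I. j < k} * inner (e k) (v x) * \<omega> x (insert k I))"

text \<open>
  Pull-back along a linear map \<open>g\<close>: \<open>g\<^sup>*(f dx\<^sub>I) = (f \<circ> g) d(x\<^sub>i\<^sub>1 \<circ> g) \<and> ... \<and> d(x\<^sub>i\<^sub>r \<circ> g)\<close> for
  \<open>I = {i\<^sub>1 < ... < i\<^sub>r}\<close>, with \<open>d(x\<^sub>i \<circ> g) = \<Sum>\<^sub>j \<langle>e i, g (e j)\<rangle> dx\<^sub>j\<close>.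
\<close>

definition pullback_dx :: "nat \<Rightarrow> (nat \<Rightarrow> 'a::real_inner) \<Rightarrow> ('a \<Rightarrow> 'a) \<Rightarrow> nat \<Rightarrow> ext" where
  "pullback_dx d e g i = (\<lambda>J. \<Sum>j<d. inner (e i) (g (e j)) * monom_ext {j} J)"

definition pullback :: "nat \<Rightarrow> (nat \<Rightarrow> 'a::real_inner) \<Rightarrow> ('a \<Rightarrow> 'a) \<Rightarrow> 'a form \<Rightarrow> 'a form" where
  "pullback d e g \<omega> = (\<lambda>x J. \<Sum>I\<in>Pow {..<d}. \<omega> (g x) I *
     foldr wedge (map (pullback_dx d e g) (sorted_list_of_set I)) (monom_ext {}) J)"

text \<open>The integral over \<open>V\<close>, oriented by \<open>dx\<^sub>0 \<and> ... \<and> dx\<^bsub>d-1\<^esub>\<close>, of the top-degree component.\<close>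

definition form_integral :: "nat \<Rightarrow> (nat \<Rightarrow> 'a::real_inner) \<Rightarrow> 'a form \<Rightarrow> real" where
  "form_integral d e \<omega> =
     (\<integral>c. \<omega> (\<Sum>k<d. c k *\<^sub>R e k) {..<d} \<partial>(\<Pi>\<^sub>M k\<in>{..<d}. lborel))"


section \<open>The group \<open>SO(V)\<close>, its Lie algebra, and equivariant forms\<close>

text \<open>The second conjunct is the Leibniz formula for the determinant of \<open>g\<close>.\<close>

definition SO :: "nat \<Rightarrow> (nat \<Rightarrow> 'a::real_inner) \<Rightarrow> ('a \<Rightarrow> 'a) set" where
  "SO d e = {g. orthogonal_transformation g \<and>
     (\<Sum>p | p permutes {..<d}. of_int (sign p) * (\<Prod>i<d. inner (e i) (g (e (p i))))) = (1::real)}"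

text \<open>
  Elements of \<open>so(V)\<close> are taken as bounded linear maps, a normed space, so that polynomials on
  \<open>so(V)\<close> are the restrictions of \<open>real_polynomial_function\<close>s.
\<close>

definition so :: "('a::real_inner \<Rightarrow>\<^sub>L 'a) set" where
  "so = {X. \<forall>v w. inner (blinfun_apply X v) w = - inner v (blinfun_apply X w)}"

definition Ad :: "('a::real_inner \<Rightarrow> 'a) \<Rightarrow> ('a \<Rightarrow>\<^sub>L 'a) \<Rightarrow> ('a \<Rightarrow>\<^sub>L 'a)" where
  "Ad g X = Blinfun (g \<circ> blinfun_apply X \<circ> inv g)"

definition exp_endo :: "('a::real_inner \<Rightarrow>\<^sub>L 'a) \<Rightarrow> 'a \<Rightarrow> 'a" where
  "exp_endo X v = (\<Sum>n. (1 / fact n) *\<^sub>R ((blinfun_apply X ^^ n) v))"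

definition vfield :: "('a::real_inner \<Rightarrow>\<^sub>L 'a) \<Rightarrow> 'a \<Rightarrow> 'a" where
  "vfield X x = vector_derivative (\<lambda>\<epsilon>. exp_endo ((- \<epsilon>) *\<^sub>R X) x) (at 0)"

type_synonym 'a eqform = "('a \<Rightarrow>\<^sub>L 'a) \<Rightarrow> 'a form"

definition eq_on :: "nat \<Rightarrow> 'a::real_inner set \<Rightarrow> 'a eqform \<Rightarrow> 'a eqform \<Rightarrow> bool" where
  "eq_on d N \<alpha> \<beta> \<longleftrightarrow> (\<forall>X\<in>so. \<forall>x\<in>N. \<forall>I\<subseteq>{..<d}. \<alpha> X x I = \<beta> X x I)"

definition equivariant :: "nat \<Rightarrow> (nat \<Rightarrow> 'a::real_inner) \<Rightarrow> 'a set \<Rightarrow> 'a eqform \<Rightarrow> bool" where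
  "equivariant d e N \<alpha> \<longleftrightarrow>
     (\<forall>g\<in>SO d e. eq_on d N (\<lambda>X. \<alpha> (Ad g X)) (\<lambda>X. pullback d e (inv g) (\<alpha> X)))"

definition A_pol :: "nat \<Rightarrow> (nat \<Rightarrow> 'a::real_inner) \<Rightarrow> 'a set \<Rightarrow> 'a eqform set" where
  "A_pol d e N = {\<alpha>. equivariant d e N \<alpha> \<and>
     (\<exists>(m::nat) p \<omega>. (\<forall>j<m. real_polynomial_function (p j) \<and> smooth_form d N (\<omega> j)) \<and>
        eq_on d N \<alpha> (\<lambda>X x I. \<Sum>j<m. p j X * \<omega> j x I))}"

definition A_pol_c :: "nat \<Rightarrow> (nat \<Rightarrow> 'a::real_inner) \<Rightarrow> 'a eqform set" where
  "A_pol_c d e = {\<alpha> \<in> A_pol d e UNIV.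
     compact (closure {x. \<exists>X\<in>so. \<exists>I\<subseteq>{..<d}. \<alpha> X x I \<noteq> 0})}"

definition A_pol_dec_rap :: "nat \<Rightarrow> (nat \<Rightarrow> 'a::real_inner) \<Rightarrow> 'a eqform set" where
  "A_pol_dec_rap d e = {\<alpha> \<in> A_pol d e UNIV.
     \<forall>X\<in>so. \<forall>I\<subseteq>{..<d}. rapidly_decreasing d e (\<lambda>x. \<alpha> X x I)}"

definition D_eq :: "nat \<Rightarrow> (nat \<Rightarrow> 'a::real_inner) \<Rightarrow> 'a eqform \<Rightarrow> 'a eqform" where
  "D_eq d e \<alpha> = (\<lambda>X x I. ext_d d e (\<alpha> X) x I - contract d e (vfield X) (\<alpha> X) x I)"

abbreviation zero_eq :: "'a eqform" where "zero_eq \<equiv> \<lambda>X x I. 0"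


section \<open>Cohomology and Thom classes\<close>

definition closed_eq :: "nat \<Rightarrow> (nat \<Rightarrow> 'a::real_inner) \<Rightarrow> 'a eqform set \<Rightarrow> 'a eqform set" where
  "closed_eq d e A = {\<alpha> \<in> A. eq_on d UNIV (D_eq d e \<alpha>) zero_eq}"

definition cohomologous :: "nat \<Rightarrow> (nat \<Rightarrow> 'a::real_inner) \<Rightarrow> 'a eqform set
    \<Rightarrow> ('a eqform \<times> 'a eqform) set" where
  "cohomologous d e A = {(\<alpha>, \<alpha>'). \<alpha> \<in> closed_eq d e A \<and> \<alpha>' \<in> closed_eq d e A \<and>
     (\<exists>\<gamma>\<in>A. eq_on d UNIV (\<lambda>X x I. \<alpha>' X x I - \<alpha> X x I) (D_eq d e \<gamma>))}"

definition cohomology :: "nat \<Rightarrow> (nat \<Rightarrow> 'a::real_inner) \<Rightarrow> 'a eqform set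
    \<Rightarrow> 'a eqform set set" where
  "cohomology d e A = closed_eq d e A // cohomologous d e A"

definition thom_form :: "nat \<Rightarrow> (nat \<Rightarrow> 'a::real_inner) \<Rightarrow> 'a eqform set \<Rightarrow> 'a eqform \<Rightarrow> bool" where
  "thom_form d e A \<alpha> \<longleftrightarrow>
     \<alpha> \<in> closed_eq d e A \<and> (\<forall>X\<in>so. form_integral d e (\<alpha> X) = 1)"

definition thom_class :: "nat \<Rightarrow> (nat \<Rightarrow> 'a::real_inner) \<Rightarrow> 'a eqform set
    \<Rightarrow> 'a eqform set \<Rightarrow> bool" where
  "thom_class d e A c \<longleftrightarrow>
     c \<in> cohomology d e A \<and> (\<exists>\<alpha>. thom_form d e A \<alpha> \<and> c = cohomologous d e A `` {\<alpha>})"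

subsection \<open>The relative complex\<close>

type_synonym 'a relform = "'a eqform \<times> 'a eqform"

definition A_rel :: "nat \<Rightarrow> (nat \<Rightarrow> 'a::real_inner) \<Rightarrow> 'a relform set" where
  "A_rel d e = A_pol d e UNIV \<times> A_pol d e (UNIV - {0})"

definition eq_rel :: "nat \<Rightarrow> 'a::real_inner relform \<Rightarrow> 'a relform \<Rightarrow> bool" where
  "eq_rel d a b \<longleftrightarrow> eq_on d UNIV (fst a) (fst b) \<and> eq_on d (UNIV - {0}) (snd a) (snd b)"

definition D_rel :: "nat \<Rightarrow> (nat \<Rightarrow> 'a::real_inner) \<Rightarrow> 'a relform \<Rightarrow> 'a relform" where
  "D_rel d e = (\<lambda>(\<alpha>, \<beta>). (D_eq d e \<alpha>, \<lambda>X x I. \<alpha> X x I - D_eq d e \<beta> X x I))"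

definition closed_rel :: "nat \<Rightarrow> (nat \<Rightarrow> 'a::real_inner) \<Rightarrow> 'a relform set" where
  "closed_rel d e = {a \<in> A_rel d e. eq_rel d (D_rel d e a) (zero_eq, zero_eq)}"

definition diff_rel :: "'a::real_inner relform \<Rightarrow> 'a relform \<Rightarrow> 'a relform" where
  "diff_rel a b = (\<lambda>X x I. fst a X x I - fst b X x I, \<lambda>X x I. snd a X x I - snd b X x I)"

definition cohomologous_rel :: "nat \<Rightarrow> (nat \<Rightarrow> 'a::real_inner)
    \<Rightarrow> ('a relform \<times> 'a relform) set" where
  "cohomologous_rel d e = {(a, a'). a \<in> closed_rel d e \<and> a' \<in> closed_rel d e \<and>
     (\<exists>c\<in>A_rel d e. eq_rel d (diff_rel a' a) (D_rel d e c))}"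

definition cohomology_rel :: "nat \<Rightarrow> (nat \<Rightarrow> 'a::real_inner) \<Rightarrow> 'a relform set set" where
  "cohomology_rel d e = closed_rel d e // cohomologous_rel d e"

definition cutoff :: "nat \<Rightarrow> (nat \<Rightarrow> 'a::real_inner) \<Rightarrow> ('a \<Rightarrow> real) \<Rightarrow> bool" where
  "cutoff d e \<rho> \<longleftrightarrow> smooth_on UNIV \<rho> \<and> (\<forall>g\<in>SO d e. \<forall>x. \<rho> (g x) = \<rho> x) \<and>
     compact (closure {x. \<rho> x \<noteq> 0}) \<and> (\<exists>U. open U \<and> 0 \<in> U \<and> (\<forall>x\<in>U. \<rho> x = 1))"

text \<open>With a cutoff \<open>\<rho>\<close>: \<open>\<rho>\<alpha> + d\<rho> \<and> \<beta>\<close>; at the origin the second summand is \<open>0\<close>.\<close>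

definition cut :: "nat \<Rightarrow> (nat \<Rightarrow> 'a::real_inner) \<Rightarrow> ('a \<Rightarrow> real) \<Rightarrow> 'a relform \<Rightarrow> 'a eqform" where
  "cut d e \<rho> = (\<lambda>(\<alpha>, \<beta>) X x I.
     \<rho> x * \<alpha> X x I + wedge (ext_d d e (fun_form \<rho>) x) (\<beta> X x) I)"

text \<open>The integral of a closed relative form does not depend on the cutoff.\<close>

definition thom_form_rel :: "nat \<Rightarrow> (nat \<Rightarrow> 'a::real_inner) \<Rightarrow> 'a relform \<Rightarrow> bool" where
  "thom_form_rel d e a \<longleftrightarrow> a \<in> closed_rel d e \<and>
     (\<forall>\<rho>. cutoff d e \<rho> \<longrightarrow> (\<forall>X\<in>so. form_integral d e (cut d e \<rho> a X) = 1))"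

definition thom_class_rel :: "nat \<Rightarrow> (nat \<Rightarrow> 'a::real_inner) \<Rightarrow> 'a relform set \<Rightarrow> bool" where
  "thom_class_rel d e c \<longleftrightarrow>
     c \<in> cohomology_rel d e \<and> (\<exists>a. thom_form_rel d e a \<and> c = cohomologous_rel d e `` {a})"


section \<open>The explicit forms\<close>

definition eps :: "nat \<Rightarrow> real" where
  "eps d = (-1) ^ (d * (d - 1) div 2) * pi powr (real d / 2)"

definition Pf :: "nat \<Rightarrow> (nat \<Rightarrow> 'a::real_inner) \<Rightarrow> ('a \<Rightarrow>\<^sub>L 'a) \<Rightarrow> real" where
  "Pf d e X = berezin d (ext_exp (\<lambda>I. \<Sum>l<d. \<Sum>k<l.
     inner (X (e k)) (e l) * wedge (monom_ext {k}) (monom_ext {l}) I))"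

definition Pf_half :: "nat \<Rightarrow> (nat \<Rightarrow> 'a::real_inner) \<Rightarrow> 'a eqform" where
  "Pf_half d e X = fun_form (\<lambda>x. Pf d e ((1 / 2) *\<^sub>R X))"

definition f_t :: "nat \<Rightarrow> (nat \<Rightarrow> 'a::real_inner) \<Rightarrow> real \<Rightarrow> ('a \<Rightarrow>\<^sub>L 'a) \<Rightarrow> 'a \<Rightarrow> sext" where
  "f_t d e t X x = (\<lambda>IJ.
     - (t\<^sup>2 * (norm x)\<^sup>2) * monom_sext {} {} IJ
     + t * (\<Sum>k<d. super_mult (dx_gen k) (e_gen k) IJ)
     + 1 / 2 * (\<Sum>l<d. \<Sum>k<l. inner (X (e k)) (e l) * super_mult (e_gen k) (e_gen l) IJ))"

definition eta_wedge :: "nat \<Rightarrow> (nat \<Rightarrow> 'a::real_inner) \<Rightarrow> real \<Rightarrow> 'a eqform" where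
  "eta_wedge d e t X x = (\<lambda>I. - berezin_form d
     (super_mult (\<lambda>IJ. \<Sum>k<d. inner (e k) x * e_gen k IJ) (sext_exp (f_t d e t X x))) I)"

definition beta_wedge :: "nat \<Rightarrow> (nat \<Rightarrow> 'a::real_inner) \<Rightarrow> 'a eqform" where
  "beta_wedge d e X x = (\<lambda>I. LBINT t:{0..}. eta_wedge d e t X x I)"

definition Th_rel :: "nat \<Rightarrow> (nat \<Rightarrow> 'a::real_inner) \<Rightarrow> 'a relform" where
  "Th_rel d e = (\<lambda>X x I. 1 / eps d * Pf_half d e X x I, \<lambda>X x I. 1 / eps d * beta_wedge d e X x I)"

definition Th_c :: "nat \<Rightarrow> (nat \<Rightarrow> 'a::real_inner) \<Rightarrow> ('a \<Rightarrow> real) \<Rightarrow> 'a eqform" where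
  "Th_c d e \<rho> = (\<lambda>X x I. 1 / eps d *
     (\<rho> x * Pf_half d e X x I + wedge (ext_d d e (fun_form \<rho>) x) (beta_wedge d e X x) I))"

definition Th_MQ :: "nat \<Rightarrow> (nat \<Rightarrow> 'a::real_inner) \<Rightarrow> 'a eqform" where
  "Th_MQ d e = (\<lambda>X x I. 1 / eps d * berezin_form d (sext_exp (f_t d e 1 X x)) I)"

end

theory Submission
  imports Defs "HOL-Probability.Distributions" "Jordan_Normal_Form.Determinant"
begin

text \<open>
  The degree-two part \<open>N\<close> of \<open>f_t(X)\<close> does not depend on the point \<open>x\<close> and is nilpotent, hence
  \<open>T(exp f_t(X)) = exp (- t\<^sup>2\<parallel>x\<parallel>\<^sup>2) \<Sum>\<^sub>I t\<^bsup>|I|\<^esup> c\<^sub>I(X) dx\<^sub>I\<close> with polynomials \<open>c\<^sub>I\<close>, and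
  \<open>\<eta>\<^sup>t\<close> is, up to sign, the contraction of the same sum with the Euler field \<open>x\<close>. Everything reduces to the
  element \<open>c = \<Sum>\<^sub>I c\<^sub>I dx\<^sub>I\<close> of an exterior algebra: \<open>\<iota>(Xx)c = 2 (\<Sum>\<^sub>k x\<^sub>k dx\<^sub>k) \<and> c\<close> gives closedness of the
  Mathai-Quillen form and, with the recursion of the Gaussian moments, \<open>D\<beta> = Pf(X/2)\<close> away from the origin. An
  orthogonal substitution of the generators multiplies the top power of the second factor by its determinant,
  which gives equivariance. An invariant function has radial gradient, so \<open>d\<rho>\<close> is killed by the contraction
  with \<open>VX\<close> and \<open>D(\<rho> Pf(X/2) + d\<rho> \<and> \<beta>) = d\<rho> \<and> (Pf(X/2) - D\<beta>) = 0\<close>. Its integral is that of the radial derivative of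
  \<open>\<rho>\<close> against \<open>\<integral> t\<^bsup>d-1\<^esup> exp (- t\<^sup>2\<parallel>x\<parallel>\<^sup>2) dt\<close>; rescaling \<open>x\<close> by \<open>t\<close> turns it into a Gaussian integral.
\<close>

text \<open>The usual proof of \<open>D\<beta> = Pf(X/2)\<close> is by transgression: the derivative
  of T(exp f_t) in t is exact, and one integrates it over t. Here the t-integral in each coefficient
  of \<beta> is a half-line Gaussian moment divided by a power of the norm of x. So D\<beta> is
  computed by ordinary differentiation, without exchanging derivative and integral; the
  transgression survives as the recursion of the moments, whose boundary value at t = 0 leaves the
  Pfaffian. The vector field is VX = - X x, so D acts as d + \<iota>(X x). For d = 1 the group SO(V)
  is trivial, and an invariant cutoff need not depend on the norm alone. Therefore only the
  direction of its gradient is used, and its derivative is integrated along each ray separately. The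
  number eps_d is the Gaussian integral pi^(d/2) times the sign for sorting dx_1 e_1 ... dx_d e_d
  into dx_1 ... dx_d e_1 ... e_d.\<close>

unbundle no m_inv_syntax

section \<open>Shuffle signs\<close>

text \<open>The sign for sorting a generator \<open>k\<close>, placed in front of the ordered
  monomial of \<open>I\<close>, into that monomial. Within one exterior algebra, multiplication and
  contraction by a single generator involve no other sign.\<close>

definition ins_sign :: "nat \<Rightarrow> nat set \<Rightarrow> real" where
  "ins_sign k I = (-1) ^ card {i \<in> I. i < k}"

lemma shuffle_sign_singleton: "shuffle_sign {k} L = ins_sign k L"
proof -
  have "{(k', l). k' \<in> {k} \<and> l \<in> L \<and> l < k'} = Pair k ` {i \<in> L. i < k}"
    by auto
  then show ?thesis
    by (simp add: shuffle_sign_def ins_sign_def card_image inj_on_def)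
qed

lemma shuffle_sign_empty [simp]: "shuffle_sign {} L = 1" "shuffle_sign K {} = 1"
  by (simp_all add: shuffle_sign_def)

lemma ins_sign_empty [simp]: "ins_sign k {} = 1"
  by (simp add: ins_sign_def)

lemma ins_sign_square [simp]: "ins_sign k I * ins_sign k I = 1"
  by (simp add: ins_sign_def flip: power_mult_distrib)

lemma ins_sign_square' [simp]: "ins_sign k I * (ins_sign k I * a) = a"
  by (simp flip: mult.assoc)

lemma ins_sign_insert:
  assumes "finite I" "k \<notin> I"
  shows "ins_sign j (insert k I) = (if k < j then - ins_sign j I else ins_sign j I)"
proof (cases "k < j")
  case True
  then have "{i \<in> insert k I. i < j} = insert k {i \<in> I. i < j}"
    by auto
  with assms True show ?thesis
    by (simp add: ins_sign_def)
next
  case False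
  then have "{i \<in> insert k I. i < j} = {i \<in> I. i < j}"
    by auto
  with False show ?thesis
    by (simp add: ins_sign_def)
qed

lemma ins_sign_remove:
  assumes "finite I" "k \<in> I"
  shows "ins_sign j (I - {k}) = (if k < j then - ins_sign j I else ins_sign j I)"
  using ins_sign_insert[of "I - {k}" k j] assms by (auto simp: insert_absorb)

lemma ins_sign_self [simp]: "ins_sign k (insert k I) = ins_sign k I" "ins_sign k (I - {k}) = ins_sign k I"
proof -
  have "{i \<in> insert k I. i < k} = {i \<in> I. i < k}" "{i \<in> I - {k}. i < k} = {i \<in> I. i < k}"
    by auto
  then show "ins_sign k (insert k I) = ins_sign k I" "ins_sign k (I - {k}) = ins_sign k I"
    unfolding ins_sign_def by simp_all
qed

lemma ins_sign_lessThan: "ins_sign m {..<n} = (-1) ^ min m n"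
proof -
  have "{i \<in> {..<n}. i < m} = {..<min m n}"
    by auto
  then show ?thesis
    by (simp add: ins_sign_def)
qed

text \<open>Inversions against a disjoint union are counted separately for its two parts. The
  resulting multiplicativity of the signs is what makes the super product associative.\<close>

lemma shuffle_sign_Un:
  assumes "finite K" "finite K'" "finite M" "K \<inter> K' = {}"
  shows "shuffle_sign (K \<union> K') M = shuffle_sign K M * shuffle_sign K' M"
    and "shuffle_sign M (K \<union> K') = shuffle_sign M K * shuffle_sign M K'"
proof -
  have fin: "finite {(k, l). k \<in> A \<and> l \<in> B \<and> l < k}" if "finite A" "finite B" for A B :: "nat set"
    by (rule finite_subset[of _ "A \<times> B"]) (use that in auto)
  have 1: "{(k, l). k \<in> K \<union> K' \<and> l \<in> M \<and> l < k} =
      {(k, l). k \<in> K \<and> l \<in> M \<and> l < k} \<union> {(k, l). k \<in> K' \<and> l \<in> M \<and> l < k}"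
    by auto
  have 2: "{(k, l). k \<in> M \<and> l \<in> K \<union> K' \<and> l < k} =
      {(k, l). k \<in> M \<and> l \<in> K \<and> l < k} \<union> {(k, l). k \<in> M \<and> l \<in> K' \<and> l < k}"
    by auto
  show "shuffle_sign (K \<union> K') M = shuffle_sign K M * shuffle_sign K' M"
    unfolding shuffle_sign_def 1
    by (subst card_Un_disjoint) (use assms in \<open>auto simp: fin power_add\<close>)
  show "shuffle_sign M (K \<union> K') = shuffle_sign M K * shuffle_sign M K'"
    unfolding shuffle_sign_def 2
    by (subst card_Un_disjoint) (use assms in \<open>auto simp: fin power_add\<close>)
qed

definition super_sign :: "nat set \<Rightarrow> nat set \<Rightarrow> nat set \<Rightarrow> nat set \<Rightarrow> real" where
  "super_sign K L M N = (-1) ^ (card L * card M) * shuffle_sign K M * shuffle_sign L N"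

lemma super_sign_Un:
  assumes "finite K" "finite K'" "finite L" "finite L'" "finite M" "finite N"
    and "K \<inter> K' = {}" "L \<inter> L' = {}"
  shows "super_sign (K \<union> K') (L \<union> L') M N = super_sign K L M N * super_sign K' L' M N"
    and "super_sign M N (K \<union> K') (L \<union> L') = super_sign M N K L * super_sign M N K' L'"
  using assms
  by (auto simp: super_sign_def shuffle_sign_Un card_Un_disjoint add_mult_distrib add_mult_distrib2 power_add)

lemma super_mult_super_sign:
  "super_mult u v (I, J) = (\<Sum>K\<in>Pow I. \<Sum>L\<in>Pow J. super_sign K L (I - K) (J - L) * u (K, L) * v (I - K, J - L))"
  by (simp add: super_mult_def super_sign_def)

text \<open>Both sides run over the ordered splittings of \<open>I\<close> into three possibly empty
  pieces; the left one cuts off the last piece first, the right one the first. This regroups the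
  sums of a triple product.\<close>

lemma sum_Pow_Pow_Diff:
  fixes f :: "'b set \<Rightarrow> 'b set \<Rightarrow> 'b set \<Rightarrow> 'c::comm_monoid_add"
  assumes "finite I"
  shows "(\<Sum>A\<in>Pow I. \<Sum>K\<in>Pow A. f K (A - K) (I - A)) = (\<Sum>K\<in>Pow I. \<Sum>M\<in>Pow (I - K). f K M (I - K - M))"
proof -
  have "(\<Sum>A\<in>Pow I. \<Sum>K\<in>Pow A. f K (A - K) (I - A)) =
      (\<Sum>(A, K)\<in>(SIGMA A:Pow I. Pow A). f K (A - K) (I - A))"
    using assms by (subst sum.Sigma) (auto intro: finite_subset)
  also have "\<dots> = (\<Sum>(K, M)\<in>(SIGMA K:Pow I. Pow (I - K)). f K M (I - K - M))"
  proof (rule sum.reindex_bij_witness[of _ "\<lambda>(K, M). (K \<union> M, K)" "\<lambda>(A, K). (K, A - K)"], goal_cases)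
    case (5 a)
    then obtain A K where "a = (A, K)" "A \<subseteq> I" "K \<subseteq> A"
      by auto
    moreover from this have "I - K - (A - K) = I - A"
      by blast
    ultimately show ?case
      by simp
  qed auto
  also have "\<dots> = (\<Sum>K\<in>Pow I. \<Sum>M\<in>Pow (I - K). f K M (I - K - M))"
    using assms by (subst sum.Sigma) auto
  finally show ?thesis .
qed

lemma super_mult_assoc:
  assumes "finite I" "finite J"
  shows "super_mult (super_mult u v) w (I, J) = super_mult u (super_mult v w) (I, J)"
proof -
  \<comment> \<open>The contribution of three monomials to a triple product, with one sign for each
    pair of factors; both bracketings give it.\<close>
  define F where "F K M P L N Q = super_sign K L M N * super_sign K L P Q * super_sign M N P Q
      * (u (K, L) * v (M, N) * w (P, Q))" for K M P L N Q
  have fin: "finite A" if "A \<subseteq> I \<or> A \<subseteq> J" for A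
    using that assms by (auto intro: finite_subset)
  have "super_mult (super_mult u v) w (I, J) =
      (\<Sum>A\<in>Pow I. \<Sum>B\<in>Pow J. \<Sum>K\<in>Pow A. \<Sum>L\<in>Pow B. F K (A - K) (I - A) L (B - L) (J - B))"
    unfolding super_mult_super_sign sum_distrib_left sum_distrib_right
  proof (intro sum.cong refl)
    fix A B K L assume *: "A \<in> Pow I" "B \<in> Pow J" "K \<in> Pow A" "L \<in> Pow B"
    then have "super_sign (K \<union> (A - K)) (L \<union> (B - L)) (I - A) (J - B) =
        super_sign K L (I - A) (J - B) * super_sign (A - K) (B - L) (I - A) (J - B)"
      by (intro super_sign_Un fin) auto
    moreover have "K \<union> (A - K) = A" "L \<union> (B - L) = B"
      using * by auto
    ultimately show "super_sign A B (I - A) (J - B) * (super_sign K L (A - K) (B - L) * u (K, L) * v (A - K, B - L)) * w (I - A, J - B) = F K (A - K) (I - A) L (B - L) (J - B)"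
      by (simp add: F_def)
  qed
  also have "\<dots> = (\<Sum>A\<in>Pow I. \<Sum>K\<in>Pow A. \<Sum>B\<in>Pow J. \<Sum>L\<in>Pow B. F K (A - K) (I - A) L (B - L) (J - B))"
    by (intro sum.cong refl sum.swap)
  also have "\<dots> = (\<Sum>A\<in>Pow I. \<Sum>K\<in>Pow A. \<Sum>L\<in>Pow J. \<Sum>N\<in>Pow (J - L). F K (A - K) (I - A) L N (J - L - N))"
    by (intro sum.cong refl sum_Pow_Pow_Diff assms)
  also have "\<dots> = (\<Sum>K\<in>Pow I. \<Sum>M\<in>Pow (I - K). \<Sum>L\<in>Pow J. \<Sum>N\<in>Pow (J - L). F K M (I - K - M) L N (J - L - N))"
    by (rule sum_Pow_Pow_Diff[OF assms(1)])
  also have "\<dots> = (\<Sum>K\<in>Pow I. \<Sum>L\<in>Pow J. \<Sum>M\<in>Pow (I - K). \<Sum>N\<in>Pow (J - L). F K M (I - K - M) L N (J - L - N))"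
    by (intro sum.cong refl sum.swap)
  also have "\<dots> = super_mult u (super_mult v w) (I, J)"
    unfolding super_mult_super_sign sum_distrib_left sum_distrib_right
  proof (intro sum.cong refl)
    fix K L M N assume *: "K \<in> Pow I" "L \<in> Pow J" "M \<in> Pow (I - K)" "N \<in> Pow (J - L)"
    then have "super_sign K L (M \<union> (I - K - M)) (N \<union> (J - L - N)) =
        super_sign K L M N * super_sign K L (I - K - M) (J - L - N)"
      by (intro super_sign_Un fin) auto
    moreover have "M \<union> (I - K - M) = I - K" "N \<union> (J - L - N) = J - L"
      using * by auto
    ultimately show "F K M (I - K - M) L N (J - L - N) = super_sign K L (I - K) (J - L) * u (K, L) * (super_sign M N (I - K - M) (J - L - N) * v (M, N) * w (I - K - M, J - L - N))"
      by (simp add: F_def)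
  qed
  finally show ?thesis .
qed


section \<open>The super tensor product as a ring\<close>

text \<open>
  \<open>super_mult\<close> vanishes at pairs with an infinite component, so its unit is two-sided only on elements
  that vanish there too.
\<close>

typedef superalg = "{u :: sext. \<forall>I J. infinite I \<or> infinite J \<longrightarrow> u (I, J) = 0}"
  morphisms sup_rep Sup_abs
  by (rule exI[of _ "\<lambda>_. 0"]) simp

setup_lifting type_definition_superalg

lift_definition cf :: "superalg \<Rightarrow> nat set \<Rightarrow> nat set \<Rightarrow> real" is "\<lambda>u I J. u (I, J)" .

lemma superalg_eqI:
  assumes "\<And>I J. finite I \<Longrightarrow> finite J \<Longrightarrow> cf u I J = cf v I J"
  shows "u = v"
proof -
  have "sup_rep u (I, J) = sup_rep v (I, J)" for I J
    using assms[of I J] sup_rep[of u] sup_rep[of v] by (cases "finite I \<and> finite J") (auto simp: cf.rep_eq)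
  then show ?thesis
    by (simp add: fun_eq_iff flip: sup_rep_inject)
qed

lemma super_mult_infinite: "infinite I \<or> infinite J \<Longrightarrow> super_mult u v (I, J) = 0"
  by (auto simp: super_mult_def)

lemma super_mult_one_left: "finite I \<Longrightarrow> finite J \<Longrightarrow> super_mult (monom_sext {} {}) u (I, J) = u (I, J)"
proof -
  assume fin: "finite I" "finite J"
  have "super_mult (monom_sext {} {}) u (I, J) =
    (\<Sum>K\<in>Pow I. if K = {} then \<Sum>L\<in>Pow J. if L = {} then u (I, J) else 0 else 0)"
    unfolding super_mult_super_sign
    by (intro sum.cong refl) (auto simp: monom_sext_def super_sign_def intro!: sum.cong sum.neutral)
  with fin show ?thesis
    by simp
qed

lemma super_mult_one_right: "finite I \<Longrightarrow> finite J \<Longrightarrow> super_mult u (monom_sext {} {}) (I, J) = u (I, J)"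
proof -
  assume fin: "finite I" "finite J"
  have "super_mult u (monom_sext {} {}) (I, J) =
    (\<Sum>K\<in>Pow I. if K = I then \<Sum>L\<in>Pow J. if L = J then u (I, J) else 0 else 0)"
    unfolding super_mult_super_sign
    by (intro sum.cong refl) (auto simp: monom_sext_def super_sign_def intro!: sum.cong sum.neutral)
  with fin show ?thesis
    by simp
qed

instantiation superalg :: real_algebra_1
begin

lift_definition zero_superalg :: superalg is "\<lambda>_. 0" by simp
lift_definition one_superalg :: superalg is "monom_sext {} {}" by (auto simp: monom_sext_def)
lift_definition plus_superalg :: "superalg \<Rightarrow> superalg \<Rightarrow> superalg" is "\<lambda>u v i. u i + v i" by simp
lift_definition minus_superalg :: "superalg \<Rightarrow> superalg \<Rightarrow> superalg" is "\<lambda>u v i. u i - v i" by simp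
lift_definition uminus_superalg :: "superalg \<Rightarrow> superalg" is "\<lambda>u i. - u i" by simp
lift_definition scaleR_superalg :: "real \<Rightarrow> superalg \<Rightarrow> superalg" is "\<lambda>r u i. r * u i" by simp
lift_definition times_superalg :: "superalg \<Rightarrow> superalg \<Rightarrow> superalg" is super_mult
  by (simp add: super_mult_infinite)

instance
proof
  fix a b c :: superalg and x y :: real
  show "a * b * c = a * (b * c)"
    by transfer (metis (no_types, lifting) ext super_mult_assoc super_mult_infinite surj_pair)
  show "1 * a = a"
    by transfer (metis (no_types, lifting) ext super_mult_one_left super_mult_infinite surj_pair)
  show "a * 1 = a"
    by transfer (metis (no_types, lifting) ext super_mult_one_right super_mult_infinite surj_pair)
  show "(0::superalg) \<noteq> 1"
    by transfer (auto simp: monom_sext_def fun_eq_iff)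
  show "(a + b) * c = a * c + b * c" "a * (b + c) = a * b + a * c"
    "(x *\<^sub>R a) * b = x *\<^sub>R (a * b)" "a * (x *\<^sub>R b) = x *\<^sub>R (a * b)"
    by (transfer; auto simp: fun_eq_iff super_mult_super_sign sum_distrib_left algebra_simps sum.distrib)+
qed (transfer; auto simp: fun_eq_iff algebra_simps)+

end

lemma cf_zero [simp]: "cf 0 I J = 0" by transfer simp
lemma cf_one: "cf 1 I J = (if I = {} \<and> J = {} then 1 else 0)" by transfer (simp add: monom_sext_def)
lemma cf_add [simp]: "cf (u + v) I J = cf u I J + cf v I J" by transfer simp
lemma cf_diff [simp]: "cf (u - v) I J = cf u I J - cf v I J" by transfer simp
lemma cf_minus [simp]: "cf (- u) I J = - cf u I J" by transfer simp
lemma cf_scaleR [simp]: "cf (r *\<^sub>R u) I J = r * cf u I J" by transfer simp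
lemma cf_sum [simp]: "cf (sum f A) I J = (\<Sum>a\<in>A. cf (f a) I J)"
  by (induction A rule: infinite_finite_induct) auto
lemma cf_mult: "cf (u * v) I J = (\<Sum>K\<in>Pow I. \<Sum>L\<in>Pow J. super_sign K L (I - K) (J - L) * cf u K L * cf v (I - K) (J - L))"
  by transfer (simp add: super_mult_super_sign)
lemma cf_infinite: "infinite I \<or> infinite J \<Longrightarrow> cf u I J = 0" by transfer auto

lift_definition dX :: "nat \<Rightarrow> superalg" is dx_gen by (auto simp: monom_sext_def)
lift_definition eE :: "nat \<Rightarrow> superalg" is e_gen by (auto simp: monom_sext_def)

lemma sup_rep_simps:
  "sup_rep (u + v) = (\<lambda>i. sup_rep u i + sup_rep v i)" "sup_rep (u - v) = (\<lambda>i. sup_rep u i - sup_rep v i)"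
  "sup_rep (r *\<^sub>R u) = (\<lambda>i. r * sup_rep u i)"
  "sup_rep (u * v) = super_mult (sup_rep u) (sup_rep v)" "sup_rep 1 = monom_sext {} {}"
  "sup_rep 0 = (\<lambda>i. 0)" "sup_rep (dX k) = dx_gen k" "sup_rep (eE k) = e_gen k"
  by (transfer; simp)+

lemma sup_rep_sum: "sup_rep (sum f A) = (\<lambda>i. \<Sum>a\<in>A. sup_rep (f a) i)"
  by (induction A rule: infinite_finite_induct) (auto simp: sup_rep_simps)

lemma sup_rep_eq_cf: "sup_rep u (I, J) = cf u I J"
  by transfer simp

lemma cf_dX_mult:
  "cf (dX k * u) I J = (if k \<in> I then ins_sign k I * cf u (I - {k}) J else 0)"
proof (cases "finite I \<and> finite J")
  case True
  have "cf (dX k * u) I J = (\<Sum>K\<in>Pow I. if K = {k} then \<Sum>L\<in>Pow J. if L = {} then ins_sign k I * cf u (I - {k}) J else 0 else 0)"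
    unfolding cf_mult
    by (intro sum.cong refl; transfer)
      (auto simp: monom_sext_def super_sign_def shuffle_sign_singleton intro!: sum.cong sum.neutral)
  with True show ?thesis
    by auto
qed (auto simp: cf_infinite)

lemma cf_eE_mult:
  "cf (eE k * u) I J = (if k \<in> J then (-1) ^ card I * ins_sign k J * cf u I (J - {k}) else 0)"
proof (cases "finite I \<and> finite J")
  case True
  have "cf (eE k * u) I J = (\<Sum>K\<in>Pow I. if K = {} then \<Sum>L\<in>Pow J. if L = {k} then (-1) ^ card I * ins_sign k J * cf u I (J - {k}) else 0 else 0)"
    unfolding cf_mult
    by (intro sum.cong refl; transfer)
      (auto simp: monom_sext_def super_sign_def shuffle_sign_singleton intro!: sum.cong sum.neutral)
  with True show ?thesis
    by auto
qed (auto simp: cf_infinite)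

lemma dX_anticomm: "dX j * dX k = - (dX k * dX j)"
proof (rule superalg_eqI)
  fix I J :: "nat set" assume fin: "finite I" "finite J"
  have "cf (dX j * (dX k * 1)) I J = cf (- (dX k * (dX j * 1))) I J"
    using fin by (auto simp: cf_dX_mult ins_sign_remove insert_commute Diff_insert2[symmetric] simp del: mult_1_right)
  then show "cf (dX j * dX k) I J = cf (- (dX k * dX j)) I J"
    by simp
qed

lemma eE_anticomm: "eE j * eE k = - (eE k * eE j)"
proof (rule superalg_eqI)
  fix I J :: "nat set" assume fin: "finite I" "finite J"
  have "cf (eE j * (eE k * 1)) I J = cf (- (eE k * (eE j * 1))) I J"
    using fin by (auto simp: cf_eE_mult ins_sign_remove insert_commute Diff_insert2[symmetric] simp del: mult_1_right)
  then show "cf (eE j * eE k) I J = cf (- (eE k * eE j)) I J"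
    by simp
qed

lemma eE_dX_anticomm: "eE j * dX k = - (dX k * eE j)"
proof (rule superalg_eqI)
  fix I J :: "nat set" assume fin: "finite I" "finite J"
  have "cf (eE j * (dX k * 1)) I J = cf (- (dX k * (eE j * 1))) I J"
    using fin by (cases "k \<in> I"; cases "card I") (auto simp: cf_eE_mult cf_dX_mult card_Diff_singleton simp del: mult_1_right)
  then show "cf (eE j * dX k) I J = cf (- (dX k * eE j)) I J"
    by simp
qed

lemma dX_eE_anticomm: "dX j * eE k = - (eE k * dX j)"
  by (simp add: eE_dX_anticomm)

lemma superalg_double_zero: "(u :: superalg) = - u \<Longrightarrow> u = 0"
proof -
  assume "u = - u"
  then have "2 *\<^sub>R u = 0"
    by (metis add.right_inverse scaleR_2)
  then show "u = 0"
    by simp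
qed

section \<open>Contractions with the generators\<close>

lift_definition ctr_dX :: "nat \<Rightarrow> superalg \<Rightarrow> superalg" is
  "\<lambda>k u (I, J). if k \<in> I then 0 else ins_sign k I * u (insert k I, J)"
  by auto

text \<open>The extra \<open>(-1) ^ card I\<close> accounts for passing the \<open>dX\<close>
  factors, which stand in front; with it \<open>ctr_dX\<close> and \<open>ctr_eE\<close> are odd
  derivations of one and the same super product.\<close>

lift_definition ctr_eE :: "nat \<Rightarrow> superalg \<Rightarrow> superalg" is
  "\<lambda>k u (I, J). if k \<in> J then 0 else (-1) ^ card I * ins_sign k J * u (I, insert k J)"
  by auto

lemma cf_ctr_dX: "cf (ctr_dX k u) I J = (if k \<in> I then 0 else ins_sign k I * cf u (insert k I) J)"
  by transfer simp

lemma cf_ctr_eE: "cf (ctr_eE k u) I J = (if k \<in> J then 0 else (-1) ^ card I * ins_sign k J * cf u I (insert k J))"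
  by transfer simp

lemma linear_ctr_dX: "linear (ctr_dX k)"
  by (rule linearI; rule superalg_eqI) (auto simp: cf_ctr_dX algebra_simps)

lemma linear_ctr_eE: "linear (ctr_eE k)"
  by (rule linearI; rule superalg_eqI) (auto simp: cf_ctr_eE algebra_simps)

lemma ctr_one [simp]: "ctr_dX k 1 = 0" "ctr_eE k 1 = 0"
  by (rule superalg_eqI; simp add: cf_ctr_dX cf_ctr_eE cf_one)+

text \<open>The odd Leibniz rule is needed only when the first factor is a generator: the exponent
  is a sum of products of two generators, and its powers are treated by induction.\<close>

lemma ctr_dX_dX: "ctr_dX j (dX k * u) = (if j = k then u else 0) - dX k * ctr_dX j u"
  by (rule superalg_eqI)
    (auto simp: cf_ctr_dX cf_dX_mult ins_sign_remove ins_sign_insert insert_Diff_if insert_absorb)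

lemma ctr_dX_eE: "ctr_dX j (eE k * u) = - (eE k * ctr_dX j u)"
  by (rule superalg_eqI) (auto simp: cf_ctr_dX cf_eE_mult)

lemma alternating_sign_cancel: "(-1 :: real) ^ n * (a * ((-1) ^ n * b)) = a * b"
  by (simp add: mult.left_commute[of a] flip: mult.assoc power_mult_distrib)

lemma ctr_eE_eE: "ctr_eE j (eE k * u) = (if j = k then u else 0) - eE k * ctr_eE j u"
  by (rule superalg_eqI)
    (auto simp: cf_ctr_eE cf_eE_mult ins_sign_remove ins_sign_insert insert_Diff_if insert_absorb alternating_sign_cancel)

lemma ctr_eE_dX: "ctr_eE j (dX k * u) = - (dX k * ctr_eE j u)"
proof (rule superalg_eqI)
  fix I J :: "nat set" assume fin: "finite I" "finite J"
  show "cf (ctr_eE j (dX k * u)) I J = cf (- (dX k * ctr_eE j u)) I J"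
    using fin by (cases "k \<in> I"; cases "card I") (auto simp: cf_ctr_eE cf_dX_mult card_Diff_singleton)
qed


subsection \<open>The exponent\<close>

text \<open>
  \<open>f_t\<close> without its scalar term; the sum over \<open>k < l\<close> is written over all pairs, which turns the factor
  \<open>1/2\<close> into \<open>1/4\<close>.
\<close>

definition expo :: "nat \<Rightarrow> real \<Rightarrow> (nat \<Rightarrow> nat \<Rightarrow> real) \<Rightarrow> superalg" where
  "expo d t X = t *\<^sub>R (\<Sum>k<d. dX k * eE k) + (1 / 4) *\<^sub>R (\<Sum>k<d. \<Sum>l<d. X k l *\<^sub>R (eE k * eE l))"

text \<open>The exponent is quadratic in the generators, so moving \<open>g\<close> past it changes
  the sign twice. Commutation is what lets the chain rule for the exponential hold in this
  noncommutative ring.\<close>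

lemma gen_expo_commute:
  assumes "\<And>k. g * dX k = - (dX k * g)" "\<And>k. g * eE k = - (eE k * g)"
  shows "g * expo d t X = expo d t X * g"
proof -
  have 1: "g * (dX k * eE k) = dX k * eE k * g" for k
    by (metis assms minus_minus mult.assoc mult_minus_left mult_minus_right)
  have 2: "g * (eE k * eE l) = eE k * eE l * g" for k l
    by (metis assms minus_minus mult.assoc mult_minus_left mult_minus_right)
  show ?thesis
    by (simp add: expo_def distrib_left distrib_right sum_distrib_left sum_distrib_right 1 2)
qed

lemma dX_expo_commute: "dX k * expo d t X = expo d t X * dX k"
  by (rule gen_expo_commute) (rule dX_anticomm dX_eE_anticomm)+

lemma eE_expo_commute: "eE k * expo d t X = expo d t X * eE k"
  by (rule gen_expo_commute) (rule eE_anticomm eE_dX_anticomm)+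

lemma ctr_dX_expo:
  assumes "j < d"
  shows "ctr_dX j (expo d t X * u) = (t *\<^sub>R eE j) * u + expo d t X * ctr_dX j u"
proof -
  have 1: "ctr_dX j (dX k * eE k * u) = (if j = k then eE k * u else 0) + dX k * eE k * ctr_dX j u" for k
    by (simp add: mult.assoc ctr_dX_dX ctr_dX_eE)
  have 2: "ctr_dX j (eE k * eE l * u) = eE k * eE l * ctr_dX j u" for k l
    by (simp add: mult.assoc ctr_dX_eE)
  note lin = linear_add[OF linear_ctr_dX] linear_scale[OF linear_ctr_dX] linear_sum[OF linear_ctr_dX]
  have "ctr_dX j (expo d t X * u) = t *\<^sub>R (\<Sum>k<d. (if j = k then eE k * u else 0)) + expo d t X * ctr_dX j u"
    by (simp add: expo_def distrib_right sum_distrib_right lin 1 2 sum.distrib scaleR_right_distrib add_ac)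
  with assms show ?thesis
    by simp
qed

text \<open>Contraction hits \<open>eE j\<close> in either position of the quadratic term;
  antisymmetry of \<open>X\<close> makes both contributions equal, which turns \<open>1 / 4\<close>
  into \<open>1 / 2\<close>. The minus sign before \<open>t *\<^sub>R dX j\<close> comes from
  passing \<open>dX j\<close> in \<open>dX j * eE j\<close>.\<close>

lemma ctr_eE_expo:
  assumes "j < d" and anti: "\<And>k l. X l k = - X k l"
  shows "ctr_eE j (expo d t X * u) =
    (- (t *\<^sub>R dX j) + (1 / 2) *\<^sub>R (\<Sum>l<d. X j l *\<^sub>R eE l)) * u + expo d t X * ctr_eE j u"
proof -
  have 1: "ctr_eE j (dX k * eE k * u) = (if j = k then - (dX k * u) else 0) + dX k * eE k * ctr_eE j u" for k
    by (simp add: mult.assoc ctr_eE_dX ctr_eE_eE right_diff_distrib)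
  have 2: "ctr_eE j (eE k * eE l * u) =
      ((if j = k then eE l * u else 0) - (if j = l then eE k * u else 0)) + eE k * eE l * ctr_eE j u" for k l
    by (simp add: mult.assoc ctr_eE_eE right_diff_distrib)
  have 3: "(\<Sum>k<d. \<Sum>l<d. X k l *\<^sub>R ((if j = k then eE l * u else 0) - (if j = l then eE k * u else 0)))
      = 2 *\<^sub>R ((\<Sum>l<d. X j l *\<^sub>R eE l) * u)"
  proof -
    have "X k l *\<^sub>R ((if j = k then eE l * u else 0) - (if j = l then eE k * u else 0))
      = (if j = k then X k l *\<^sub>R (eE l * u) else 0) - (if j = l then X k l *\<^sub>R (eE k * u) else 0)" for k l
      by (auto simp: scaleR_right_diff_distrib)
    then have "(\<Sum>k<d. \<Sum>l<d. X k l *\<^sub>R ((if j = k then eE l * u else 0) - (if j = l then eE k * u else 0)))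
      = (\<Sum>k<d. \<Sum>l<d. if j = k then X k l *\<^sub>R (eE l * u) else 0) - (\<Sum>k<d. \<Sum>l<d. if j = l then X k l *\<^sub>R (eE k * u) else 0)"
      by (simp only: sum_subtractf)
    also have "(\<Sum>k<d. \<Sum>l<d. if j = k then X k l *\<^sub>R (eE l * u) else 0) =
      (\<Sum>k<d. if j = k then \<Sum>l<d. X k l *\<^sub>R (eE l * u) else 0)"
      by (intro sum.cong refl) simp
    also have "\<dots> - (\<Sum>k<d. \<Sum>l<d. if j = l then X k l *\<^sub>R (eE k * u) else 0) = (\<Sum>l<d. X j l *\<^sub>R (eE l * u)) - (\<Sum>k<d. X k j *\<^sub>R (eE k * u))"
      using assms(1) by simp
    also have "(\<Sum>k<d. X k j *\<^sub>R (eE k * u)) = - (\<Sum>k<d. X j k *\<^sub>R (eE k * u))"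
      by (subst anti) (simp add: sum_negf)
    finally show ?thesis
      by (simp add: sum_distrib_right scaleR_2)
  qed
  note lin = linear_add[OF linear_ctr_eE] linear_scale[OF linear_ctr_eE] linear_sum[OF linear_ctr_eE]
  have "ctr_eE j (expo d t X * u) = t *\<^sub>R (\<Sum>k<d. (if j = k then - (dX k * u) else 0))
    + (1/4) *\<^sub>R (\<Sum>k<d. \<Sum>l<d. X k l *\<^sub>R ((if j = k then eE l * u else 0) - (if j = l then eE k * u else 0))) + expo d t X * ctr_eE j u"
    by (simp add: expo_def distrib_right sum_distrib_right lin 1 2 sum.distrib scaleR_right_distrib add_ac)
  with assms(1) show ?thesis
    by (simp add: 3 distrib_right left_diff_distrib)
qed

section \<open>Nilpotency of the exponent and its exponential\<close>

definition tot_degree :: "nat \<Rightarrow> nat \<Rightarrow> superalg \<Rightarrow> bool" where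
  "tot_degree d n u \<longleftrightarrow> (\<forall>I J. cf u I J \<noteq> 0 \<longrightarrow> I \<subseteq> {..<d} \<and> J \<subseteq> {..<d} \<and> card I + card J = n)"

lemma tot_degree_linear:
  "tot_degree d n u \<Longrightarrow> tot_degree d n v \<Longrightarrow> tot_degree d n (u + v)"
  "tot_degree d n u \<Longrightarrow> tot_degree d n (r *\<^sub>R u)"
  "(\<And>a. a \<in> A \<Longrightarrow> tot_degree d n (f a)) \<Longrightarrow> tot_degree d n (sum f A)"
proof -
  show add: "tot_degree d n u \<Longrightarrow> tot_degree d n v \<Longrightarrow> tot_degree d n (u + v)" for u v
    unfolding tot_degree_def by (metis add.right_neutral cf_add)
  show "tot_degree d n u \<Longrightarrow> tot_degree d n (r *\<^sub>R u)"
    unfolding tot_degree_def cf_scaleR by (metis mult_zero_right)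
  show "(\<And>a. a \<in> A \<Longrightarrow> tot_degree d n (f a)) \<Longrightarrow> tot_degree d n (sum f A)"
    by (induction A rule: infinite_finite_induct) (auto intro: add simp: tot_degree_def[of d n 0])
qed

lemma tot_degree_gen:
  assumes "k < d" "tot_degree d n u"
  shows "tot_degree d (Suc n) (dX k * u)" "tot_degree d (Suc n) (eE k * u)"
proof -
  have card: "card I = Suc (card (I - {k}))" if "k \<in> I" "I - {k} \<subseteq> {..<d}" for I
    using that finite_subset[of "I - {k}" "{..<d}"] by (intro card.remove) auto
  have sub: "I \<subseteq> {..<d}" if "I - {k} \<subseteq> {..<d}" for I
    using that assms(1) by auto
  show "tot_degree d (Suc n) (dX k * u)"
    unfolding tot_degree_def
  proof (intro allI impI)
    fix I J assume "cf (dX k * u) I J \<noteq> 0"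
    then have k: "k \<in> I" and "cf u (I - {k}) J \<noteq> 0"
      by (auto simp: cf_dX_mult split: if_splits)
    then have "I - {k} \<subseteq> {..<d} \<and> J \<subseteq> {..<d} \<and> card (I - {k}) + card J = n"
      using assms(2) unfolding tot_degree_def by blast
    then show "I \<subseteq> {..<d} \<and> J \<subseteq> {..<d} \<and> card I + card J = Suc n"
      using card[OF k] sub[of I] by (metis add_Suc add_Suc_right)
  qed
  show "tot_degree d (Suc n) (eE k * u)"
    unfolding tot_degree_def
  proof (intro allI impI)
    fix I J assume "cf (eE k * u) I J \<noteq> 0"
    then have k: "k \<in> J" and "cf u I (J - {k}) \<noteq> 0"
      by (auto simp: cf_eE_mult split: if_splits)
    then have "I \<subseteq> {..<d} \<and> J - {k} \<subseteq> {..<d} \<and> card I + card (J - {k}) = n"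
      using assms(2) unfolding tot_degree_def by blast
    then show "I \<subseteq> {..<d} \<and> J \<subseteq> {..<d} \<and> card I + card J = Suc n"
      using card[OF k] sub[of J] by (metis add_Suc add_Suc_right)
  qed
qed

lemma tot_degree_expo: "tot_degree d n u \<Longrightarrow> tot_degree d (Suc (Suc n)) (expo d t X * u)"
  unfolding expo_def distrib_right sum_distrib_right mult_scaleR_left mult.assoc
  by (intro tot_degree_linear tot_degree_gen) auto

lemma tot_degree_expo_power: "tot_degree d (2 * n) (expo d t X ^ n)"
  by (induction n) (auto intro: tot_degree_expo simp: tot_degree_def[of d 0] cf_one)

text \<open>The power has total degree \<open>2 * d + 2\<close>, but a monomial contains at most
  \<open>d\<close> generators of each kind.\<close>

lemma expo_nilpotent: "expo d t X ^ Suc d = 0"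
proof (rule superalg_eqI)
  fix I J
  have le: "card I \<le> d" "card J \<le> d" if "I \<subseteq> {..<d}" "J \<subseteq> {..<d}" for I J
    using card_mono[OF finite_lessThan that(1)] card_mono[OF finite_lessThan that(2)] by auto
  then show "cf (expo d t X ^ Suc d) I J = cf 0 I J"
    using tot_degree_expo_power[of d "Suc d" t X, unfolded tot_degree_def, rule_format, of I J] le[of I J]
    by (cases "cf (expo d t X ^ Suc d) I J = 0") (simp_all del: power_Suc)
qed

text \<open>By nilpotency the truncated series is the full exponential; it is a finite sum in the
  ring, where no convergence has to be discussed.\<close>

definition expE :: "nat \<Rightarrow> real \<Rightarrow> (nat \<Rightarrow> nat \<Rightarrow> real) \<Rightarrow> superalg" where
  "expE d t X = (\<Sum>n\<le>d. (1 / fact n) *\<^sub>R expo d t X ^ n)"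

text \<open>Chain rule: \<open>h\<close> is the derivative of the exponent, and since it commutes
  with the exponent, the \<open>n\<close>-th power contributes \<open>n\<close> equal terms.\<close>

lemma derivation_expE:
  assumes lin: "linear D" and one: "D 1 = 0"
    and step: "\<And>u. D (expo d t X * u) = h * u + expo d t X * D u"
    and comm: "h * expo d t X = expo d t X * h"
  shows "D (expE d t X) = h * expE d t X"
proof -
  let ?N = "expo d t X"
  have pow: "D (?N ^ Suc n) = real (Suc n) *\<^sub>R (h * ?N ^ n)" for n
  proof (induction n)
    case 0
    show ?case
      using step[of 1] one by simp
  next
    case (Suc n)
    have "D (?N ^ Suc (Suc n)) = h * ?N ^ Suc n + ?N * D (?N ^ Suc n)"
      using step[of "?N ^ Suc n"] by simp
    also have "?N * D (?N ^ Suc n) = real (Suc n) *\<^sub>R (h * ?N ^ Suc n)"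
      unfolding Suc using comm by (simp add: mult.assoc[symmetric])
    finally show ?case
      by (simp add: scaleR_left_distrib scaleR_2 algebra_simps)
  qed
  \<comment> \<open>Differentiation lowers the truncation order by one. The missing term vanishes
    because \<open>(d + 1) * h * N ^ d\<close> is the derivative of \<open>N ^ (d + 1)\<close>,
    which is \<open>0\<close>.\<close>
  have hN: "h * ?N ^ d = 0"
    using pow[of d] linear_0[OF lin] by (simp only: expo_nilpotent) simp
  have "D (expE d t X) = (\<Sum>n\<le>d. (1 / fact n) *\<^sub>R D (?N ^ n))"
    by (simp add: expE_def linear_sum[OF lin] linear_scale[OF lin])
  also have "\<dots> = (\<Sum>n<d. (1 / fact (Suc n)) *\<^sub>R D (?N ^ Suc n))"
    by (subst sum.atMost_shift) (simp add: one)
  also have "\<dots> = (\<Sum>n<d. (1 / fact n) *\<^sub>R (h * ?N ^ n))"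
    by (intro sum.cong refl) (simp only: pow scaleR_scaleR fact_Suc, simp del: of_nat_Suc)
  also have "\<dots> = (\<Sum>n\<le>d. (1 / fact n) *\<^sub>R (h * ?N ^ n))"
    by (simp add: lessThan_Suc_atMost[symmetric] hN)
  finally show ?thesis
    by (simp add: expE_def sum_distrib_left)
qed

lemma ctr_dX_expE: "j < d \<Longrightarrow> ctr_dX j (expE d t X) = (t *\<^sub>R eE j) * expE d t X"
  by (rule derivation_expE) (auto simp: linear_ctr_dX ctr_dX_expo eE_expo_commute)

lemma ctr_eE_expE:
  assumes "j < d" "\<And>k l. X l k = - X k l"
  shows "ctr_eE j (expE d t X) = (- (t *\<^sub>R dX j) + (1 / 2) *\<^sub>R (\<Sum>l<d. X j l *\<^sub>R eE l)) * expE d t X"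
proof (rule derivation_expE)
  show "(- (t *\<^sub>R dX j) + (1 / 2) *\<^sub>R (\<Sum>l<d. X j l *\<^sub>R eE l)) * expo d t X =
    expo d t X * (- (t *\<^sub>R dX j) + (1 / 2) *\<^sub>R (\<Sum>l<d. X j l *\<^sub>R eE l))"
    by (simp add: distrib_left distrib_right sum_distrib_left sum_distrib_right left_diff_distrib right_diff_distrib dX_expo_commute eE_expo_commute)
qed (simp_all add: linear_ctr_eE ctr_eE_expo[OF assms])

text \<open>The factor \<open>t\<close> is attached to exactly one \<open>dX\<close> in each mixed
  term and to no other term, so its exponent counts the form degree. This isolates the dependence of
  the explicit forms on \<open>t\<close>, apart from the Gaussian factor.\<close>

lemma cf_expo_power_scale: "cf (expo d t X ^ n) I J = t ^ card I * cf (expo d 1 X ^ n) I J"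
proof (induction n arbitrary: I J)
  case (Suc n)
  have 1: "t * cf (dX k * (eE k * expo d t X ^ n)) I J = t ^ card I * cf (dX k * (eE k * expo d 1 X ^ n)) I J" for k
  proof (cases "finite I \<and> k \<in> I")
    case True
    then have "t ^ card I = t * t ^ card (I - {k})"
      using card.remove[of I k] by (metis power_Suc)
    with True show ?thesis
      by (simp add: cf_dX_mult cf_eE_mult Suc)
  qed (auto simp: cf_infinite cf_dX_mult)
  have 2: "cf (eE k * (eE l * expo d t X ^ n)) I J = t ^ card I * cf (eE k * (eE l * expo d 1 X ^ n)) I J" for k l
    by (simp add: cf_eE_mult Suc)
  have e: "cf (expo d s X * u) I J = (\<Sum>k<d. s * cf (dX k * (eE k * u)) I J) +
      (\<Sum>k<d. \<Sum>l<d. 1 / 4 * X k l * cf (eE k * (eE l * u)) I J)" for s u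
    by (simp add: expo_def distrib_right sum_distrib_right mult.assoc sum_distrib_left)
  show ?case
    unfolding power_Suc e 1 2 mult_1
    by (simp add: sum_distrib_left distrib_left mult.left_commute[of _ "t ^ card I"])
qed (simp add: cf_one)

lemma cf_expE_scale: "cf (expE d t X) I J = t ^ card I * cf (expE d 1 X) I J"
  by (simp add: expE_def cf_expo_power_scale[of d t] sum_distrib_left mult_ac)

section \<open>The exponential series of a scalar plus the exponent\<close>

lemma scalar_plus_nilpotent_power:
  fixes N :: superalg
  shows "(c *\<^sub>R 1 + N) ^ n = (\<Sum>k\<le>n. (real (n choose k) * c ^ (n - k)) *\<^sub>R N ^ k)"
proof (induction n)
  case (Suc n)
  have "(c *\<^sub>R 1 + N) ^ Suc n = c *\<^sub>R (c *\<^sub>R 1 + N) ^ n + N * (c *\<^sub>R 1 + N) ^ n"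
    by (simp add: distrib_right)
  also have "N * (c *\<^sub>R 1 + N) ^ n = (\<Sum>k\<le>n. (real (n choose k) * c ^ (n - k)) *\<^sub>R N ^ Suc k)"
    by (simp add: Suc sum_distrib_left)
  also have "\<dots> = (\<Sum>k\<le>Suc n. if k = 0 then 0 else (real (n choose (k - 1)) * c ^ (Suc n - k)) *\<^sub>R N ^ k)"
    by (simp del: sum.atMost_Suc power_Suc add: sum.atMost_Suc_shift)
  also have "c *\<^sub>R (c *\<^sub>R 1 + N) ^ n = (\<Sum>k\<le>n. (real (n choose k) * c ^ (Suc n - k)) *\<^sub>R N ^ k)"
    by (auto simp: Suc scaleR_sum_right Suc_diff_le intro!: sum.cong)
  also have "\<dots> = (\<Sum>k\<le>Suc n. (real (n choose k) * c ^ (Suc n - k)) *\<^sub>R N ^ k)"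
    by simp
  finally have "(c *\<^sub>R 1 + N) ^ Suc n = (\<Sum>k\<le>Suc n. (real (n choose k) * c ^ (Suc n - k)) *\<^sub>R N ^ k
      + (if k = 0 then 0 else (real (n choose (k - 1)) * c ^ (Suc n - k)) *\<^sub>R N ^ k))"
    by (simp only: sum.distrib)
  also have "\<dots> = (\<Sum>k\<le>Suc n. (real (Suc n choose k) * c ^ (Suc n - k)) *\<^sub>R N ^ k)"
  proof (intro sum.cong refl)
    fix k
    show "(real (n choose k) * c ^ (Suc n - k)) *\<^sub>R N ^ k
      + (if k = 0 then 0 else (real (n choose (k - 1)) * c ^ (Suc n - k)) *\<^sub>R N ^ k) =
      (real (Suc n choose k) * c ^ (Suc n - k)) *\<^sub>R N ^ k"
      by (cases k) (simp_all add: algebra_simps)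
  qed
  finally show ?case .
qed simp

text \<open>The series is rearranged by powers of the nilpotent part: for each \<open>k\<close> the
  sum over \<open>n\<close> is \<open>exp c / fact k\<close>, and only \<open>k \<le> d\<close>
  occur. So finitely many series are added, and no double series has to be exchanged.\<close>

lemma sums_exp_scalar_plus_expo:
  "(\<lambda>n. cf ((c *\<^sub>R 1 + expo d t X) ^ n) I J / fact n) sums (exp c * cf (expE d t X) I J)"
proof -
  let ?N = "expo d t X"
  define a where "a k n = (if k \<le> n then real (n choose k) * c ^ (n - k) / fact n else 0)" for k n
  have zero: "?N ^ k = 0" if "k > d" for k
    using that expo_nilpotent[of d t X] by (metis Suc_leI le_add_diff_inverse mult_zero_left power_add)
  have "a k sums (exp c / fact k)" for k
  proof -
    have "(\<lambda>n. a k (n + k)) = (\<lambda>n. c ^ n / fact n / fact k)"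
      by (auto simp: a_def binomial_fact field_simps)
    moreover have "(\<lambda>n. c ^ n / fact n / fact k) sums (exp c / fact k)"
      using exp_converges[of c] by (intro sums_divide) (simp add: field_simps)
    moreover have "(\<Sum>i<k. a k i) = 0"
      by (simp add: a_def)
    ultimately show ?thesis
      using sums_iff_shift[of "a k" k "exp c / fact k"] by simp
  qed
  then have "(\<lambda>n. \<Sum>k\<le>d. a k n * cf (?N ^ k) I J) sums (\<Sum>k\<le>d. exp c / fact k * cf (?N ^ k) I J)"
    by (intro sums_sum sums_mult2)
  moreover have "(\<Sum>k\<le>d. a k n * cf (?N ^ k) I J) = cf ((c *\<^sub>R 1 + ?N) ^ n) I J / fact n" for n
  proof -
    have "(\<Sum>k\<le>d. a k n * cf (?N ^ k) I J) = (\<Sum>k\<le>n. a k n * cf (?N ^ k) I J)"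
      by (rule sum.mono_neutral_cong) (auto simp: a_def zero)
    then show ?thesis
      by (simp add: scalar_plus_nilpotent_power a_def sum_divide_distrib)
  qed
  ultimately show ?thesis
    by (simp add: expE_def sum_distrib_left mult_ac)
qed

subsection \<open>Linear substitutions\<close>

definition mprod :: "(nat \<Rightarrow> superalg) \<Rightarrow> nat set \<Rightarrow> superalg" where
  "mprod \<phi> I = prod_list (map \<phi> (sorted_list_of_set I))"

lemma mprod_empty [simp]: "mprod \<phi> {} = 1"
  by (simp add: mprod_def)

lemma mprod_insert_less: "finite I \<Longrightarrow> \<forall>i\<in>I. k < i \<Longrightarrow> mprod \<phi> (insert k I) = \<phi> k * mprod \<phi> I"
proof -
  assume "finite I" "\<forall>i\<in>I. k < i"
  then have "sorted_list_of_set (insert k I) = k # sorted_list_of_set I"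
    by (subst sorted_list_of_set_insert_remove) (auto simp: insort_is_Cons less_imp_le)
  then show ?thesis
    by (simp add: mprod_def)
qed

definition anticommuting :: "(nat \<Rightarrow> superalg) \<Rightarrow> bool" where
  "anticommuting \<phi> \<longleftrightarrow> (\<forall>j k. \<phi> j * \<phi> k = - (\<phi> k * \<phi> j))"

text \<open>Sorting uses anticommutation alone, which over the reals also forces squares to vanish.
  Hence the images of generators under a substitution multiply by the same sign rule as the
  generators themselves.\<close>

lemma gen_mprod:
  assumes anti: "anticommuting \<phi>" and "finite I"
  shows "\<phi> k * mprod \<phi> I = (if k \<in> I then 0 else ins_sign k I *\<^sub>R mprod \<phi> (insert k I))"
  using assms(2)
proof (induction I arbitrary: k rule: finite_linorder_min_induct)
  case empty
  show ?case
    by (simp add: mprod_insert_less)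
next
  case (insert b A)
  have sq: "\<phi> b * \<phi> b = 0"
    using anti superalg_double_zero unfolding anticommuting_def by blast
  consider "k < b" | "k = b" | "b < k"
    by linarith
  then show ?case
  proof cases
    case 1
    then have "\<forall>i\<in>insert b A. k < i"
      using insert.hyps by auto
    moreover from this have "{i \<in> insert b A. i < k} = {}" "k \<notin> insert b A"
      by fastforce+
    ultimately show ?thesis
      using insert.hyps(1) by (simp only: mprod_insert_less finite_insert ins_sign_def) simp
  next
    case 2
    with insert.hyps sq show ?thesis
      by (simp add: mprod_insert_less flip: mult.assoc)
  next
    case 3
    have "\<phi> k * \<phi> b = - (\<phi> b * \<phi> k)"
      using anti unfolding anticommuting_def by blast
    then have "\<phi> k * mprod \<phi> (insert b A) = - (\<phi> b * (\<phi> k * mprod \<phi> A))"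
      using insert.hyps by (simp add: mprod_insert_less flip: mult.assoc)
    also have "\<dots> = (if k \<in> A then 0 else - (ins_sign k A *\<^sub>R (\<phi> b * mprod \<phi> (insert k A))))"
      by (simp add: insert.IH)
    also have "\<dots> = (if k \<in> A then 0 else - (ins_sign k A *\<^sub>R mprod \<phi> (insert b (insert k A))))"
      using insert.hyps 3 by (simp add: mprod_insert_less)
    finally show ?thesis
      using insert.hyps 3 by (auto simp: ins_sign_insert insert_commute)
  qed
qed

text \<open>Left exterior multiplication by the generator \<open>k\<close> in terms of coefficients;
  \<open>gen_contr\<close> is the contraction adjoint to it. The exterior derivative and the
  contraction with a vector field are both sums of these operators.\<close>

definition gen_wedge :: "nat \<Rightarrow> ext \<Rightarrow> ext" where
  "gen_wedge k a I = (if k \<in> I then ins_sign k I * a (I - {k}) else 0)"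

definition gen_contr :: "nat \<Rightarrow> ext \<Rightarrow> ext" where
  "gen_contr k a I = (if k \<in> I then 0 else ins_sign k I * a (insert k I))"

lemma sum_gen_wedge_mprod:
  assumes "anticommuting \<phi>" "k < d"
  shows "\<phi> k * (\<Sum>I\<in>Pow {..<d}. a I *\<^sub>R mprod \<phi> I) = (\<Sum>I\<in>Pow {..<d}. gen_wedge k a I *\<^sub>R mprod \<phi> I)"
proof -
  have "\<phi> k * (\<Sum>I\<in>Pow {..<d}. a I *\<^sub>R mprod \<phi> I) =
    (\<Sum>I\<in>Pow {..<d}. if k \<in> I then 0 else (a I * ins_sign k I) *\<^sub>R mprod \<phi> (insert k I))"
    unfolding sum_distrib_left
  proof (intro sum.cong refl)
    fix I assume "I \<in> Pow {..<d}"
    then have "finite I"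
      using finite_subset by auto
    with assms(1) show "\<phi> k * a I *\<^sub>R mprod \<phi> I = (if k \<in> I then 0 else (a I * ins_sign k I) *\<^sub>R mprod \<phi> (insert k I))"
      by (simp add: gen_mprod)
  qed
  also have "\<dots> = (\<Sum>I\<in>{I \<in> Pow {..<d}. k \<notin> I}. (a I * ins_sign k I) *\<^sub>R mprod \<phi> (insert k I))"
    by (rule sum.mono_neutral_cong_right) auto
  also have "\<dots> = (\<Sum>I\<in>{I \<in> Pow {..<d}. k \<in> I}. gen_wedge k a I *\<^sub>R mprod \<phi> I)"
    by (rule sum.reindex_bij_witness[of _ "\<lambda>I. I - {k}" "insert k"])
      (use assms(2) in \<open>auto simp: gen_wedge_def insert_absorb mult.commute\<close>)
  also have "\<dots> = (\<Sum>I\<in>Pow {..<d}. gen_wedge k a I *\<^sub>R mprod \<phi> I)"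
    by (rule sum.mono_neutral_cong_left) (auto simp: gen_wedge_def)
  finally show ?thesis .
qed

text \<open>The homomorphism that sends \<open>dX k\<close> to \<open>\<phi> k\<close> and
  \<open>eE k\<close> to \<open>\<psi> k\<close>, given on ordered monomials. Multiplicativity is
  established only for a generator as left factor, which suffices for powers of the
  exponent.\<close>

definition subst :: "nat \<Rightarrow> (nat \<Rightarrow> superalg) \<Rightarrow> (nat \<Rightarrow> superalg) \<Rightarrow> superalg \<Rightarrow> superalg" where
  "subst d \<phi> \<psi> u = (\<Sum>I\<in>Pow {..<d}. \<Sum>J\<in>Pow {..<d}. cf u I J *\<^sub>R (mprod \<phi> I * mprod \<psi> J))"

lemma linear_subst: "linear (subst d \<phi> \<psi>)"
  by (rule linearI) (simp_all add: subst_def scaleR_left_distrib sum.distrib scaleR_sum_right)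

lemma subst_one: "subst d \<phi> \<psi> 1 = 1"
proof -
  have "subst d \<phi> \<psi> 1 = (\<Sum>I\<in>Pow {..<d}. if I = {} then \<Sum>J\<in>Pow {..<d}. if J = {} then 1 else 0 else 0)"
    unfolding subst_def by (intro sum.cong refl) (auto simp: cf_one if_distrib[of "\<lambda>r. r *\<^sub>R _"] cong: if_cong)
  then show ?thesis
    by simp
qed

lemma gen_mprod_commute:
  assumes "\<And>k. g * \<phi> k = - (\<phi> k * g)" "finite I"
  shows "g * mprod \<phi> I = (-1) ^ card I *\<^sub>R (mprod \<phi> I * g)"
  using assms(2)
proof (induction I rule: finite_linorder_min_induct)
  case (insert b A)
  have "b \<notin> A"
    using insert.hyps by auto
  have "g * mprod \<phi> (insert b A) = - (\<phi> b * (g * mprod \<phi> A))"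
    using insert.hyps assms(1) by (simp add: mprod_insert_less flip: mult.assoc)
  with insert.hyps \<open>b \<notin> A\<close> show ?case
    by (simp add: insert.IH mprod_insert_less mult.assoc)
qed simp

lemma subst_dX:
  assumes "anticommuting \<phi>" "k < d"
  shows "subst d \<phi> \<psi> (dX k * u) = \<phi> k * subst d \<phi> \<psi> u"
proof -
  have s: "subst d \<phi> \<psi> u = (\<Sum>J\<in>Pow {..<d}. (\<Sum>I\<in>Pow {..<d}. cf u I J *\<^sub>R mprod \<phi> I) * mprod \<psi> J)" for u
    unfolding subst_def by (subst sum.swap) (simp add: sum_distrib_right)
  have c: "cf (dX k * u) I J = gen_wedge k (\<lambda>I. cf u I J) I" for I J
    by (simp add: cf_dX_mult gen_wedge_def)
  show ?thesis
    unfolding s c sum_gen_wedge_mprod[OF assms, symmetric] mult.assoc by (rule sum_distrib_left[symmetric])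
qed

lemma subst_eE:
  assumes "anticommuting \<psi>" "\<And>j k. \<psi> j * \<phi> k = - (\<phi> k * \<psi> j)" "k < d"
  shows "subst d \<phi> \<psi> (eE k * u) = \<psi> k * subst d \<phi> \<psi> u"
proof -
  have s: "subst d \<phi> \<psi> u = (\<Sum>I\<in>Pow {..<d}. mprod \<phi> I * (\<Sum>J\<in>Pow {..<d}. cf u I J *\<^sub>R mprod \<psi> J))" for u
    unfolding subst_def by (simp add: sum_distrib_left)
  have c: "cf (eE k * u) I J = (-1) ^ card I * gen_wedge k (cf u I) J" for I J
    by (simp add: cf_eE_mult gen_wedge_def)
  have 1: "\<psi> k * (mprod \<phi> I * v) = (-1) ^ card I *\<^sub>R (mprod \<phi> I * (\<psi> k * v))" if "I \<in> Pow {..<d}" for I v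
    using gen_mprod_commute[of "\<psi> k" \<phi> I] assms(2) finite_subset[of I "{..<d}"] that
    by (simp flip: mult.assoc)
  have 2: "mprod \<phi> I * (\<Sum>J\<in>Pow {..<d}. cf (eE k * u) I J *\<^sub>R mprod \<psi> J) =
      (-1) ^ card I *\<^sub>R (mprod \<phi> I * (\<psi> k * (\<Sum>J\<in>Pow {..<d}. cf u I J *\<^sub>R mprod \<psi> J)))" for I
    unfolding c sum_gen_wedge_mprod[OF assms(1,3)]
    by (simp only: mult_scaleR_right[symmetric] scaleR_sum_right scaleR_scaleR)
  show ?thesis
    unfolding s sum_distrib_left[of "\<psi> k"] by (intro sum.cong refl) (simp only: 1 2)
qed

text \<open>The coefficients are those of column \<open>k\<close>. For orthogonal \<open>g\<close>
  this column gives both the image of the basis vector \<open>e k\<close> and the pull-back of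
  \<open>dx k\<close> along the inverse of \<open>g\<close>, so one array transforms both kinds of
  generators.\<close>

definition gen_comb :: "nat \<Rightarrow> (nat \<Rightarrow> superalg) \<Rightarrow> (nat \<Rightarrow> nat \<Rightarrow> real) \<Rightarrow> nat \<Rightarrow> superalg" where
  "gen_comb d \<theta> g k = (\<Sum>j<d. g j k *\<^sub>R \<theta> j)"

lemma gen_comb_anticomm:
  assumes "\<And>j k. \<theta> j * \<tau> k = - (\<tau> k * \<theta> j)"
  shows "gen_comb d \<theta> g j * gen_comb d \<tau> h k = - (gen_comb d \<tau> h k * gen_comb d \<theta> g j)"
  unfolding gen_comb_def sum_distrib_left sum_distrib_right
  by (subst sum.swap) (simp add: assms sum_negf mult.commute)

definition orthogonal_array :: "nat \<Rightarrow> (nat \<Rightarrow> nat \<Rightarrow> real) \<Rightarrow> bool" where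
  "orthogonal_array d g \<longleftrightarrow> (\<forall>i<d. \<forall>j<d. (\<Sum>k<d. g i k * g j k) = (if i = j then 1 else 0))"

lemma sum_gen_comb_mult:
  "gen_comb d \<theta> g k * gen_comb d \<tau> g l = (\<Sum>i<d. \<Sum>j<d. (g i k * g j l) *\<^sub>R (\<theta> i * \<tau> j))"
  unfolding gen_comb_def sum_distrib_left sum_distrib_right
  by (subst sum.swap) (simp add: mult.commute)

text \<open>The mixed term is preserved because the rows of \<open>g\<close> are orthonormal, and
  the quadratic term in the \<open>eE\<close> absorbs the substitution into a conjugate of
  \<open>X\<close>. Equivariance of the explicit forms rests on this.\<close>

lemma subst_expE:
  assumes "orthogonal_array d g"
    and X': "\<And>k l. k < d \<Longrightarrow> l < d \<Longrightarrow> X' k l = (\<Sum>a<d. \<Sum>b<d. g k a * g l b * X a b)"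
  shows "subst d (gen_comb d dX g) (gen_comb d eE g) (expE d t X) = expE d t X'"
proof -
  let ?\<phi> = "gen_comb d dX g" and ?\<psi> = "gen_comb d eE g"
  let ?S = "subst d ?\<phi> ?\<psi>"
  have anti: "anticommuting ?\<phi>" "anticommuting ?\<psi>" "?\<psi> j * ?\<phi> k = - (?\<phi> k * ?\<psi> j)" for j k
    unfolding anticommuting_def by (intro allI gen_comb_anticomm dX_anticomm eE_anticomm eE_dX_anticomm)+
  note lin = linear_add[OF linear_subst] linear_scale[OF linear_subst] linear_sum[OF linear_subst]
  have A: "(\<Sum>k<d. ?\<phi> k * ?\<psi> k) = (\<Sum>k<d. dX k * eE k)"
  proof -
    have "(\<Sum>k<d. ?\<phi> k * ?\<psi> k) = (\<Sum>i<d. \<Sum>j<d. (\<Sum>k<d. g i k * g j k) *\<^sub>R (dX i * eE j))"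
      unfolding sum_gen_comb_mult scaleR_sum_left
      by (subst sum.swap) (intro sum.cong refl sum.swap)
    also have "\<dots> = (\<Sum>i<d. \<Sum>j<d. if i = j then dX i * eE j else 0)"
      using assms(1) by (intro sum.cong refl) (auto simp: orthogonal_array_def)
    finally show ?thesis
      by simp
  qed
  have B: "(\<Sum>a<d. \<Sum>b<d. X a b *\<^sub>R (?\<psi> a * ?\<psi> b)) = (\<Sum>k<d. \<Sum>l<d. X' k l *\<^sub>R (eE k * eE l))"
  proof -
    have "(\<Sum>a<d. \<Sum>b<d. X a b *\<^sub>R (?\<psi> a * ?\<psi> b)) =
      (\<Sum>a<d. \<Sum>b<d. \<Sum>k<d. \<Sum>l<d. (g k a * g l b * X a b) *\<^sub>R (eE k * eE l))"
      by (simp add: sum_gen_comb_mult scaleR_sum_right mult_ac)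
    also have "\<dots> = (\<Sum>a<d. \<Sum>k<d. \<Sum>b<d. \<Sum>l<d. (g k a * g l b * X a b) *\<^sub>R (eE k * eE l))"
      by (intro sum.cong refl sum.swap)
    also have "\<dots> = (\<Sum>k<d. \<Sum>a<d. \<Sum>b<d. \<Sum>l<d. (g k a * g l b * X a b) *\<^sub>R (eE k * eE l))"
      by (rule sum.swap)
    also have "\<dots> = (\<Sum>k<d. \<Sum>a<d. \<Sum>l<d. \<Sum>b<d. (g k a * g l b * X a b) *\<^sub>R (eE k * eE l))"
      by (intro sum.cong refl sum.swap)
    also have "\<dots> = (\<Sum>k<d. \<Sum>l<d. \<Sum>a<d. \<Sum>b<d. (g k a * g l b * X a b) *\<^sub>R (eE k * eE l))"
      by (intro sum.cong refl sum.swap)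
    also have "\<dots> = (\<Sum>k<d. \<Sum>l<d. X' k l *\<^sub>R (eE k * eE l))"
      by (intro sum.cong refl) (simp add: X' scaleR_sum_left)
    finally show ?thesis .
  qed
  have step: "?S (expo d t X * u) = expo d t X' * ?S u" for u
  proof -
    have "?S (expo d t X * u) = (t *\<^sub>R (\<Sum>k<d. ?\<phi> k * ?\<psi> k)
        + (1 / 4) *\<^sub>R (\<Sum>a<d. \<Sum>b<d. X a b *\<^sub>R (?\<psi> a * ?\<psi> b))) * ?S u"
      by (simp add: expo_def[of d t X] distrib_right sum_distrib_right mult.assoc lin
          subst_dX[OF anti(1)] subst_eE[OF anti(2,3)])
    then show ?thesis
      unfolding A B by (simp add: expo_def)
  qed
  have "?S (expo d t X ^ n) = expo d t X' ^ n" for n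
    by (induction n) (simp_all add: subst_one step)
  then show ?thesis
    by (simp add: expE_def lin)
qed


subsection \<open>The Berezin integral of a substitution\<close>

definition pure_dX :: "superalg \<Rightarrow> bool" where
  "pure_dX u \<longleftrightarrow> (\<forall>I J. J \<noteq> {} \<longrightarrow> cf u I J = 0)"

definition pure_eE :: "superalg \<Rightarrow> bool" where
  "pure_eE u \<longleftrightarrow> (\<forall>I J. I \<noteq> {} \<longrightarrow> cf u I J = 0)"

lemma cf_pure_mult:
  assumes "pure_dX u" "pure_eE v"
  shows "cf (u * v) I J = cf u I {} * cf v {} J"
proof (cases "finite I \<and> finite J")
  case True
  have "cf (u * v) I J = (\<Sum>K\<in>Pow I. if K = I then \<Sum>L\<in>Pow J. if L = {} then cf u I {} * cf v {} J else 0 else 0)"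
    unfolding cf_mult
    using assms by (intro sum.cong refl)
      (auto simp: pure_dX_def pure_eE_def super_sign_def intro!: sum.cong sum.neutral)
  with True show ?thesis
    by simp
qed (auto simp: cf_infinite)

lemma pure_mprod: "pure_dX (mprod (gen_comb d dX g) I)" "pure_eE (mprod (gen_comb d eE g) I)"
proof -
  have "pure_dX (prod_list (map (gen_comb d dX g) is))" for "is"
    by (induction "is") (simp_all add: pure_dX_def cf_one gen_comb_def sum_distrib_right cf_dX_mult sum.neutral)
  then show "pure_dX (mprod (gen_comb d dX g) I)"
    by (simp add: mprod_def)
  have "pure_eE (prod_list (map (gen_comb d eE g) is))" for "is"
    by (induction "is") (simp_all add: pure_eE_def cf_one gen_comb_def sum_distrib_right cf_eE_mult sum.neutral)
  then show "pure_eE (mprod (gen_comb d eE g) I)"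
    by (simp add: mprod_def)
qed

lemma tot_degree_mprod:
  assumes "\<And>k. \<theta> k = dX k \<or> \<theta> k = eE k"
  shows "tot_degree d (card I) (mprod (gen_comb d \<theta> g) I)"
proof -
  have "tot_degree d (length is) (prod_list (map (gen_comb d \<theta> g) is))" for "is"
  proof (induction "is")
    case (Cons i "is")
    have "tot_degree d (Suc (length is)) (\<theta> k * prod_list (map (gen_comb d \<theta> g) is))" if "k < d" for k
      using tot_degree_gen[OF that Cons] assms[of k] by auto
    then show ?case
      unfolding list.map prod_list.Cons gen_comb_def[of d \<theta> g i] sum_distrib_right mult_scaleR_left
      by (auto intro!: tot_degree_linear)
  qed (simp add: tot_degree_def cf_one)
  then show ?thesis
    by (metis mprod_def length_sorted_list_of_set)
qed

text \<open>The product is expanded by its first factor; choosing the index \<open>js ! i\<close>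
  there matches row \<open>i\<close> in the Laplace expansion along the first column. Arbitrary
  sorted index lists and the column offset \<open>m\<close> bring the minors under the induction
  hypothesis.\<close>

lemma cf_prod_list_eE:
  assumes "sorted js" "distinct js" "set js \<subseteq> {..<d}"
  shows "cf (prod_list (map (gen_comb d eE v) [m..<m + length js])) {} (set js) =
    Determinant.det (mat (length js) (length js) (\<lambda>(i, k). v (js ! i) (m + k)))"
  using assms
proof (induction "length js" arbitrary: js m)
  case 0
  then show ?case
    by (simp add: cf_one det_dim_zero)
next
  case (Suc n)
  define del where "del i = take i js @ drop (Suc i) js" for i
  let ?A = "mat (Suc n) (Suc n) (\<lambda>(i, k). v (js ! i) (m + k))"
  define Q where "Q = prod_list (map (gen_comb d eE v) [Suc m..<Suc m + n])"
  have n: "length js = Suc n"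
    using Suc by simp
  have del: "length (del i) = n" "sorted (del i)" "distinct (del i)" "set (del i) = set js - {js ! i}"
    if "i < Suc n" for i
  proof -
    have js: "js = take i js @ js ! i # drop (Suc i) js"
      using that n by (simp add: id_take_nth_drop)
    show "length (del i) = n"
      using that n by (simp add: del_def)
    have 1: "sorted (take i js @ js ! i # drop (Suc i) js)" "distinct (take i js @ js ! i # drop (Suc i) js)"
      unfolding js[symmetric] by (rule Suc.prems)+
    then show "sorted (del i)" "distinct (del i)"
      by (auto simp: del_def sorted_append)
    show "set (del i) = set js - {js ! i}"
      using arg_cong[OF js, of set] 1(2) by (auto simp: del_def)
  qed
  \<comment> \<open>As \<open>js\<close> is sorted and distinct, exactly \<open>i\<close> of its
    entries lie below \<open>js ! i\<close>, so the sorting sign is that of the cofactor.\<close>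
  have sign: "ins_sign (js ! i) (set js) = (-1) ^ i" if "i < Suc n" for i
  proof -
    have "{x \<in> set js. x < js ! i} = set (take i js)"
    proof safe
      fix x assume "x \<in> set js" "x < js ! i"
      then obtain k where "k < length js" "x = js ! k"
        by (metis in_set_conv_nth)
      moreover from this have "k < i"
        using \<open>x < js ! i\<close> Suc.prems(1) that n by (metis leD leI sorted_nth_mono)
      ultimately show "x \<in> set (take i js)"
        by (metis in_set_conv_nth length_take min_less_iff_conj nth_take)
    next
      fix x assume "x \<in> set (take i js)"
      then obtain k where k: "k < i" "k < length js" "x = js ! k"
        by (metis in_set_conv_nth length_take min_less_iff_conj nth_take)
      have "js ! k \<le> js ! i" "js ! k \<noteq> js ! i"
        using Suc.prems k that n by (auto simp: sorted_nth_mono nth_eq_iff_index_eq)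
      with k show "x < js ! i"
        by simp
    qed (auto dest: in_set_takeD)
    moreover have "card (set (take i js)) = i"
      using Suc.prems(2) that n by (simp add: distinct_card)
    ultimately show ?thesis
      by (simp add: ins_sign_def)
  qed
  have IH: "cf Q {} (set js - {js ! i}) = Determinant.det (mat_delete ?A i 0)" if "i < Suc n" for i
  proof -
    have "cf (prod_list (map (gen_comb d eE v) [Suc m..<Suc m + length (del i)])) {} (set (del i)) =
      Determinant.det (mat (length (del i)) (length (del i)) (\<lambda>(i', k). v (del i ! i') (Suc m + k)))"
      using Suc.prems del[OF that] by (intro Suc.hyps(1)) auto
    moreover have "mat n n (\<lambda>(i', k). v (del i ! i') (Suc m + k)) = mat_delete ?A i 0"
      using that n by (intro eq_matI) (auto simp: mat_delete_def del_def nth_append)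
    ultimately show ?thesis
      using del[OF that] by (simp add: Q_def)
  qed
  have "cf (prod_list (map (gen_comb d eE v) [m..<m + length js])) {} (set js) =
    cf (gen_comb d eE v m * Q) {} (set js)"
    by (simp add: n Q_def upt_conv_Cons del: upt_Suc)
  also have "\<dots> = (\<Sum>j<d. v j m * (if j \<in> set js then ins_sign j (set js) * cf Q {} (set js - {j}) else 0))"
    by (simp add: gen_comb_def sum_distrib_right cf_eE_mult cong: if_cong)
  also have "\<dots> = (\<Sum>j\<in>set js. v j m * (ins_sign j (set js) * cf Q {} (set js - {j})))"
    using Suc.prems(3) by (intro sum.mono_neutral_cong_right) auto
  also have "\<dots> = (\<Sum>i<Suc n. v (js ! i) m * (ins_sign (js ! i) (set js) * cf Q {} (set js - {js ! i})))"
    using Suc.prems(2) n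
    by (intro sum.reindex_bij_betw[symmetric] bij_betw_nth) auto
  also have "\<dots> = (\<Sum>i<Suc n. ?A $$ (i, 0) * cofactor ?A i 0)"
    by (intro sum.cong refl) (simp add: cofactor_def sign IH)
  also have "\<dots> = Determinant.det ?A"
    by (rule laplace_expansion_column[symmetric]) auto
  finally show ?case
    by (simp add: n)
qed

lemma cf_mprod_top:
  "cf (mprod (gen_comb d eE g) {..<d}) {} {..<d} = Determinant.det (mat d d (\<lambda>(i, k). g i k))"
proof -
  have "mat d d (\<lambda>(i, k). g ([0..<d] ! i) (0 + k)) = mat d d (\<lambda>(i, k). g i k)"
    by (intro eq_matI) auto
  then show ?thesis
    using cf_prod_list_eE[of "[0..<d]" d g 0] by (simp add: mprod_def lessThan_atLeast0)
qed

text \<open>The Berezin integral picks the full monomial in the \<open>eE\<close>. Substitution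
  preserves degrees, so only the full monomial can produce it, and it does so with the determinant
  as factor. This is where determinant one of the elements of \<open>SO\<close> enters.\<close>

lemma cf_subst_top:
  assumes "Determinant.det (mat d d (\<lambda>(i, k). g i k)) = 1"
  shows "cf (subst d (gen_comb d dX g) (gen_comb d eE g) u) I' {..<d} =
    (\<Sum>I\<in>Pow {..<d}. cf u I {..<d} * cf (mprod (gen_comb d dX g) I) I' {})"
proof -
  have "cf (mprod (gen_comb d eE g) J) {} {..<d} = (if J = {..<d} then 1 else 0)" if "J \<subseteq> {..<d}" for J
  proof (cases "J = {..<d}")
    case False
    then have "card J \<noteq> d"
      using that by (metis card_lessThan card_subset_eq finite_lessThan)
    moreover have "tot_degree d (card J) (mprod (gen_comb d eE g) J)"
      by (rule tot_degree_mprod) simp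
    ultimately show ?thesis
      using False unfolding tot_degree_def
      by (cases "cf (mprod (gen_comb d eE g) J) {} {..<d} = 0") force+
  qed (simp add: cf_mprod_top assms)
  then have "cf (subst d (gen_comb d dX g) (gen_comb d eE g) u) I' {..<d} =
    (\<Sum>I\<in>Pow {..<d}. \<Sum>J\<in>Pow {..<d}. if J = {..<d} then cf u I {..<d} * cf (mprod (gen_comb d dX g) I) I' {} else 0)"
    unfolding subst_def cf_sum cf_scaleR cf_pure_mult[OF pure_mprod]
    by (intro sum.cong refl) simp
  then show ?thesis
    by simp
qed

section \<open>Coefficients of the explicit forms\<close>

definition mat_of :: "(nat \<Rightarrow> 'a::real_inner) \<Rightarrow> ('a \<Rightarrow>\<^sub>L 'a) \<Rightarrow> nat \<Rightarrow> nat \<Rightarrow> real" where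
  "mat_of e X k l = inner (blinfun_apply X (e k)) (e l)"

text \<open>The \<open>c_I\<close> of the overview: the Berezin integral of the exponential at
  \<open>t = 1\<close>, without its Gaussian factor.\<close>

definition thom_coeff :: "nat \<Rightarrow> (nat \<Rightarrow> 'a::real_inner) \<Rightarrow> ('a \<Rightarrow>\<^sub>L 'a) \<Rightarrow> ext" where
  "thom_coeff d e X I = cf (expE d 1 (mat_of e X)) I {..<d}"

definition contr_along :: "nat \<Rightarrow> (nat \<Rightarrow> real) \<Rightarrow> ext \<Rightarrow> ext" where
  "contr_along d v a I = (\<Sum>k<d. v k * gen_contr k a I)"

lemma mat_of_antisym: "X \<in> so \<Longrightarrow> mat_of e X l k = - mat_of e X k l"
proof -
  assume "X \<in> so"
  then have "inner (blinfun_apply X (e l)) (e k) = - inner (e l) (blinfun_apply X (e k))"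
    unfolding so_def by blast
  then show ?thesis
    by (simp add: mat_of_def inner_commute)
qed

lemma sum_symmetric_square:
  fixes F :: "nat \<Rightarrow> nat \<Rightarrow> 'b::real_vector"
  assumes "\<And>k l. F l k = F k l" "\<And>k. F k k = 0"
  shows "(\<Sum>k<d. \<Sum>l<d. F k l) = 2 *\<^sub>R (\<Sum>l<d. \<Sum>k<l. F k l)"
proof (induction d)
  case (Suc d)
  have "(\<Sum>l<d. F d l) = (\<Sum>l<d. F l d)"
    using assms(1) by (intro sum.cong) auto
  with Suc show ?case
    by (simp add: sum.distrib assms(2) scaleR_2)
qed simp

lemma expo_eq:
  assumes "\<And>k l. X l k = - X k l"
  shows "expo d t X = t *\<^sub>R (\<Sum>k<d. dX k * eE k) + (1 / 2) *\<^sub>R (\<Sum>l<d. \<Sum>k<l. X k l *\<^sub>R (eE k * eE l))"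
proof -
  have "X l k *\<^sub>R (eE l * eE k) = X k l *\<^sub>R (eE k * eE l)" for k l
    by (subst assms, subst eE_anticomm) simp
  moreover have "X k k = 0" for k
    using assms[of k k] by simp
  ultimately show ?thesis
    unfolding expo_def by (subst sum_symmetric_square) auto
qed

lemma f_t_eq:
  assumes "X \<in> so"
  shows "f_t d e t X x = sup_rep ((- (t\<^sup>2 * (norm x)\<^sup>2)) *\<^sub>R 1 + expo d t (mat_of e X))"
  unfolding f_t_def expo_eq[of "mat_of e X", OF mat_of_antisym[OF assms]]
  by (rule ext) (simp add: sup_rep_simps sup_rep_sum mat_of_def)

lemma super_mult_funpow: "(super_mult (sup_rep u) ^^ n) (monom_sext {} {}) = sup_rep (u ^ n)"
  by (induction n) (simp_all add: sup_rep_simps)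

lemma sext_exp_f_t:
  assumes "X \<in> so"
  shows "sext_exp (f_t d e t X x) = sup_rep (exp (- (t\<^sup>2 * (norm x)\<^sup>2)) *\<^sub>R expE d t (mat_of e X))"
proof
  fix IJ :: "nat set \<times> nat set"
  obtain I J where "IJ = (I, J)"
    by fastforce
  then show "sext_exp (f_t d e t X x) IJ = sup_rep (exp (- (t\<^sup>2 * (norm x)\<^sup>2)) *\<^sub>R expE d t (mat_of e X)) IJ"
    using sums_exp_scalar_plus_expo[of "- (t\<^sup>2 * (norm x)\<^sup>2)" d t "mat_of e X" I J, THEN sums_unique]
    by (simp add: sext_exp_def exp_series_def f_t_eq[OF assms] super_mult_funpow sup_rep_eq_cf)
qed

lemma berezin_form_exp_f_t:
  assumes "X \<in> so"
  shows "berezin_form d (sext_exp (f_t d e t X x)) I =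
    exp (- (t\<^sup>2 * (norm x)\<^sup>2)) * t ^ card I * thom_coeff d e X I"
  by (simp add: berezin_form_def berezin_def sext_exp_f_t[OF assms] sup_rep_eq_cf thom_coeff_def
      cf_expE_scale[of d t])

text \<open>The derivative of the exponent with respect to \<open>dX k\<close> is \<open>t\<close>
  times \<open>eE k\<close>. At \<open>t = 1\<close>, multiplying the exponential by
  \<open>eE k\<close> is therefore the same as contracting it in the first factor, which turns
  \<open>eta_wedge\<close> into a contraction with the Euler field.\<close>

lemma cf_eE_expE:
  assumes "k < d"
  shows "cf (eE k * expE d t (mat_of e X)) I {..<d} = t ^ card I * gen_contr k (thom_coeff d e X) I"
proof -
  have "cf (eE k * expE d t (mat_of e X)) I {..<d} = t ^ card I * cf (eE k * expE d 1 (mat_of e X)) I {..<d}"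
    unfolding cf_eE_mult cf_expE_scale[of d t] by simp
  also have "eE k * expE d 1 (mat_of e X) = ctr_dX k (expE d 1 (mat_of e X))"
    using assms by (simp add: ctr_dX_expE)
  finally show ?thesis
    by (simp add: cf_ctr_dX gen_contr_def thom_coeff_def)
qed

lemma eta_wedge_eq:
  assumes "X \<in> so"
  shows "eta_wedge d e t X x I =
    - (exp (- (t\<^sup>2 * (norm x)\<^sup>2)) * t ^ card I * contr_along d (\<lambda>k. inner (e k) x) (thom_coeff d e X) I)"
proof -
  have "(\<lambda>IJ. \<Sum>k<d. inner (e k) x * e_gen k IJ) = sup_rep (\<Sum>k<d. inner (e k) x *\<^sub>R eE k)"
    by (simp add: sup_rep_simps sup_rep_sum)
  then have "eta_wedge d e t X x I = - cf ((\<Sum>k<d. inner (e k) x *\<^sub>R eE k) *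
      (exp (- (t\<^sup>2 * (norm x)\<^sup>2)) *\<^sub>R expE d t (mat_of e X))) I {..<d}"
    by (simp add: eta_wedge_def berezin_form_def berezin_def sext_exp_f_t[OF assms] sup_rep_eq_cf
        flip: sup_rep_simps(4))
  then show ?thesis
    by (simp add: sum_distrib_right cf_eE_expE contr_along_def sum_distrib_left mult_ac)
qed

definition gauss_int :: "nat \<Rightarrow> real \<Rightarrow> real" where
  "gauss_int m r = (LBINT t:{0..}. exp (- (t\<^sup>2 * r\<^sup>2)) * t ^ m)"

lemma beta_wedge_eq:
  assumes "X \<in> so"
  shows "beta_wedge d e X x I =
    - (gauss_int (card I) (norm x) * contr_along d (\<lambda>k. inner (e k) x) (thom_coeff d e X) I)"
proof -
  let ?b = "contr_along d (\<lambda>k. inner (e k) x) (thom_coeff d e X) I"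
  have "beta_wedge d e X x I = (LBINT t. (- ?b) * (indicat_real {0..} t *\<^sub>R (exp (- (t\<^sup>2 * (norm x)\<^sup>2)) * t ^ card I)))"
    unfolding beta_wedge_def eta_wedge_eq[OF assms] set_lebesgue_integral_def
    by (intro Bochner_Integration.integral_cong) auto
  then show ?thesis
    unfolding integral_mult_right_zero gauss_int_def set_lebesgue_integral_def by simp
qed

text \<open>
  Obtained by contracting \<open>exp f\<close> with \<open>e\<^sub>j\<close> in the second factor: the Berezin integral kills the result.
\<close>

lemma thom_coeff_closed:
  assumes "X \<in> so" "j < d"
  shows "2 * gen_wedge j (thom_coeff d e X) I = contr_along d (mat_of e X j) (thom_coeff d e X) I"
proof -
  let ?E = "expE d 1 (mat_of e X)"
  have "0 = cf (ctr_eE j ?E) I {..<d}"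
    using assms(2) by (simp add: cf_ctr_eE)
  also have "ctr_eE j ?E = (- (1 *\<^sub>R dX j) + (1 / 2) *\<^sub>R (\<Sum>l<d. mat_of e X j l *\<^sub>R eE l)) * ?E"
    by (rule ctr_eE_expE[OF assms(2) mat_of_antisym[OF assms(1)]])
  also have "cf \<dots> I {..<d} = - cf (dX j * ?E) I {..<d} + (1 / 2) * (\<Sum>l<d. mat_of e X j l * cf (eE l * ?E) I {..<d})"
    by (simp add: distrib_right left_diff_distrib sum_distrib_right)
  finally show ?thesis
    by (simp add: cf_eE_expE contr_along_def cf_dX_mult gen_wedge_def thom_coeff_def cong: if_cong)
qed

lemma super_mult_empty_left: "super_mult u v ({}, J) = wedge (\<lambda>L. u ({}, L)) (\<lambda>L. v ({}, L)) J"
  by (simp add: super_mult_def wedge_def)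

text \<open>Terms without \<open>dx\<close> multiply among themselves as in an ordinary exterior
  algebra, so the Pfaffian is the component of degree zero. The one half in the argument matches the
  one before the quadratic term of \<open>f_t\<close>.\<close>

lemma Pf_half_eq:
  assumes "X \<in> so"
  shows "Pf d e ((1 / 2) *\<^sub>R X) = thom_coeff d e X {}"
proof -
  let ?U = "expo d 1 (mat_of e X)"
  have gen: "(\<lambda>L. e_gen k ({}, L)) = monom_ext {k}" "(\<lambda>L. dx_gen k ({}, L)) = (\<lambda>L. 0)" for k
    by (auto simp: monom_sext_def monom_ext_def)
  have b: "(\<lambda>I. \<Sum>l<d. \<Sum>k<l. inner (blinfun_apply ((1 / 2) *\<^sub>R X) (e k)) (e l) * wedge (monom_ext {k}) (monom_ext {l}) I)
    = (\<lambda>J. sup_rep ?U ({}, J))"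
    unfolding expo_eq[of "mat_of e X", OF mat_of_antisym[OF assms]]
    by (simp add: sup_rep_simps sup_rep_sum mat_of_def super_mult_empty_left gen scaleR_blinfun.rep_eq
        sum_distrib_left wedge_def[of "\<lambda>L. 0"])
  have "(wedge (\<lambda>J. sup_rep ?U ({}, J)) ^^ n) (monom_ext {}) = (\<lambda>J. sup_rep (?U ^ n) ({}, J))" for n
    by (induction n) (auto simp: sup_rep_simps super_mult_empty_left monom_sext_def monom_ext_def)
  then have "Pf d e ((1 / 2) *\<^sub>R X) = (\<Sum>n. cf ((0 *\<^sub>R 1 + ?U) ^ n) {} {..<d} / fact n)"
    by (simp add: Pf_def berezin_def ext_exp_def exp_series_def b sup_rep_eq_cf)
  also have "\<dots> = exp 0 * cf (expE d 1 (mat_of e X)) {} {..<d}"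
    by (rule sums_exp_scalar_plus_expo[THEN sums_unique, symmetric])
  finally show ?thesis
    by (simp add: thom_coeff_def)
qed

text \<open>Contracting the exponential with \<open>dX m\<close> amounts to multiplying it by
  \<open>eE m\<close>, which links consecutive diagonal coefficients. Each step costs
  \<open>(-1) ^ m\<close>, and the exponents add up to the number of transpositions that separate
  the \<open>dx\<close> from the \<open>e\<close>.\<close>

lemma thom_coeff_top: "thom_coeff d e X {..<d} = (-1) ^ (d * (d - 1) div 2)"
proof -
  let ?E = "expE d 1 (mat_of e X)"
  have "cf ?E {..<m} {..<m} = (-1) ^ (m * (m - 1) div 2)" if "m \<le> d" for m
    using that
  proof (induction m)
    case 0
    have *: "cf (expo d 1 (mat_of e X) ^ n) {} {} = (if n = 0 then 1 else 0)" for n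
      using tot_degree_expo_power[of d n 1 "mat_of e X"]
      by (cases "n = 0") (force simp: cf_one tot_degree_def)+
    have "cf ?E {} {} = (\<Sum>n\<le>d. if n = 0 then 1 else 0)"
      unfolding expE_def cf_sum by (intro sum.cong refl) (simp add: *)
    then show ?case
      by simp
  next
    case (Suc m)
    have "cf (ctr_dX m ?E) {..<m} {..<Suc m} = cf (eE m * ?E) {..<m} {..<Suc m}"
      using Suc.prems by (simp add: ctr_dX_expE)
    moreover have "{..<Suc m} - {m} = {..<m}"
      by auto
    ultimately have *: "(-1) ^ m * cf ?E {..<Suc m} {..<Suc m} = (-1) ^ m * ((-1) ^ m * cf ?E {..<m} {..<m})"
      by (simp add: cf_ctr_dX cf_eE_mult ins_sign_lessThan flip: lessThan_Suc)
    have "(-1 :: real) ^ m * ((-1) ^ m * y) = y" for y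
      by (simp flip: mult.assoc power_mult_distrib)
    from arg_cong[OF *, of "\<lambda>y. (-1) ^ m * y", unfolded this]
    have "cf ?E {..<Suc m} {..<Suc m} = (-1) ^ m * cf ?E {..<m} {..<m}" .
    also have "\<dots> = (-1) ^ (m + m * (m - 1) div 2)"
      using Suc by (simp add: power_add)
    also have "m + m * (m - 1) div 2 = Suc m * (Suc m - 1) div 2"
      by (cases m) auto
    finally show ?case .
  qed
  then show ?thesis
    by (simp add: thom_coeff_def)
qed

section \<open>Exterior multiplication and contraction on coefficients\<close>

lemma gen_wedge_antisym: "finite I \<Longrightarrow> gen_wedge j (gen_wedge k a) I = - gen_wedge k (gen_wedge j a) I"
  by (auto simp: gen_wedge_def ins_sign_remove Diff_insert2[symmetric] insert_commute)

lemma gen_contr_wedge: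
  "finite I \<Longrightarrow> gen_contr j (gen_wedge k a) I = (if j = k then a I else 0) - gen_wedge k (gen_contr j a) I"
  by (auto simp: gen_wedge_def gen_contr_def ins_sign_remove ins_sign_insert insert_Diff_if insert_absorb)

lemma gen_contr_antisym: "finite I \<Longrightarrow> gen_contr j (gen_contr k a) I = - gen_contr k (gen_contr j a) I"
  by (auto simp: gen_contr_def ins_sign_insert insert_commute)

lemma wedge_gens:
  assumes "finite I"
  shows "wedge (\<lambda>K. \<Sum>k<d. v k * monom_ext {k} K) a I = (\<Sum>k<d. v k * gen_wedge k a I)"
proof -
  have "wedge (\<lambda>K. \<Sum>k<d. v k * monom_ext {k} K) a I =
    (\<Sum>k<d. \<Sum>K\<in>Pow I. if K = {k} then v k * (shuffle_sign {k} (I - {k}) * a (I - {k})) else 0)"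
    unfolding wedge_def sum_distrib_left sum_distrib_right
    by (subst sum.swap) (auto simp: monom_ext_def intro!: sum.cong)
  also have "\<dots> = (\<Sum>k<d. v k * gen_wedge k a I)"
    using assms by (intro sum.cong refl) (auto simp: gen_wedge_def shuffle_sign_singleton)
  finally show ?thesis .
qed

lemma wedge_gen: "finite I \<Longrightarrow> wedge (monom_ext {k}) a I = gen_wedge k a I"
  using wedge_gens[of I "\<lambda>j. if j = k then 1 else 0" "Suc k" a]
  by (simp add: if_distrib[of "\<lambda>r. r * _"] cong: if_cong)

text \<open>Reads the iterated exterior product in \<open>pullback\<close> as a product in the super
  algebra, so that the substitution lemmas apply to pull-backs.\<close>

lemma cf_mprod_pullback:
  assumes "finite J"
  shows "foldr wedge (map (\<lambda>i K. \<Sum>j<d. g j i * monom_ext {j} K) is) (monom_ext {}) J =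
    cf (prod_list (map (gen_comb d dX g) is)) J {}"
  using assms
proof (induction "is" arbitrary: J)
  case (Cons i "is")
  have "gen_wedge j (foldr wedge (map (\<lambda>i K. \<Sum>j<d. g j i * monom_ext {j} K) is) (monom_ext {})) J =
    cf (dX j * prod_list (map (gen_comb d dX g) is)) J {}" for j
    using Cons by (simp add: gen_wedge_def cf_dX_mult)
  then show ?case
    by (simp add: wedge_gens[OF Cons.prems] gen_comb_def[of d dX g i] sum_distrib_right)
qed (simp add: cf_one monom_ext_def)

section \<open>Equivariance under the special orthogonal group\<close>

lemma onb_inner: "orthonormal_basis d e \<Longrightarrow> i < d \<Longrightarrow> j < d \<Longrightarrow> inner (e i) (e j) = (if i = j then 1 else 0)"
  by (simp add: orthonormal_basis_def)

lemma onb_expand: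
  assumes "orthonormal_basis d e"
  shows "(\<Sum>k<d. inner (e k) x *\<^sub>R e k) = x"
proof -
  have "x \<in> span (e ` {..<d})"
    using assms by (simp add: orthonormal_basis_def)
  then show ?thesis
  proof (induction rule: span_induct_alt)
    case (step c y z)
    then obtain j where j: "j < d" "y = e j"
      by auto
    have "(\<Sum>k<d. inner (e k) y *\<^sub>R e k) = (\<Sum>k<d. if k = j then e j else 0)"
      using j by (intro sum.cong refl) (auto simp: onb_inner[OF assms])
    also have "\<dots> = y"
      using j by simp
    finally have "(\<Sum>k<d. inner (e k) (c *\<^sub>R y + z) *\<^sub>R e k) = c *\<^sub>R y + (\<Sum>k<d. inner (e k) z *\<^sub>R e k)"
      by (simp add: inner_add_right scaleR_left_distrib sum.distrib flip: scaleR_sum_right scaleR_scaleR)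
    with step show ?case
      by simp
  qed simp
qed

lemma onb_inner_eq:
  assumes "orthonormal_basis d e"
  shows "inner x y = (\<Sum>k<d. inner (e k) x * inner (e k) y)"
  using arg_cong[OF onb_expand[OF assms, of x], of "\<lambda>v. inner v y"] by (simp add: inner_sum_left)

lemma onb_norm_eq: "orthonormal_basis d e \<Longrightarrow> (norm x)\<^sup>2 = (\<Sum>k<d. (inner (e k) x)\<^sup>2)"
  unfolding power2_norm_eq_inner power2_eq_square[of "inner (e _) x"] by (rule onb_inner_eq)

lemma onb_eqI:
  assumes "orthonormal_basis d e" "\<And>k. k < d \<Longrightarrow> inner (e k) x = inner (e k) y"
  shows "x = y"
proof -
  have "(\<Sum>k<d. inner (e k) x *\<^sub>R e k) = (\<Sum>k<d. inner (e k) y *\<^sub>R e k)"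
    by (intro sum.cong refl) (simp add: assms(2))
  then show ?thesis
    by (simp only: onb_expand[OF assms(1)])
qed

lemma onb_coord_sum:
  assumes "orthonormal_basis d e" "k < d"
  shows "inner (e k) (\<Sum>j<d. c j *\<^sub>R e j) = c k"
proof -
  have "inner (e k) (\<Sum>j<d. c j *\<^sub>R e j) = (\<Sum>j<d. if j = k then c k else 0)"
    unfolding inner_sum_right using assms by (intro sum.cong refl) (auto simp: onb_inner)
  with assms(2) show ?thesis
    by simp
qed

definition arr :: "(nat \<Rightarrow> 'a::real_inner) \<Rightarrow> ('a \<Rightarrow> 'a) \<Rightarrow> nat \<Rightarrow> nat \<Rightarrow> real" where
  "arr e g i k = inner (e i) (g (e k))"

text \<open>Preservation of inner products says that the columns are orthonormal.
  \<open>orthogonal_array\<close> asks for orthonormal rows, which follow because a left inverse of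
  a square matrix is also a right inverse.\<close>

lemma arr_orthogonal:
  assumes onb: "orthonormal_basis d e" and g: "orthogonal_transformation g"
  shows "orthogonal_array d (arr e g)"
    and "Determinant.det (mat d d (\<lambda>(i, k). arr e g i k)) = 1 \<or> Determinant.det (mat d d (\<lambda>(i, k). arr e g i k)) = -1"
proof -
  let ?A = "mat d d (\<lambda>(i, k). arr e g i k)"
  have A: "?A \<in> carrier_mat d d"
    by simp
  have "inner (g (e i)) (g (e j)) = (if i = j then 1 else 0)" if "i < d" "j < d" for i j
    using g that onb by (simp add: orthogonal_transformation_def onb_inner)
  then have 1: "transpose_mat ?A * ?A = 1\<^sub>m d"
    by (intro eq_matI)
      (auto simp: scalar_prod_def onb_inner_eq[OF onb, of "g _" "g _"] arr_def lessThan_atLeast0)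
  have 2: "?A * transpose_mat ?A = 1\<^sub>m d"
    by (rule mat_mult_left_right_inverse[OF _ _ 1]) auto
  have "(\<Sum>k<d. arr e g i k * arr e g j k) = (if i = j then 1 else 0)" if "i < d" "j < d" for i j
    using arg_cong[OF 2, of "\<lambda>M. M $$ (i, j)"] that by (simp add: scalar_prod_def lessThan_atLeast0)
  then show "orthogonal_array d (arr e g)"
    by (simp add: orthogonal_array_def)
  have "Determinant.det ?A * Determinant.det ?A = 1"
    using det_mult[of ?A d "transpose_mat ?A"] by (simp add: 2 det_transpose[OF A])
  then show "Determinant.det ?A = 1 \<or> Determinant.det ?A = -1"
    by (metis mult_cancel_right2 square_eq_1_iff)
qed

lemma SO_iff:
  "g \<in> SO d e \<longleftrightarrow> orthogonal_transformation g \<and> Determinant.det (mat d d (\<lambda>(i, k). arr e g i k)) = 1"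
proof -
  have "Determinant.det (mat d d (\<lambda>(i, k). arr e g i k)) =
    (\<Sum>p | p permutes {..<d}. of_int (sign p) * (\<Prod>i<d. inner (e i) (g (e (p i)))))"
    unfolding det_def'[OF mat_carrier] lessThan_atLeast0[symmetric]
    by (intro sum.cong refl arg_cong2[where f="(*)"] prod.cong)
      (auto simp: arr_def sign_def permutes_in_image[where S="{..<d}", simplified])
  then show ?thesis
    by (simp add: SO_def)
qed

text \<open>Finite dimension is available only through the basis, so surjectivity is shown by an
  explicit preimage: its coordinates are those of \<open>y\<close> with respect to the images of the
  basis vectors.\<close>

lemma orthogonal_bij:
  fixes g :: "'a::real_inner \<Rightarrow> 'a"
  assumes onb: "orthonormal_basis d (e :: nat \<Rightarrow> 'a)" and g: "orthogonal_transformation g"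
  shows "bij g"
proof (rule bijI)
  have lin: "linear g"
    using g by (simp add: orthogonal_transformation_def)
  show "inj g"
    using orthogonal_transformation_norm[OF g] by (simp add: linear_injective_0[OF lin]) (metis norm_eq_zero)
  show "surj g"
  proof (rule surjI)
    fix y
    show "g (\<Sum>k<d. inner (g (e k)) y *\<^sub>R e k) = y"
    proof (rule onb_eqI[OF onb])
      fix i assume i: "i < d"
      have "inner (e i) (g (\<Sum>k<d. inner (g (e k)) y *\<^sub>R e k)) = (\<Sum>k<d. inner (g (e k)) y * arr e g i k)"
        by (simp add: linear_sum[OF lin] linear_scale[OF lin] inner_sum_right arr_def)
      also have "\<dots> = (\<Sum>k<d. \<Sum>j<d. arr e g j k * inner (e j) y * arr e g i k)"
        by (simp only: onb_inner_eq[OF onb, of "g _" y] arr_def sum_distrib_right)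
      also have "\<dots> = (\<Sum>j<d. (\<Sum>k<d. arr e g i k * arr e g j k) * inner (e j) y)"
        unfolding sum_distrib_right by (subst sum.swap) (simp add: mult_ac)
      also have "\<dots> = (\<Sum>j<d. if j = i then inner (e i) y else 0)"
        using arr_orthogonal(1)[OF onb g] i by (intro sum.cong refl) (auto simp: orthogonal_array_def)
      finally show "inner (e i) (g (\<Sum>k<d. inner (g (e k)) y *\<^sub>R e k)) = inner (e i) y"
        using i by simp
    qed
  qed
qed

lemma SO_D:
  assumes onb: "orthonormal_basis d e" and "g \<in> SO d e"
  shows "orthogonal_transformation g" "linear g" "inner (g v) (g w) = inner v w" "norm (g v) = norm v"
    "g (inv g v) = v" "inv g (g v) = v" "inner (inv g v) w = inner v (g w)" "linear (inv g)" "norm (inv g v) = norm v"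
    "bounded_linear g" "bounded_linear (inv g)"
proof -
  show g: "orthogonal_transformation g"
    using assms(2) by (simp add: SO_def)
  then show lin: "linear g" and inner: "inner (g v) (g w) = inner v w" for v w
    by (simp_all add: orthogonal_transformation_def)
  have bij: "bij g"
    by (rule orthogonal_bij[OF onb g])
  then show gi: "g (inv g v) = v" and "inv g (g v) = v" for v
    by (simp_all add: bij_is_surj surj_f_inv_f bij_is_inj)
  show "norm (g v) = norm v" for v
    by (rule orthogonal_transformation_norm[OF g])
  show "inner (inv g v) w = inner v (g w)"
    using inner[of "inv g v" w] by (simp add: gi)
  show nv: "norm (inv g v) = norm v" for v
    using orthogonal_transformation_norm[OF g, of "inv g v"] by (simp add: gi)
  show il: "linear (inv g)"
    by (rule linearI; rule injD[OF bij_is_inj[OF bij]]) (simp_all add: linear_add[OF lin] linear_scale[OF lin] gi)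
  show "bounded_linear g"
    using lin orthogonal_transformation_norm[OF g]
    by (intro bounded_linear_intro[of g 1]) (auto simp: linear_add linear_scale)
  show "bounded_linear (inv g)"
    using il nv by (intro bounded_linear_intro[of "inv g" 1]) (auto simp: linear_add linear_scale)
qed

lemma blinfun_apply_Ad:
  assumes "orthonormal_basis d e" "g \<in> SO d e"
  shows "blinfun_apply (Ad g X) v = g (blinfun_apply X (inv g v))"
proof -
  have "bounded_linear (g \<circ> blinfun_apply X \<circ> inv g)"
    unfolding o_def by (intro bounded_linear_compose[OF SO_D(10)[OF assms]]
        bounded_linear_compose[OF blinfun.bounded_linear_right SO_D(11)[OF assms]])
  then show ?thesis
    by (simp add: Ad_def bounded_linear_Blinfun_apply)
qed

lemma Ad_so:
  assumes "orthonormal_basis d e" "g \<in> SO d e" "X \<in> so"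
  shows "Ad g X \<in> so"
proof -
  have X: "inner (blinfun_apply X v) w = - inner v (blinfun_apply X w)" for v w
    using assms(3) unfolding so_def by blast
  have "inner (g u) w = inner u (inv g w)" for u w
    using SO_D(7)[OF assms(1,2), of w u] by (simp add: inner_commute)
  then show ?thesis
    unfolding so_def mem_Collect_eq blinfun_apply_Ad[OF assms(1,2)] by (simp add: X SO_D(7)[OF assms(1,2)])
qed

lemma mat_of_Ad:
  assumes onb: "orthonormal_basis d e" and g: "g \<in> SO d e"
  shows "mat_of e (Ad g X) k l = (\<Sum>a<d. \<Sum>b<d. arr e g k a * arr e g l b * mat_of e X a b)"
proof -
  note lin = linear_sum[OF SO_D(2)[OF onb g]] linear_scale[OF SO_D(2)[OF onb g]]
  have "inv g (e k) = (\<Sum>a<d. arr e g k a *\<^sub>R e a)"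
    by (subst onb_expand[OF onb, of "inv g (e k)", symmetric])
      (simp add: arr_def SO_D(7)[OF onb g] inner_commute[of _ "inv g _"])
  then have "g (blinfun_apply X (inv g (e k))) = (\<Sum>a<d. arr e g k a *\<^sub>R g (blinfun_apply X (e a)))"
    by (simp add: blinfun.sum_right blinfun.scaleR_right lin)
  also have "\<dots> = (\<Sum>a<d. arr e g k a *\<^sub>R g (\<Sum>b<d. inner (e b) (blinfun_apply X (e a)) *\<^sub>R e b))"
    by (simp only: onb_expand[OF onb])
  also have "\<dots> = (\<Sum>a<d. \<Sum>b<d. (arr e g k a * mat_of e X a b) *\<^sub>R g (e b))"
    by (simp add: lin scaleR_sum_right mat_of_def inner_commute)
  finally show ?thesis
    unfolding mat_of_def[of e "Ad g X"] blinfun_apply_Ad[OF onb g]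
    by (simp add: inner_sum_right arr_def inner_commute[of _ "e l"] mult_ac)
qed

section \<open>Transformation of the coefficients under rotations\<close>

definition pull_coeff :: "nat \<Rightarrow> (nat \<Rightarrow> nat \<Rightarrow> real) \<Rightarrow> nat set \<Rightarrow> nat set \<Rightarrow> real" where
  "pull_coeff d g I J = cf (mprod (gen_comb d dX g) I) J {}"

lemma pull_coeff_card: "pull_coeff d g I J \<noteq> 0 \<Longrightarrow> card I = card J"
proof -
  have "tot_degree d (card I) (mprod (gen_comb d dX g) I)"
    by (rule tot_degree_mprod) simp
  then show "pull_coeff d g I J \<noteq> 0 \<Longrightarrow> card I = card J"
    by (fastforce simp: pull_coeff_def tot_degree_def)
qed

lemma pullback_inv:
  assumes "orthonormal_basis d e" "g \<in> SO d e" "J \<subseteq> {..<d}"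
  shows "pullback d e (inv g) \<omega> x J = (\<Sum>I\<in>Pow {..<d}. \<omega> (inv g x) I * pull_coeff d (arr e g) I J)"
proof -
  have "pullback_dx d e (inv g) = (\<lambda>i K. \<Sum>j<d. arr e g j i * monom_ext {j} K)"
    by (auto simp: pullback_dx_def arr_def fun_eq_iff inner_commute[of _ "inv g _"] SO_D(7)[OF assms(1,2)])
  moreover have "finite J"
    using assms(3) finite_subset by auto
  ultimately show ?thesis
    by (simp add: pullback_def cf_mprod_pullback pull_coeff_def mprod_def)
qed

lemma equivariantI:
  assumes "orthonormal_basis d e"
    and "\<And>g X x J. g \<in> SO d e \<Longrightarrow> X \<in> so \<Longrightarrow> x \<in> N \<Longrightarrow> J \<subseteq> {..<d} \<Longrightarrow>
      \<alpha> (Ad g X) x J = (\<Sum>I\<in>Pow {..<d}. \<alpha> X (inv g x) I * pull_coeff d (arr e g) I J)"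
  shows "equivariant d e N \<alpha>"
  unfolding equivariant_def eq_on_def using assms by (simp add: pullback_inv)

lemma thom_coeff_Ad:
  assumes "orthonormal_basis d e" "g \<in> SO d e"
  shows "thom_coeff d e (Ad g X) J = (\<Sum>I\<in>Pow {..<d}. thom_coeff d e X I * pull_coeff d (arr e g) I J)"
proof -
  have "subst d (gen_comb d dX (arr e g)) (gen_comb d eE (arr e g)) (expE d 1 (mat_of e X)) = expE d 1 (mat_of e (Ad g X))"
    using assms by (intro subst_expE arr_orthogonal(1) SO_D(1) mat_of_Ad)
  moreover have "Determinant.det (mat d d (\<lambda>(i, k). arr e g i k)) = 1"
    using assms(2) by (simp add: SO_iff)
  ultimately show ?thesis
    using cf_subst_top[of d "arr e g" "expE d 1 (mat_of e X)" J] by (simp add: thom_coeff_def pull_coeff_def)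
qed

lemma contr_along_thom_coeff:
  "contr_along d v (thom_coeff d e X) I = cf ((\<Sum>k<d. v k *\<^sub>R eE k) * expE d 1 (mat_of e X)) I {..<d}"
  by (simp add: contr_along_def sum_distrib_right cf_eE_expE)

text \<open>By \<open>contr_along_thom_coeff\<close> the contraction is the Berezin integral of the
  exponential multiplied by the vector \<open>x\<close> in the second factor. The substitution
  carries that vector to \<open>g x\<close>, so the argument for \<open>thom_coeff_Ad\<close>
  applies again.\<close>

lemma contr_along_Ad:
  assumes onb: "orthonormal_basis d e" and g: "g \<in> SO d e"
  shows "contr_along d (\<lambda>k. inner (e k) (g x)) (thom_coeff d e (Ad g X)) J =
    (\<Sum>I\<in>Pow {..<d}. contr_along d (\<lambda>k. inner (e k) x) (thom_coeff d e X) I * pull_coeff d (arr e g) I J)"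
proof -
  let ?\<phi> = "gen_comb d dX (arr e g)" and ?\<psi> = "gen_comb d eE (arr e g)"
  let ?E = "expE d 1 (mat_of e X)"
  have anti: "anticommuting ?\<psi>" "?\<psi> j * ?\<phi> k = - (?\<phi> k * ?\<psi> j)" for j k
    unfolding anticommuting_def by (intro allI gen_comb_anticomm eE_anticomm eE_dX_anticomm)+
  have x: "(\<Sum>k<d. inner (e k) x *\<^sub>R ?\<psi> k) = (\<Sum>j<d. inner (e j) (g x) *\<^sub>R eE j)"
  proof -
    have "inner (e j) (g x) = (\<Sum>k<d. inner (e k) x * arr e g j k)" for j
      by (subst onb_expand[OF onb, of x, symmetric])
        (simp add: linear_sum[OF SO_D(2)[OF onb g]] linear_scale[OF SO_D(2)[OF onb g]] inner_sum_right arr_def)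
    then show ?thesis
      unfolding gen_comb_def by (simp add: scaleR_sum_right scaleR_sum_left) (rule sum.swap)
  qed
  have "subst d ?\<phi> ?\<psi> ((\<Sum>k<d. inner (e k) x *\<^sub>R eE k) * ?E) = (\<Sum>k<d. inner (e k) x *\<^sub>R ?\<psi> k) * subst d ?\<phi> ?\<psi> ?E"
    by (simp add: sum_distrib_right linear_sum[OF linear_subst] linear_scale[OF linear_subst] subst_eE[OF anti])
  also have "subst d ?\<phi> ?\<psi> ?E = expE d 1 (mat_of e (Ad g X))"
    using assms by (intro subst_expE arr_orthogonal(1) SO_D(1) mat_of_Ad)
  finally have "subst d ?\<phi> ?\<psi> ((\<Sum>k<d. inner (e k) x *\<^sub>R eE k) * ?E) =
      (\<Sum>j<d. inner (e j) (g x) *\<^sub>R eE j) * expE d 1 (mat_of e (Ad g X))"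
    by (simp only: x)
  moreover have "Determinant.det (mat d d (\<lambda>(i, k). arr e g i k)) = 1"
    using g by (simp add: SO_iff)
  ultimately show ?thesis
    using cf_subst_top[of d "arr e g" "(\<Sum>k<d. inner (e k) x *\<^sub>R eE k) * ?E" J]
    by (simp add: contr_along_thom_coeff pull_coeff_def)
qed

text \<open>Multiplicativity of the pull-back for a factor \<open>dx_k\<close> on the left; it
  serves the product of the differential of the cutoff with \<beta>.\<close>

lemma gen_wedge_pull:
  assumes "k < d"
  shows "(\<Sum>I\<in>Pow {..<d}. gen_wedge k a I * pull_coeff d g I J) =
    (\<Sum>j<d. g j k * gen_wedge j (\<lambda>J. \<Sum>I\<in>Pow {..<d}. a I * pull_coeff d g I J) J)"
proof -
  let ?\<phi> = "gen_comb d dX g"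
  have "anticommuting ?\<phi>"
    unfolding anticommuting_def by (intro allI gen_comb_anticomm dX_anticomm)
  then have "(\<Sum>I\<in>Pow {..<d}. gen_wedge k a I * pull_coeff d g I J) = cf (?\<phi> k * (\<Sum>I\<in>Pow {..<d}. a I *\<^sub>R mprod ?\<phi> I)) J {}"
    by (simp only: sum_gen_wedge_mprod[OF _ assms]) (simp add: pull_coeff_def)
  also have "\<dots> = (\<Sum>j<d. g j k * gen_wedge j (\<lambda>J. \<Sum>I\<in>Pow {..<d}. a I * pull_coeff d g I J) J)"
    unfolding gen_comb_def[of d dX g k] sum_distrib_right mult_scaleR_left cf_sum cf_scaleR cf_dX_mult gen_wedge_def
    by (simp add: pull_coeff_def cong: if_cong)
  finally show ?thesis .
qed

section \<open>Smooth functions\<close>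

lemma cont_diff_on_imp_continuous: "cont_diff_on n U f \<Longrightarrow> continuous_on U f"
  by (cases n) (auto intro!: continuous_at_imp_continuous_on differentiable_imp_continuous_within)

lemma cont_diff_on_Suc_D: "cont_diff_on (Suc n) U f \<Longrightarrow> cont_diff_on n U f"
proof (induction n arbitrary: f)
  case 0
  then show ?case
    using cont_diff_on_imp_continuous[OF 0] by simp
next
  case (Suc n)
  then show ?case
    by (metis cont_diff_on.simps(2))
qed

lemma cont_diff_on_cong:
  assumes "open U" "cont_diff_on n U f" "\<And>x. x \<in> U \<Longrightarrow> f x = g x"
  shows "cont_diff_on n U g"
  using assms(2,3)
proof (induction n arbitrary: f g)
  case 0
  then show ?case
    using continuous_on_cong[OF refl 0(2)] by simp
next
  case (Suc n)
  have eq: "frechet_derivative f (at x) = frechet_derivative g (at x)" if "x \<in> U" for x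
  proof (rule frechet_derivative_transform_within_open[OF _ assms(1) that Suc.prems(2)])
    show "f differentiable (at x)"
      using Suc.prems(1) that by simp
  qed
  have "g differentiable (at x)" if "x \<in> U" for x
  proof -
    obtain D where "(f has_derivative D) (at x)"
      using Suc.prems(1) \<open>x \<in> U\<close> by (auto simp: differentiable_def)
    from has_derivative_transform_within_open[OF this assms(1) \<open>x \<in> U\<close> Suc.prems(2)] show ?thesis
      by (auto simp: differentiable_def)
  qed
  moreover have "cont_diff_on n U (\<lambda>x. frechet_derivative g (at x) v)" for v
  proof (rule Suc.IH)
    show "cont_diff_on n U (\<lambda>x. frechet_derivative f (at x) v)"
      using Suc.prems(1) by simp
  qed (simp only: eq)
  ultimately show ?case
    by simp
qed

text \<open>Lets the closure properties be proved with explicit derivative formulas. These agree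
  with \<open>frechet_derivative\<close> only on the open set, which is why
  \<open>cont_diff_on_cong\<close> comes before.\<close>

lemma cont_diff_on_SucI:
  assumes "open U" "\<And>x. x \<in> U \<Longrightarrow> (f has_derivative f' x) (at x)" "\<And>v. cont_diff_on n U (\<lambda>x. f' x v)"
  shows "cont_diff_on (Suc n) U f"
proof -
  have "cont_diff_on n U (\<lambda>x. frechet_derivative f (at x) v)" for v
    by (rule cont_diff_on_cong[OF assms(1) assms(3)[of v]]) (metis assms(2) frechet_derivative_at)
  with assms(2) show ?thesis
    by (auto simp: differentiable_def)
qed

lemma cont_diff_on_has_derivative:
  "cont_diff_on (Suc n) U f \<Longrightarrow> x \<in> U \<Longrightarrow> (f has_derivative frechet_derivative f (at x)) (at x)"
  by (simp add: frechet_derivative_works)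

lemma cont_diff_on_const: "open U \<Longrightarrow> cont_diff_on n U (\<lambda>x. c)"
proof (induction n arbitrary: c)
  case (Suc n)
  then show ?case
    by (intro cont_diff_on_SucI[where f'="\<lambda>x v. 0"]) auto
qed simp

lemma cont_diff_on_linear: "open U \<Longrightarrow> bounded_linear f \<Longrightarrow> cont_diff_on n U f"
proof (induction n)
  case 0
  then show ?case
    by (simp add: linear_continuous_on)
next
  case (Suc n)
  then show ?case
    by (intro cont_diff_on_SucI[where f'="\<lambda>x. f"] bounded_linear_imp_has_derivative cont_diff_on_const)
qed

lemma cont_diff_on_add:
  "open U \<Longrightarrow> cont_diff_on n U f \<Longrightarrow> cont_diff_on n U g \<Longrightarrow> cont_diff_on n U (\<lambda>x. f x + g x)"
proof (induction n arbitrary: f g)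
  case (Suc n)
  show ?case
    by (rule cont_diff_on_SucI[where f'="\<lambda>x v. frechet_derivative f (at x) v + frechet_derivative g (at x) v"])
      (use Suc in \<open>auto intro!: has_derivative_add simp: frechet_derivative_works\<close>)
qed (auto intro: continuous_on_add)

lemma cont_diff_on_mult:
  "open U \<Longrightarrow> cont_diff_on n U f \<Longrightarrow> cont_diff_on n U g \<Longrightarrow> cont_diff_on n U (\<lambda>x. f x * g x)"
proof (induction n arbitrary: f g)
  case (Suc n)
  show ?case
  proof (rule cont_diff_on_SucI[where f'="\<lambda>x v. f x * frechet_derivative g (at x) v + frechet_derivative f (at x) v * g x"])
    show "((\<lambda>x. f x * g x) has_derivative
      (\<lambda>v. f x * frechet_derivative g (at x) v + frechet_derivative f (at x) v * g x)) (at x)" if "x \<in> U" for x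
      using Suc.prems that by (intro has_derivative_mult) (auto simp: frechet_derivative_works)
    show "cont_diff_on n U (\<lambda>x. f x * frechet_derivative g (at x) v + frechet_derivative f (at x) v * g x)" for v
      using Suc.prems cont_diff_on_Suc_D[OF Suc.prems(2)] cont_diff_on_Suc_D[OF Suc.prems(3)]
      by (intro cont_diff_on_add Suc.IH) auto
  qed (rule Suc.prems(1))
qed (auto intro: continuous_on_mult)

lemma cont_diff_on_exp:
  "open U \<Longrightarrow> cont_diff_on n U f \<Longrightarrow> cont_diff_on n U (\<lambda>x. exp (f x))"
proof (induction n)
  case (Suc n)
  show ?case
  proof (rule cont_diff_on_SucI[where f'="\<lambda>x v. exp (f x) * frechet_derivative f (at x) v"])
    show "((\<lambda>x. exp (f x)) has_derivative (\<lambda>v. exp (f x) * frechet_derivative f (at x) v)) (at x)" if "x \<in> U" for x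
      using Suc.prems that
      by (auto intro!: derivative_eq_intros simp: frechet_derivative_works)
    show "cont_diff_on n U (\<lambda>x. exp (f x) * frechet_derivative f (at x) v)" for v
      using Suc.prems cont_diff_on_Suc_D[OF Suc.prems(2)] by (intro cont_diff_on_mult Suc.IH) auto
  qed (rule Suc.prems(1))
qed (auto intro: continuous_on_exp)

text \<open>The exponent is generalized in the induction because each derivative lowers it by
  one.\<close>

lemma cont_diff_on_powr:
  "open U \<Longrightarrow> (\<And>x. x \<in> U \<Longrightarrow> f x > 0) \<Longrightarrow> cont_diff_on n U f \<Longrightarrow> cont_diff_on n U (\<lambda>x. f x powr a)"
proof (induction n arbitrary: a)
  case 0
  then show ?case
    by (simp, intro continuous_on_powr continuous_on_const) (metis less_irrefl)+
next
  case (Suc n)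
  show ?case
  proof (rule cont_diff_on_SucI[where f'="\<lambda>x v. (a * f x powr (a - 1)) * frechet_derivative f (at x) v"])
    show "((\<lambda>x. f x powr a) has_derivative (\<lambda>v. (a * f x powr (a - 1)) * frechet_derivative f (at x) v)) (at x)"
      if "x \<in> U" for x
    proof -
      have "((\<lambda>x. f x powr a) has_derivative (\<lambda>h. f x powr a * (frechet_derivative f (at x) h * a / f x))) (at x)"
        using Suc.prems that
        by (auto intro!: derivative_eq_intros simp: frechet_derivative_works)
      moreover have "f x powr a = f x powr (a - 1) * f x"
        using Suc.prems(2)[OF that] by (simp add: powr_diff)
      then have "(\<lambda>h. f x powr a * (frechet_derivative f (at x) h * a / f x)) =
          (\<lambda>v. (a * f x powr (a - 1)) * frechet_derivative f (at x) v)"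
        using Suc.prems(2)[OF that] by (simp add: fun_eq_iff)
      ultimately show ?thesis
        by simp
    qed
    show "cont_diff_on n U (\<lambda>x. (a * f x powr (a - 1)) * frechet_derivative f (at x) v)" for v
      using Suc.prems cont_diff_on_Suc_D[OF Suc.prems(3)] by (intro cont_diff_on_mult cont_diff_on_const Suc.IH) auto
  qed (rule Suc.prems(1))
qed

lemma cont_diff_on_Un:
  "open U \<Longrightarrow> open V \<Longrightarrow> cont_diff_on n U f \<Longrightarrow> cont_diff_on n V f \<Longrightarrow> cont_diff_on n (U \<union> V) f"
  by (induction n arbitrary: f) (auto intro: continuous_on_open_Un)

lemma cont_diff_on_subset: "cont_diff_on n U f \<Longrightarrow> V \<subseteq> U \<Longrightarrow> cont_diff_on n V f"
  by (induction n arbitrary: f) (auto intro: continuous_on_subset)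

lemma smooth_on_cong: "open U \<Longrightarrow> smooth_on U f \<Longrightarrow> (\<And>x. x \<in> U \<Longrightarrow> f x = g x) \<Longrightarrow> smooth_on U g"
  unfolding smooth_on_def by (blast intro: cont_diff_on_cong)

lemma smooth_on_const: "open U \<Longrightarrow> smooth_on U (\<lambda>x. c)"
  by (simp add: smooth_on_def cont_diff_on_const)

lemma smooth_on_linear: "open U \<Longrightarrow> bounded_linear f \<Longrightarrow> smooth_on U f"
  by (simp add: smooth_on_def cont_diff_on_linear)

lemma smooth_on_add: "open U \<Longrightarrow> smooth_on U f \<Longrightarrow> smooth_on U g \<Longrightarrow> smooth_on U (\<lambda>x. f x + g x)"
  by (simp add: smooth_on_def cont_diff_on_add)

lemma smooth_on_mult: "open U \<Longrightarrow> smooth_on U f \<Longrightarrow> smooth_on U g \<Longrightarrow> smooth_on U (\<lambda>x. f x * g x)"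
  by (simp add: smooth_on_def cont_diff_on_mult)

lemma smooth_on_minus: "open U \<Longrightarrow> smooth_on U f \<Longrightarrow> smooth_on U (\<lambda>x. - f x)"
  using smooth_on_mult[OF _ smooth_on_const[of U "-1"], of f] by simp

lemma smooth_on_sum: "open U \<Longrightarrow> (\<And>a. a \<in> A \<Longrightarrow> smooth_on U (f a)) \<Longrightarrow> smooth_on U (\<lambda>x. \<Sum>a\<in>A. f a x)"
  by (induction A rule: infinite_finite_induct) (auto intro: smooth_on_const smooth_on_add)

lemma smooth_on_exp: "open U \<Longrightarrow> smooth_on U f \<Longrightarrow> smooth_on U (\<lambda>x. exp (f x))"
  by (simp add: smooth_on_def cont_diff_on_exp)

lemma smooth_on_powr: "open U \<Longrightarrow> (\<And>x. x \<in> U \<Longrightarrow> f x > 0) \<Longrightarrow> smooth_on U f \<Longrightarrow> smooth_on U (\<lambda>x. f x powr a)"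
  by (simp add: smooth_on_def cont_diff_on_powr)

lemma smooth_on_Un: "open U \<Longrightarrow> open V \<Longrightarrow> smooth_on U f \<Longrightarrow> smooth_on V f \<Longrightarrow> smooth_on (U \<union> V) f"
  by (simp add: smooth_on_def cont_diff_on_Un)

lemma smooth_on_subset: "smooth_on U f \<Longrightarrow> V \<subseteq> U \<Longrightarrow> smooth_on V f"
  unfolding smooth_on_def by (blast intro: cont_diff_on_subset)

lemma smooth_on_inner: "open U \<Longrightarrow> smooth_on U (\<lambda>x. inner v x)"
  by (intro smooth_on_linear bounded_linear_inner_right)

lemma smooth_on_norm_square:
  fixes e :: "nat \<Rightarrow> 'a::real_inner" and U :: "'a set"
  assumes "orthonormal_basis d e" "open U"
  shows "smooth_on U (\<lambda>x. (norm x)\<^sup>2)"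
  unfolding onb_norm_eq[OF assms(1)] power2_eq_square[of "inner _ _"]
  by (intro smooth_on_sum smooth_on_mult smooth_on_inner assms)

lemma smooth_on_partial: "smooth_on U f \<Longrightarrow> smooth_on U (partial e k f)"
  unfolding smooth_on_def partial_def by (metis cont_diff_on.simps(2))

lemma smooth_on_has_derivative:
  "smooth_on U f \<Longrightarrow> x \<in> U \<Longrightarrow> (f has_derivative frechet_derivative f (at x)) (at x)"
  unfolding smooth_on_def using cont_diff_on_has_derivative by blast

lemma smooth_on_continuous: "smooth_on U f \<Longrightarrow> continuous_on U f"
  unfolding smooth_on_def using cont_diff_on_imp_continuous by blast

lemma partial_eqI: "(f has_derivative f') (at x) \<Longrightarrow> partial e k f x = f' (e k)"
  unfolding partial_def by (metis frechet_derivative_at)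

lemma partial_transform:
  "(f has_derivative f') (at x) \<Longrightarrow> open U \<Longrightarrow> x \<in> U \<Longrightarrow> (\<And>y. y \<in> U \<Longrightarrow> g y = f y) \<Longrightarrow> partial e k g x = f' (e k)"
  by (rule partial_eqI) (auto intro: has_derivative_transform_within_open[of f _ x UNIV U g])

lemma frechet_partial_sum:
  assumes onb: "orthonormal_basis d e" and f: "(f has_derivative f') (at x)"
  shows "f' v = (\<Sum>k<d. inner (e k) v * partial e k f x)"
proof -
  have lin: "linear f'"
    using f has_derivative_linear by blast
  show ?thesis
    by (subst onb_expand[OF onb, of v, symmetric])
      (simp add: linear_sum[OF lin] linear_scale[OF lin] partial_eqI[OF f])
qed


section \<open>The equivariant differential in coordinates\<close>

lemma contract_eq: "contract d e v \<omega> x I = contr_along d (\<lambda>k. inner (e k) (v x)) (\<omega> x) I"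
proof -
  have "contract d e v \<omega> x I = (\<Sum>k\<in>{..<d} - I. inner (e k) (v x) * gen_contr k (\<omega> x) I)"
    unfolding contract_def by (intro sum.cong refl) (auto simp: gen_contr_def ins_sign_def)
  also have "\<dots> = (\<Sum>k<d. inner (e k) (v x) * gen_contr k (\<omega> x) I)"
    by (rule sum.mono_neutral_left) (auto simp: gen_contr_def)
  finally show ?thesis
    by (simp add: contr_along_def)
qed

lemma ext_d_eq:
  "finite I \<Longrightarrow> ext_d d e \<omega> x I = (\<Sum>k<d. gen_wedge k (\<lambda>J. partial e k (\<lambda>y. \<omega> y J) x) I)"
  by (simp add: ext_d_def wedge_gen)

lemma funpow_scaleR_blinfun:
  fixes X :: "'a::real_normed_vector \<Rightarrow>\<^sub>L 'a"
  shows "(blinfun_apply (c *\<^sub>R X) ^^ n) x = c ^ n *\<^sub>R (blinfun_apply X ^^ n) x"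
  by (induction n) (simp_all add: scaleR_blinfun.rep_eq blinfun.scaleR_right)

lemma norm_funpow_blinfun:
  fixes X :: "'a::real_normed_vector \<Rightarrow>\<^sub>L 'a"
  shows "norm ((blinfun_apply X ^^ n) x) \<le> norm X ^ n * norm x"
proof (induction n)
  case (Suc n)
  have "norm ((blinfun_apply X ^^ Suc n) x) \<le> norm X * norm ((blinfun_apply X ^^ n) x)"
    by (simp add: norm_blinfun)
  also have "\<dots> \<le> norm X * (norm X ^ n * norm x)"
    by (intro mult_left_mono Suc) simp
  finally show ?case
    by (simp add: mult.assoc)
qed simp

text \<open>Each coordinate of the exponential is a real power series in the parameter, dominated by
  that of the scalar exponential and hence differentiable termwise at \<open>0\<close>. The sign
  comes from \<open>- \<epsilon>\<close> in \<open>vfield\<close>.\<close>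

lemma vfield_eq:
  fixes X :: "'a::real_inner \<Rightarrow>\<^sub>L 'a" and e :: "nat \<Rightarrow> 'a"
  assumes onb: "orthonormal_basis d e"
  shows "vfield X x = - blinfun_apply X x"
proof -
  define a where "a k n = inner (e k) ((blinfun_apply X ^^ n) x) / fact n" for k n
  define s where "s k r = (\<Sum>n. a k n * r ^ n)" for k and r :: real
  have summ: "summable (\<lambda>n. a k n * r ^ n)" for k r
  proof (rule summable_comparison_test)
    show "\<exists>N. \<forall>n\<ge>N. norm (a k n * r ^ n) \<le> norm (e k) * norm x * (inverse (fact n) * (norm X * \<bar>r\<bar>) ^ n)"
    proof (intro exI allI impI)
      fix n
      have "\<bar>inner (e k) ((blinfun_apply X ^^ n) x)\<bar> \<le> norm (e k) * (norm X ^ n * norm x)"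
        using Cauchy_Schwarz_ineq2[of "e k" "(blinfun_apply X ^^ n) x"] norm_funpow_blinfun[of n X x]
        by (meson mult_left_mono norm_ge_zero order_trans)
      then have "\<bar>inner (e k) ((blinfun_apply X ^^ n) x)\<bar> * (\<bar>r\<bar> ^ n / fact n) \<le> norm (e k) * (norm X ^ n * norm x) * (\<bar>r\<bar> ^ n / fact n)"
        by (intro mult_right_mono) auto
      then show "norm (a k n * r ^ n) \<le> norm (e k) * norm x * (inverse (fact n) * (norm X * \<bar>r\<bar>) ^ n)"
        by (simp add: a_def abs_mult power_abs power_mult_distrib field_simps)
    qed
    show "summable (\<lambda>n. norm (e k) * norm x * (inverse (fact n) * (norm X * \<bar>r\<bar>) ^ n))"
      by (intro summable_mult summable_exp)
  qed
  have "(s k has_field_derivative (\<Sum>n. diffs (a k) n * 0 ^ n)) (at 0)" for k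
    unfolding s_def by (rule termdiffs_strong[of _ 1]) (use summ[of k 1] in auto)
  then have ds: "(s k has_field_derivative inner (e k) (blinfun_apply X x)) (at 0)" for k
    unfolding powser_zero by (simp add: a_def diffs_def)
  have eq: "exp_endo ((- r) *\<^sub>R X) x = (\<Sum>k<d. s k (- r) *\<^sub>R e k)" for r
  proof -
    have "(\<lambda>n. \<Sum>k<d. (a k n * (- r) ^ n) *\<^sub>R e k) sums (\<Sum>k<d. s k (- r) *\<^sub>R e k)"
      unfolding s_def by (intro sums_sum sums_scaleR_left summable_sums summ)
    moreover have "(\<Sum>k<d. (a k n * (- r) ^ n) *\<^sub>R e k) = (1 / fact n) *\<^sub>R ((blinfun_apply ((- r) *\<^sub>R X) ^^ n) x)" for n
    proof -
      have "(\<Sum>k<d. (a k n * (- r) ^ n) *\<^sub>R e k) =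
          ((- r) ^ n / fact n) *\<^sub>R (\<Sum>k<d. inner (e k) ((blinfun_apply X ^^ n) x) *\<^sub>R e k)"
        by (simp add: a_def scaleR_sum_right mult_ac)
      then show ?thesis
        by (simp only: onb_expand[OF onb] funpow_scaleR_blinfun scaleR_scaleR) simp
    qed
    ultimately show ?thesis
      unfolding exp_endo_def by (simp add: sums_iff)
  qed
  have "((\<lambda>r. s k (- r) *\<^sub>R e k) has_vector_derivative (- inner (e k) (blinfun_apply X x)) *\<^sub>R e k) (at 0)" for k
  proof -
    have "((\<lambda>r. s k (- r)) has_field_derivative (inner (e k) (blinfun_apply X x) * (- 1))) (at 0)"
      by (rule DERIV_chain2[of "s k"]) (auto simp: ds intro!: derivative_eq_intros)
    then show ?thesis
      by (intro has_vector_derivative_scaleR[THEN has_vector_derivative_eq_rhs])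
         (auto simp: has_real_derivative_iff_has_vector_derivative)
  qed
  then have "((\<lambda>r. \<Sum>k<d. s k (- r) *\<^sub>R e k) has_vector_derivative (\<Sum>k<d. (- inner (e k) (blinfun_apply X x)) *\<^sub>R e k)) (at 0)"
    by (intro has_vector_derivative_sum)
  from vector_derivative_at[OF this] have "vfield X x = (\<Sum>k<d. (- inner (e k) (blinfun_apply X x)) *\<^sub>R e k)"
    by (simp only: vfield_def eq)
  also have "\<dots> = - (\<Sum>k<d. inner (e k) (blinfun_apply X x) *\<^sub>R e k)"
    by (simp add: sum_negf)
  finally show ?thesis
    by (simp only: onb_expand[OF onb])
qed

text \<open>The field \<open>vfield X\<close> is \<open>- X x\<close>, so the minus sign in
  \<open>D_eq\<close> turns into a plus.\<close>

lemma D_eq_eq: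
  assumes "orthonormal_basis d e" "finite I"
  shows "D_eq d e \<alpha> X x I = (\<Sum>k<d. gen_wedge k (\<lambda>J. partial e k (\<lambda>y. \<alpha> X y J) x) I)
    + contr_along d (\<lambda>k. inner (e k) (blinfun_apply X x)) (\<alpha> X x) I"
  by (simp add: D_eq_def ext_d_eq[OF assms(2)] contract_eq vfield_eq[OF assms(1)] contr_along_def sum_negf)

section \<open>Gaussian moments on the half line\<close>

text \<open>Half of Gamma at \<open>(m + 1) / 2\<close>, evaluated by factorials according to the
  parity of \<open>m\<close>; the recursion \<open>gauss_moment_rec\<close> is the functional
  equation of Gamma.\<close>

definition gauss_moment :: "nat \<Rightarrow> real" where
  "gauss_moment m = (if even m then sqrt pi / 2 * (fact m / (2 ^ m * fact (m div 2))) else fact (m div 2) / 2)"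

lemma has_integral_gauss_moment:
  "has_bochner_integral lborel (\<lambda>t::real. indicator {0..} t *\<^sub>R (exp (- t\<^sup>2) * t ^ m)) (gauss_moment m)"
proof (cases "even m")
  case True
  then show ?thesis
    using gaussian_moment_even_pos[of "m div 2"] by (simp add: gauss_moment_def)
next
  case False
  then obtain k where "m = 2 * k + 1"
    by (elim oddE)
  then show ?thesis
    using gaussian_moment_odd_pos[of k] by (simp add: gauss_moment_def)
qed

lemma gauss_moment_1: "gauss_moment 1 = 1 / 2"
  by (simp add: gauss_moment_def)

lemma gauss_moment_rec: "2 * gauss_moment (m + 2) = (real m + 1) * gauss_moment m"
proof (cases "even m")
  case True
  then obtain k where m: "m = 2 * k"
    by (elim evenE)
  define F P Q :: real where "F = fact (2 * k)" and "P = 4 ^ k" and "Q = fact k"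
  have pos: "P \<noteq> 0" "Q \<noteq> 0" "real k + 1 \<noteq> 0"
    by (auto simp: P_def Q_def)
  have 1: "gauss_moment m = sqrt pi / 2 * (F / (P * Q))"
    by (simp add: gauss_moment_def power_mult m F_def P_def Q_def)
  have 2: "gauss_moment (m + 2) = sqrt pi / 2 * (fact (2 * k + 2) / (2 ^ (2 * k + 2) * fact (Suc k)))"
    by (simp add: gauss_moment_def m del: fact_Suc power_Suc)
  have 3: "(fact (2 * k + 2) :: real) = 2 * (real k + 1) * (2 * real k + 1) * F"
    by (simp add: F_def algebra_simps)
  have 4: "(2 :: real) ^ (2 * k + 2) = 4 * P" "(fact (Suc k) :: real) = (real k + 1) * Q"
    by (simp_all add: P_def Q_def power_add power_mult)
  have 5: "2 * a * b * F / (4 * P * (a * Q)) = b * F / (2 * P * Q)" if "a \<noteq> 0" for a b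
    using that by (simp add: mult_ac)
  have "gauss_moment (m + 2) = sqrt pi / 2 * ((2 * real k + 1) * F / (2 * P * Q))"
    unfolding 2 3 4 5[OF pos(3)] ..
  then show ?thesis
    unfolding 1 by (simp add: m)
next
  case False
  then obtain k where m: "m = 2 * k + 1"
    by (elim oddE)
  then show ?thesis
    by (simp add: gauss_moment_def algebra_simps)
qed

lemma has_integral_gauss_int:
  assumes "r > 0"
  shows "has_bochner_integral lborel (\<lambda>t. indicator {0..} t *\<^sub>R (exp (- (t\<^sup>2 * r\<^sup>2)) * t ^ m)) (gauss_moment m / r ^ Suc m)"
proof -
  have "has_bochner_integral lborel (\<lambda>t. indicator {0..} (0 + r * t) *\<^sub>R (exp (- (0 + r * t)\<^sup>2) * (0 + r * t) ^ m)) (gauss_moment m /\<^sub>R \<bar>r\<bar>)"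
    using lborel_has_bochner_integral_real_affine_iff[of r "\<lambda>t. indicat_real {0..} t *\<^sub>R (exp (- t\<^sup>2) * t ^ m)" "gauss_moment m" 0]
      has_integral_gauss_moment[of m] assms by blast
  from has_bochner_integral_mult_right[OF this, of "1 / r ^ m"]
  show ?thesis
  proof (rule has_bochner_integral_cong[THEN iffD1, rotated -1])
    fix t
    show "1 / r ^ m * (indicat_real {0..} (0 + r * t) *\<^sub>R (exp (- (0 + r * t)\<^sup>2) * (0 + r * t) ^ m)) =
      indicator {0..} t *\<^sub>R (exp (- (t\<^sup>2 * r\<^sup>2)) * t ^ m)"
      using assms by (simp add: indicator_def zero_le_mult_iff power_mult_distrib mult.commute)
  qed (use assms in \<open>auto simp: divide_simps\<close>)
qed

lemma gauss_int_eq: "r > 0 \<Longrightarrow> gauss_int m r = gauss_moment m / r ^ Suc m"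
  using has_bochner_integral_integral_eq[OF has_integral_gauss_int] by (simp add: gauss_int_def set_lebesgue_integral_def)

text \<open>These are integrations by parts in \<open>t\<close>. In the second one the boundary term
  at \<open>t = 0\<close> survives, and this \<open>1\<close> is what leaves the Pfaffian in the
  differential of \<beta>.\<close>

lemma gauss_int_rec:
  assumes "r > 0"
  shows "2 * r\<^sup>2 * gauss_int (m + 2) r = (real m + 1) * gauss_int m r" "2 * r\<^sup>2 * gauss_int 1 r = 1"
proof -
  have "2 * r\<^sup>2 * gauss_int (m + 2) r = 2 * gauss_moment (m + 2) / r ^ Suc m"
    using assms by (simp add: gauss_int_eq power2_eq_square)
  then show "2 * r\<^sup>2 * gauss_int (m + 2) r = (real m + 1) * gauss_int m r"
    unfolding gauss_moment_rec using assms by (simp add: gauss_int_eq)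
  show "2 * r\<^sup>2 * gauss_int 1 r = 1"
    using assms by (simp add: gauss_int_eq gauss_moment_1[unfolded One_nat_def] power2_eq_square)
qed

text \<open>Written as a power of the squared norm, which is a polynomial in the coordinates, the
  radial factor is visibly smooth away from the origin.\<close>

lemma gauss_int_norm_eq:
  assumes "x \<noteq> 0"
  shows "gauss_int m (norm x) = gauss_moment m * ((norm x)\<^sup>2) powr (- ((real m + 1) / 2))"
proof -
  have r: "norm x > 0"
    using assms by simp
  have "((norm x)\<^sup>2) powr (- ((real m + 1) / 2)) = (norm x powr 2) powr (- ((real m + 1) / 2))"
    using r by simp
  also have "\<dots> = norm x powr (- real (Suc m))"
    unfolding powr_powr by (intro arg_cong2[where f="(powr)"]) (auto simp: field_simps)
  also have "\<dots> = 1 / norm x ^ Suc m"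
    using r by (simp only: powr_minus powr_realpow) (simp add: field_simps)
  finally show ?thesis
    using r by (simp add: gauss_int_eq)
qed

lemma smooth_on_gauss_int:
  fixes e :: "nat \<Rightarrow> 'a::real_inner"
  assumes "orthonormal_basis d e"
  shows "smooth_on (UNIV - {0 :: 'a}) (\<lambda>x. gauss_int m (norm x))"
proof -
  have op: "open (UNIV - {0 :: 'a})"
    by (intro open_Diff) auto
  have "smooth_on (UNIV - {0 :: 'a}) (\<lambda>x. gauss_moment m * ((norm x)\<^sup>2) powr (- ((real m + 1) / 2)))"
    by (intro smooth_on_mult smooth_on_const smooth_on_powr smooth_on_norm_square[OF assms] op) auto
  then show ?thesis
    by (rule smooth_on_cong[OF op]) (simp add: gauss_int_norm_eq)
qed

lemma has_derivative_norm_square: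
  "((\<lambda>y::'a::real_inner. (norm y)\<^sup>2) has_derivative (\<lambda>h. 2 * inner x h)) (at x)"
  unfolding power2_norm_eq_inner
  by (auto intro!: derivative_eq_intros simp: inner_commute)

text \<open>The formula is that of differentiation under the integral: the Gaussian contributes
  \<open>- 2 * t^2 * inner x h\<close>, which raises the moment by two. It is obtained from the
  closed form and the recursion instead.\<close>

lemma has_derivative_gauss_int:
  fixes x :: "'a::real_inner"
  assumes "x \<noteq> 0"
  shows "((\<lambda>y. gauss_int m (norm y)) has_derivative (\<lambda>h. - (2 * inner x h * gauss_int (m + 2) (norm x)))) (at x)"
proof -
  define a where "a = - ((real m + 1) / 2)"
  have pos: "(norm x)\<^sup>2 > 0"
    using assms by simp
  have "((\<lambda>y. ((norm y)\<^sup>2) powr a) has_derivative (\<lambda>h. ((norm x)\<^sup>2) powr a * (0 * ln ((norm x)\<^sup>2) + 2 * inner x h * a / (norm x)\<^sup>2))) (at x)"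
    by (rule has_derivative_powr[OF has_derivative_norm_square has_derivative_const pos]) auto
  then have "((\<lambda>y. gauss_moment m * ((norm y)\<^sup>2) powr a) has_derivative
      (\<lambda>h. gauss_moment m * (((norm x)\<^sup>2) powr a * (0 * ln ((norm x)\<^sup>2) + 2 * inner x h * a / (norm x)\<^sup>2)))) (at x)"
    by (rule has_derivative_mult_right)
  moreover have "gauss_moment m * (((norm x)\<^sup>2) powr a * (0 * ln ((norm x)\<^sup>2) + 2 * inner x h * a / (norm x)\<^sup>2)) =
      - (2 * inner x h * gauss_int (m + 2) (norm x))" for h
  proof -
    have "gauss_moment m * (((norm x)\<^sup>2) powr a) = gauss_int m (norm x)"
      using gauss_int_norm_eq[OF assms] by (simp add: a_def)
    then have "gauss_moment m * (((norm x)\<^sup>2) powr a * (0 * ln ((norm x)\<^sup>2) + 2 * inner x h * a / (norm x)\<^sup>2)) =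
        inner x h / (norm x)\<^sup>2 * (2 * a * gauss_int m (norm x))"
      by (simp add: algebra_simps)
    also have "2 * a * gauss_int m (norm x) = - ((real m + 1) * gauss_int m (norm x))"
      by (simp add: a_def)
    also have "\<dots> = - (2 * (norm x)\<^sup>2 * gauss_int (m + 2) (norm x))"
      using gauss_int_rec(1)[of "norm x" m] assms by simp
    finally show ?thesis
      using pos by simp
  qed
  ultimately have "((\<lambda>y. gauss_moment m * ((norm y)\<^sup>2) powr a) has_derivative (\<lambda>h. - (2 * inner x h * gauss_int (m + 2) (norm x)))) (at x)"
    by simp
  then show ?thesis
    by (rule has_derivative_transform_within_open[where s="UNIV - {0}"])
      (use assms in \<open>auto simp: gauss_int_norm_eq a_def intro!: open_Diff\<close>)
qed


section \<open>Closedness\<close>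

lemma gen_linear:
  "gen_wedge k (\<lambda>J. r * a J) I = r * gen_wedge k a I"
  "gen_contr k (\<lambda>J. r * a J) I = r * gen_contr k a I"
  "gen_wedge k (\<lambda>J. \<Sum>s\<in>S. f s J) I = (\<Sum>s\<in>S. gen_wedge k (f s) I)"
  "gen_contr k (\<lambda>J. \<Sum>s\<in>S. f s J) I = (\<Sum>s\<in>S. gen_contr k (f s) I)"
  "gen_wedge k (\<lambda>J. a J + b J) I = gen_wedge k a I + gen_wedge k b I"
  "gen_contr k (\<lambda>J. a J + b J) I = gen_contr k a I + gen_contr k b I"
  "gen_wedge k (\<lambda>J. - a J) I = - gen_wedge k a I"
  by (simp_all add: gen_wedge_def gen_contr_def sum_distrib_left algebra_simps)

lemma thom_coeff_closed_along:
  assumes onb: "orthonormal_basis d e" and X: "X \<in> so"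
  shows "2 * (\<Sum>k<d. inner (e k) x * gen_wedge k (thom_coeff d e X) I) =
    contr_along d (\<lambda>k. inner (e k) (blinfun_apply X x)) (thom_coeff d e X) I"
proof -
  let ?c = "thom_coeff d e X"
  have Xx: "(\<Sum>k<d. inner (e k) x * mat_of e X k l) = inner (e l) (blinfun_apply X x)" for l
  proof -
    have "(\<Sum>k<d. inner (e k) x * mat_of e X k l) = inner (blinfun_apply X (\<Sum>k<d. inner (e k) x *\<^sub>R e k)) (e l)"
      by (simp add: mat_of_def blinfun.sum_right blinfun.scaleR_right inner_sum_left)
    then show ?thesis
      by (simp only: onb_expand[OF onb] inner_commute[of "e l"])
  qed
  have "2 * (\<Sum>k<d. inner (e k) x * gen_wedge k ?c I) = (\<Sum>k<d. inner (e k) x * (2 * gen_wedge k ?c I))"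
    by (simp add: sum_distrib_left mult_ac)
  also have "\<dots> = (\<Sum>k<d. \<Sum>l<d. inner (e k) x * mat_of e X k l * gen_contr l ?c I)"
    by (intro sum.cong refl) (simp add: thom_coeff_closed[OF X] contr_along_def sum_distrib_left mult_ac)
  also have "\<dots> = (\<Sum>l<d. (\<Sum>k<d. inner (e k) x * mat_of e X k l) * gen_contr l ?c I)"
    unfolding sum_distrib_right by (rule sum.swap)
  finally show ?thesis
    by (simp add: Xx contr_along_def)
qed

text \<open>The identity \<open>thom_coeff_closed_along\<close> is contracted with the Euler field.
  On its left the Leibniz rule produces the squared norm, on its right the two contractions
  anticommute.\<close>

lemma euler_contr_closed:
  fixes x :: "'a::real_inner" and e :: "nat \<Rightarrow> 'a"
  assumes onb: "orthonormal_basis d e" and X: "X \<in> so" and I: "finite I"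
  defines "b \<equiv> contr_along d (\<lambda>k. inner (e k) x) (thom_coeff d e X)"
  shows "2 * (\<Sum>k<d. inner (e k) x * gen_wedge k b I) - contr_along d (\<lambda>k. inner (e k) (blinfun_apply X x)) b I =
    2 * (norm x)\<^sup>2 * thom_coeff d e X I"
proof -
  let ?c = "thom_coeff d e X" and ?x = "\<lambda>k. inner (e k) x" and ?y = "\<lambda>k. inner (e k) (blinfun_apply X x)"
  have "contr_along d ?x (\<lambda>I. 2 * (\<Sum>k<d. ?x k * gen_wedge k ?c I)) I = contr_along d ?x (contr_along d ?y ?c) I"
    by (simp only: thom_coeff_closed_along[OF onb X])
  moreover have "contr_along d ?x (\<lambda>I. 2 * (\<Sum>k<d. ?x k * gen_wedge k ?c I)) I =
      2 * (norm x)\<^sup>2 * ?c I - 2 * (\<Sum>k<d. ?x k * gen_wedge k b I)"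
  proof -
    have "contr_along d ?x (\<lambda>I. 2 * (\<Sum>k<d. ?x k * gen_wedge k ?c I)) I =
        2 * (\<Sum>l<d. \<Sum>k<d. ?x l * ?x k * ((if l = k then ?c I else 0) - gen_wedge k (gen_contr l ?c) I))"
      by (simp add: contr_along_def gen_linear gen_contr_wedge[OF I] sum_distrib_left mult_ac)
    also have "\<dots> = 2 * (\<Sum>l<d. \<Sum>k<d. if l = k then ?x l * ?x k * ?c I else 0)
        - 2 * (\<Sum>l<d. \<Sum>k<d. ?x l * ?x k * gen_wedge k (gen_contr l ?c) I)"
      unfolding right_diff_distrib[of 2, symmetric] sum_subtractf[symmetric]
      by (intro arg_cong2[where f="(*)"] sum.cong refl) (auto simp: algebra_simps)
    also have "(\<Sum>l<d. \<Sum>k<d. if l = k then ?x l * ?x k * ?c I else 0) = (norm x)\<^sup>2 * ?c I"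
      by (simp add: onb_norm_eq[OF onb] power2_eq_square[of "inner _ _"] sum_distrib_right)
    also have "(\<Sum>l<d. \<Sum>k<d. ?x l * ?x k * gen_wedge k (gen_contr l ?c) I) = (\<Sum>k<d. ?x k * gen_wedge k b I)"
      unfolding b_def contr_along_def gen_linear sum_distrib_left
      by (subst sum.swap) (simp add: mult_ac)
    finally show ?thesis
      by simp
  qed
  moreover have "contr_along d ?x (contr_along d ?y ?c) I = - contr_along d ?y b I"
  proof -
    have "contr_along d ?x (contr_along d ?y ?c) I = (\<Sum>l<d. \<Sum>k<d. ?x l * ?y k * gen_contr l (gen_contr k ?c) I)"
      by (simp add: contr_along_def[of d ?x] contr_along_def[of d ?y, abs_def] gen_linear sum_distrib_left mult_ac)
    also have "\<dots> = (\<Sum>k<d. \<Sum>l<d. - (?x l * ?y k * gen_contr k (gen_contr l ?c) I))"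
    proof (subst sum.swap, intro sum.cong refl)
      fix k l
      show "?x l * ?y k * gen_contr l (gen_contr k ?c) I = - (?x l * ?y k * gen_contr k (gen_contr l ?c) I)"
        by (subst gen_contr_antisym[OF I]) simp
    qed
    also have "\<dots> = - (\<Sum>k<d. \<Sum>l<d. ?x l * ?y k * gen_contr k (gen_contr l ?c) I)"
      by (simp add: sum_negf)
    finally show ?thesis
      by (simp add: b_def contr_along_def[of d ?y] contr_along_def[of d ?x, abs_def] gen_linear sum_distrib_left mult_ac)
  qed
  ultimately show ?thesis
    by simp
qed

text \<open>This is the number operator of the exterior algebra; it appears when the linear factor
  of \<beta> is differentiated.\<close>

lemma sum_gen_wedge_contr: "I \<subseteq> {..<d} \<Longrightarrow> (\<Sum>k<d. gen_wedge k (gen_contr k a) I) = real (card I) * a I"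
proof -
  assume "I \<subseteq> {..<d}"
  have "(\<Sum>k<d. gen_wedge k (gen_contr k a) I) = (\<Sum>k<d. if k \<in> I then a I else 0)"
    by (intro sum.cong refl) (auto simp: gen_wedge_def gen_contr_def insert_absorb)
  also have "\<dots> = (\<Sum>k\<in>I. a I)"
    using \<open>I \<subseteq> {..<d}\<close> by (subst sum.inter_restrict[symmetric]) (auto simp: Int_absorb1)
  finally show ?thesis
    by simp
qed

lemma partial_cmult:
  assumes "(f has_derivative f') (at x)"
  shows "partial e k (\<lambda>y. c * f y) x = c * partial e k f x"
  using partial_eqI[OF has_derivative_mult_right[OF assms, of c]] partial_eqI[OF assms] by simp

lemma has_derivative_exp_norm_square:
  "((\<lambda>y::'a::real_inner. exp (- (norm y)\<^sup>2)) has_derivative (\<lambda>h. - (2 * inner x h * exp (- (norm x)\<^sup>2)))) (at x)"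
proof -
  show ?thesis
    using has_derivative_exp[OF has_derivative_minus[OF has_derivative_norm_square[of x]]]
    by (simp add: mult_ac)
qed

lemma Th_MQ_eq:
  assumes "X \<in> so"
  shows "Th_MQ d e X x I = 1 / eps d * exp (- (norm x)\<^sup>2) * thom_coeff d e X I"
  by (simp add: Th_MQ_def berezin_form_exp_f_t[OF assms])

lemma D_Th_MQ:
  assumes onb: "orthonormal_basis d e" and X: "X \<in> so" and I: "finite I"
  shows "D_eq d e (Th_MQ d e) X x I = 0"
proof -
  let ?c = "thom_coeff d e X" and ?r = "1 / eps d * exp (- (norm x)\<^sup>2)"
  have pd: "partial e k (\<lambda>y. Th_MQ d e X y J) x = (- 2 * ?r * inner (e k) x) * ?c J" for k J
  proof -
    have "Th_MQ d e X y J = (1 / eps d * ?c J) * exp (- (norm y)\<^sup>2)" for y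
      by (simp add: Th_MQ_eq[OF X])
    then show ?thesis
      using partial_cmult[OF has_derivative_exp_norm_square[of x], of e k "1 / eps d * ?c J"]
        partial_eqI[OF has_derivative_exp_norm_square[of x], of e k]
      by (simp add: inner_commute)
  qed
  have i: "gen_contr k (Th_MQ d e X x) I = ?r * gen_contr k ?c I" for k
    by (simp add: gen_contr_def Th_MQ_eq[OF X])
  have "D_eq d e (Th_MQ d e) X x I = - ?r * (2 * (\<Sum>k<d. inner (e k) x * gen_wedge k ?c I)) +
      ?r * contr_along d (\<lambda>k. inner (e k) (blinfun_apply X x)) ?c I"
    unfolding D_eq_eq[OF onb I] contr_along_def i pd gen_linear(1) sum_distrib_left
    by (simp add: mult_ac)
  then show ?thesis
    unfolding thom_coeff_closed_along[OF onb X] by simp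
qed

section \<open>The differential of the form on the punctured space\<close>

lemma has_derivative_contr_along:
  "((\<lambda>y::'a::real_inner. contr_along d (\<lambda>k. inner (e k) y) a I) has_derivative (\<lambda>h. contr_along d (\<lambda>k. inner (e k) h) a I)) (at x)"
  unfolding contr_along_def by (auto intro!: derivative_eq_intros)

lemma contr_along_basis:
  assumes "orthonormal_basis d e" "k < d"
  shows "contr_along d (\<lambda>l. inner (e l) (e k)) a I = gen_contr k a I"
proof -
  have "contr_along d (\<lambda>l. inner (e l) (e k)) a I = (\<Sum>l<d. if l = k then gen_contr k a I else 0)"
    unfolding contr_along_def using assms by (intro sum.cong refl) (auto simp: onb_inner)
  with assms(2) show ?thesis
    by simp
qed

lemma has_derivative_beta_wedge:
  assumes X: "X \<in> so" and x: "x \<noteq> 0"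
  shows "((\<lambda>y. beta_wedge d e X y J) has_derivative
    (\<lambda>h. 2 * inner x h * gauss_int (card J + 2) (norm x) * contr_along d (\<lambda>k. inner (e k) x) (thom_coeff d e X) J
      - gauss_int (card J) (norm x) * contr_along d (\<lambda>k. inner (e k) h) (thom_coeff d e X) J)) (at x)"
proof -
  have "((\<lambda>y. - (gauss_int (card J) (norm y) * contr_along d (\<lambda>k. inner (e k) y) (thom_coeff d e X) J)) has_derivative
    (\<lambda>h. - (gauss_int (card J) (norm x) * contr_along d (\<lambda>k. inner (e k) h) (thom_coeff d e X) J +
      - (2 * inner x h * gauss_int (card J + 2) (norm x)) * contr_along d (\<lambda>k. inner (e k) x) (thom_coeff d e X) J))) (at x)"
    by (intro has_derivative_minus has_derivative_mult has_derivative_gauss_int x has_derivative_contr_along)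
  then show ?thesis
    by (simp add: beta_wedge_eq[OF X])
qed

text \<open>Differentiation hits either the radial factor, which raises the moment by two, or the
  linear factor, which gives the number operator. With \<open>euler_contr_closed\<close> the
  coefficient at \<open>I\<close> becomes \<open>c_I\<close> times the difference of the two sides
  of the moment recursion.\<close>

lemma D_beta_wedge:
  assumes onb: "orthonormal_basis d e" and X: "X \<in> so" and I: "I \<subseteq> {..<d}" and x: "x \<noteq> 0"
  shows "D_eq d e (beta_wedge d e) X x I = (if I = {} then thom_coeff d e X {} else 0)"
proof -
  let ?c = "thom_coeff d e X" and ?r = "norm x"
  let ?b = "contr_along d (\<lambda>k. inner (e k) x) ?c"
  have fin: "finite I"
    using I finite_subset by auto
  have r: "?r > 0"
    using x by simp
  have pd: "partial e k (\<lambda>y. beta_wedge d e X y J) x = 2 * gauss_int (card J + 2) ?r * (inner (e k) x * ?b J)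
      - gauss_int (card J) ?r * gen_contr k ?c J" if "k < d" for k J
    using partial_eqI[OF has_derivative_beta_wedge[OF X x], of e k]
    by (simp add: contr_along_basis[OF onb that] inner_commute)
  have w: "gen_wedge k (\<lambda>J. partial e k (\<lambda>y. beta_wedge d e X y J) x) I =
      2 * gauss_int (card I + 1) ?r * (inner (e k) x * gen_wedge k ?b I) - gauss_int (card I - 1) ?r * gen_wedge k (gen_contr k ?c) I"
    if "k < d" for k
  proof (cases "k \<in> I")
    case True
    \<comment> \<open>Exterior multiplication by \<open>dx_k\<close> takes its coefficient from
      \<open>I - {k}\<close>, one degree lower, which shifts both moments.\<close>
    then have "card (I - {k}) + 2 = card I + 1" "card (I - {k}) = card I - 1"
      using card.remove[OF fin True] by auto
    then show ?thesis
      using True unfolding gen_wedge_def pd[OF that] by (simp only: if_True) (simp add: algebra_simps)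
  qed (simp add: gen_wedge_def)
  have i: "gen_contr k (beta_wedge d e X x) I = - gauss_int (card I + 1) ?r * gen_contr k ?b I" for k
    using fin by (simp add: gen_contr_def beta_wedge_eq[OF X])
  have "D_eq d e (beta_wedge d e) X x I = gauss_int (card I + 1) ?r * (2 * (\<Sum>k<d. inner (e k) x * gen_wedge k ?b I) -
      contr_along d (\<lambda>k. inner (e k) (blinfun_apply X x)) ?b I) - gauss_int (card I - 1) ?r * (\<Sum>k<d. gen_wedge k (gen_contr k ?c) I)"
    unfolding D_eq_eq[OF onb fin] contr_along_def[of d "\<lambda>k. inner (e k) (blinfun_apply X x)"] i
    by (simp add: w sum_subtractf sum_distrib_left right_diff_distrib sum_negf mult_ac)
  also have "\<dots> = (2 * ?r\<^sup>2 * gauss_int (card I + 1) ?r - card I * gauss_int (card I - 1) ?r) * ?c I"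
    unfolding euler_contr_closed[OF onb X fin] sum_gen_wedge_contr[OF I] by (simp add: algebra_simps)
  \<comment> \<open>For empty \<open>I\<close> the truncated \<open>card I - 1\<close> is harmless
    because its factor \<open>card I\<close> is \<open>0\<close>, and the other term contributes
    \<open>1\<close>.\<close>
  also have "\<dots> = (if I = {} then ?c {} else 0)"
  proof (cases "card I")
    case 0
    then show ?thesis
      using fin gauss_int_rec(2)[OF r] by simp
  next
    case (Suc m)
    then show ?thesis
      using gauss_int_rec(1)[OF r, of m] by auto
  qed
  finally show ?thesis .
qed

section \<open>Invariant functions\<close>

definition plane_rotation :: "'a::real_inner \<Rightarrow> 'a \<Rightarrow> real \<Rightarrow> 'a \<Rightarrow> 'a" where
  "plane_rotation u w \<theta> y = y + (cos \<theta> - 1) *\<^sub>R (inner u y *\<^sub>R u + inner w y *\<^sub>R w)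
     + sin \<theta> *\<^sub>R (inner u y *\<^sub>R w - inner w y *\<^sub>R u)"

lemma linear_plane_rotation: "linear (plane_rotation u w \<theta>)"
  by (rule linearI) (simp_all add: plane_rotation_def algebra_simps inner_add_right)

text \<open>The one-parameter group law serves twice: it makes the adjoint, the rotation by the
  opposite angle, the inverse, and it makes every rotation a square.\<close>

lemma plane_rotation_add:
  assumes "inner u u = 1" "inner w w = 1" "inner u w = 0"
  shows "plane_rotation u w \<theta> (plane_rotation u w \<phi> y) = plane_rotation u w (\<theta> + \<phi>) y"
proof -
  define a b where "a = inner u y" and "b = inner w y"
  have wu: "inner w u = 0"
    using assms(3) by (simp add: inner_commute)
  have UW: "inner u (plane_rotation u w \<phi> y) = cos \<phi> * a - sin \<phi> * b"
    "inner w (plane_rotation u w \<phi> y) = cos \<phi> * b + sin \<phi> * a"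
    using assms wu by (simp_all add: plane_rotation_def a_def b_def inner_add_right inner_diff_right algebra_simps)
  have "plane_rotation u w \<theta> (plane_rotation u w \<phi> y) =
    (y + ((cos \<phi> - 1) * a - sin \<phi> * b) *\<^sub>R u + ((cos \<phi> - 1) * b + sin \<phi> * a) *\<^sub>R w)
      + ((cos \<theta> - 1) * (cos \<phi> * a - sin \<phi> * b) - sin \<theta> * (cos \<phi> * b + sin \<phi> * a)) *\<^sub>R u
      + ((cos \<theta> - 1) * (cos \<phi> * b + sin \<phi> * a) + sin \<theta> * (cos \<phi> * a - sin \<phi> * b)) *\<^sub>R w"
    unfolding plane_rotation_def[of u w \<theta> "plane_rotation u w \<phi> y"] UW
    by (simp add: plane_rotation_def[of u w \<phi> y] a_def[symmetric] b_def[symmetric] algebra_simps)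
  also have "\<dots> = y + (((cos \<phi> - 1) * a - sin \<phi> * b) + ((cos \<theta> - 1) * (cos \<phi> * a - sin \<phi> * b) - sin \<theta> * (cos \<phi> * b + sin \<phi> * a))) *\<^sub>R u
      + (((cos \<phi> - 1) * b + sin \<phi> * a) + ((cos \<theta> - 1) * (cos \<phi> * b + sin \<phi> * a) + sin \<theta> * (cos \<phi> * a - sin \<phi> * b))) *\<^sub>R w"
    by (simp only: scaleR_left_distrib add_ac)
  also have "((cos \<phi> - 1) * a - sin \<phi> * b) + ((cos \<theta> - 1) * (cos \<phi> * a - sin \<phi> * b) - sin \<theta> * (cos \<phi> * b + sin \<phi> * a))
      = (cos (\<theta> + \<phi>) - 1) * a - sin (\<theta> + \<phi>) * b"
    by (simp add: cos_add sin_add algebra_simps)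
  also have "((cos \<phi> - 1) * b + sin \<phi> * a) + ((cos \<theta> - 1) * (cos \<phi> * b + sin \<phi> * a) + sin \<theta> * (cos \<phi> * a - sin \<phi> * b))
      = (cos (\<theta> + \<phi>) - 1) * b + sin (\<theta> + \<phi>) * a"
    by (simp add: cos_add sin_add algebra_simps)
  also have "y + ((cos (\<theta> + \<phi>) - 1) * a - sin (\<theta> + \<phi>) * b) *\<^sub>R u + ((cos (\<theta> + \<phi>) - 1) * b + sin (\<theta> + \<phi>) * a) *\<^sub>R w
      = plane_rotation u w (\<theta> + \<phi>) y"
    by (simp add: plane_rotation_def a_def[symmetric] b_def[symmetric] algebra_simps)
  finally show ?thesis .
qed

lemma inner_plane_rotation:
  assumes "inner u u = 1" "inner w w = 1" "inner u w = 0"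
  shows "inner (plane_rotation u w \<theta> y) (plane_rotation u w \<theta> z) = inner y z"
proof -
  have adj: "inner (plane_rotation u w \<theta> v) z = inner v (plane_rotation u w (- \<theta>) z)" for v z
    by (simp add: plane_rotation_def inner_add_left inner_add_right inner_diff_left inner_diff_right
        inner_commute[of v] inner_commute[of _ z] algebra_simps)
  show ?thesis
    unfolding adj plane_rotation_add[OF assms] by (simp add: plane_rotation_def)
qed

text \<open>The determinant of a rotation is a square because the rotation itself is one.\<close>

lemma plane_rotation_SO:
  assumes onb: "orthonormal_basis d e" and uw: "inner u u = 1" "inner w w = 1" "inner u w = 0"
  shows "plane_rotation u w \<theta> \<in> SO d e"
proof -
  let ?h = "plane_rotation u w (\<theta> / 2)"
  let ?M = "\<lambda>g. mat d d (\<lambda>(i, k). arr e g i k)"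
  have orth: "orthogonal_transformation (plane_rotation u w \<phi>)" for \<phi>
    by (simp add: orthogonal_transformation_def linear_plane_rotation inner_plane_rotation[OF uw])
  have lin: "linear ?h"
    by (rule linear_plane_rotation)
  have "arr e (plane_rotation u w \<theta>) i k = (\<Sum>j<d. arr e ?h i j * arr e ?h j k)" if "k < d" for i k
  proof -
    have "?h (?h (e k)) = (\<Sum>j<d. arr e ?h j k *\<^sub>R ?h (e j))"
      using arg_cong[OF onb_expand[OF onb, of "?h (e k)"], of ?h]
      by (simp add: linear_sum[OF lin] linear_scale[OF lin] arr_def)
    then show ?thesis
      using plane_rotation_add[OF uw, of "\<theta> / 2" "\<theta> / 2" "e k"]
      by (simp add: arr_def inner_sum_right mult.commute)
  qed
  then have "?M (plane_rotation u w \<theta>) = ?M ?h * ?M ?h"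
    by (intro eq_matI) (auto simp: scalar_prod_def lessThan_atLeast0)
  then have "Determinant.det (?M (plane_rotation u w \<theta>)) = Determinant.det (?M ?h) * Determinant.det (?M ?h)"
    by (simp add: det_mult[of _ d])
  with arr_orthogonal(2)[OF onb orth[of "\<theta> / 2"]] have "Determinant.det (?M (plane_rotation u w \<theta>)) = 1"
    by auto
  with orth show ?thesis
    by (simp add: SO_iff)
qed

text \<open>A nonzero \<open>v\<close> orthogonal to \<open>x\<close> is, up to scale, the velocity
  at \<open>x\<close> of a rotation in the plane of \<open>x\<close> and \<open>v\<close>, along
  which \<open>f\<close> is constant. In dimension one only \<open>v = 0\<close> is orthogonal to
  \<open>x\<close>, so the trivial group causes no exception.\<close>

lemma invariant_derivative_orthogonal:
  assumes onb: "orthonormal_basis d e" and inv: "\<forall>g\<in>SO d e. \<forall>y. f (g y) = f y"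
    and f: "(f has_derivative f') (at x)" and xv: "inner x v = 0" and x: "x \<noteq> 0"
  shows "f' v = (0::real)"
proof (cases "v = 0")
  case True
  then show ?thesis
    using has_derivative_linear[OF f] linear_0 by auto
next
  case False
  define u w where "u = (1 / norm x) *\<^sub>R x" and "w = (1 / norm v) *\<^sub>R v"
  have uw: "inner u u = 1" "inner w w = 1" "inner u w = 0"
    using x False xv by (simp_all add: u_def w_def power2_norm_eq_inner[symmetric] power2_eq_square)
  have R: "plane_rotation u w \<theta> x = x + ((cos \<theta> - 1) * norm x) *\<^sub>R u + (sin \<theta> * norm x) *\<^sub>R w" for \<theta>
  proof -
    have "inner u x = norm x" "inner w x = 0"
      using x xv by (simp_all add: u_def w_def power2_norm_eq_inner[symmetric] power2_eq_square inner_commute)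
    then show ?thesis
      by (simp add: plane_rotation_def)
  qed
  have "((\<lambda>\<theta>. plane_rotation u w \<theta> x) has_derivative (\<lambda>h. h *\<^sub>R norm x *\<^sub>R w)) (at 0)"
    unfolding R by (auto intro!: derivative_eq_intros)
  moreover have "plane_rotation u w 0 x = x"
    by (simp add: plane_rotation_def)
  ultimately have "((\<lambda>\<theta>. f (plane_rotation u w \<theta> x)) has_derivative (\<lambda>h. f' (h *\<^sub>R norm x *\<^sub>R w))) (at 0)"
    using has_derivative_compose[of "\<lambda>\<theta>. plane_rotation u w \<theta> x" _ 0 UNIV f f'] f by simp
  moreover have "f (plane_rotation u w \<theta> x) = f x" for \<theta>
    using inv plane_rotation_SO[OF onb uw] by blast
  ultimately have "((\<lambda>\<theta>::real. f x) has_derivative (\<lambda>h. f' (h *\<^sub>R norm x *\<^sub>R w))) (at 0)"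
    by simp
  then have "(\<lambda>h. f' (h *\<^sub>R norm x *\<^sub>R w)) = (\<lambda>h::real. 0)"
    by (rule has_derivative_unique) simp
  \<comment> \<open>At this parameter the tangent vector
    \<open>h *\<^sub>R norm x *\<^sub>R w\<close> is \<open>v\<close> itself.\<close>
  from fun_cong[OF this, of "norm v / norm x"] show ?thesis
    using x False by (simp add: w_def)
qed

lemma invariant_derivative_radial:
  assumes onb: "orthonormal_basis d e" and inv: "\<forall>g\<in>SO d e. \<forall>y. f (g y) = f y"
    and f: "(f has_derivative f') (at x)" and x: "x \<noteq> 0"
  shows "f' v = inner x v * ((f' x :: real) / (norm x)\<^sup>2)"
proof -
  have lin: "linear f'"
    using has_derivative_linear[OF f] .
  have "inner x (v - (inner x v / (norm x)\<^sup>2) *\<^sub>R x) = 0"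
    using x by (simp add: inner_diff_right power2_norm_eq_inner)
  from invariant_derivative_orthogonal[where f=f, OF onb inv f this x] show ?thesis
    by (simp add: linear_diff[OF lin] linear_scale[OF lin])
qed

lemma cutoff_D:
  assumes onb: "orthonormal_basis d e" and "cutoff d e \<rho>"
  shows "smooth_on UNIV \<rho>" "\<forall>g\<in>SO d e. \<forall>y. \<rho> (g y) = \<rho> y"
    "(\<rho> has_derivative frechet_derivative \<rho> (at x)) (at x)"
  using assms(2) smooth_on_has_derivative[of UNIV \<rho> x] by (auto simp: cutoff_def)

lemma cutoff_partial_SO:
  assumes onb: "orthonormal_basis d e" and \<rho>: "cutoff d e \<rho>" and g: "g \<in> SO d e"
  shows "frechet_derivative \<rho> (at (g x)) (g v) = frechet_derivative \<rho> (at x) v"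
proof -
  have "((\<lambda>y. \<rho> (g y)) has_derivative (\<lambda>v. frechet_derivative \<rho> (at (g x)) (g v))) (at x)"
    by (rule has_derivative_compose[OF bounded_linear_imp_has_derivative[OF SO_D(10)[OF onb g]]])
      (rule cutoff_D(3)[OF onb \<rho>])
  then have "(\<rho> has_derivative (\<lambda>v. frechet_derivative \<rho> (at (g x)) (g v))) (at x)"
    using cutoff_D(2)[OF onb \<rho>] g by simp
  from has_derivative_unique[OF this cutoff_D(3)[OF onb \<rho>]] show ?thesis
    by metis
qed

text \<open>Invariance replaces the general theorem on mixed derivatives. Away from the origin the
  gradient is \<open>q y\<close> times the position \<open>y\<close>, where \<open>q\<close> is
  again smooth and invariant. One more derivative yields \<open>q x\<close> on the diagonal plus a
  multiple of the product of the two coordinates, which is symmetric.\<close>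

lemma cutoff_symmetric:
  fixes x :: "'a::real_inner"
  assumes onb: "orthonormal_basis d e" and \<rho>: "cutoff d e \<rho>" and x: "x \<noteq> 0" and jk: "j < d" "k < d"
  shows "partial e j (partial e k \<rho>) x = partial e k (partial e j \<rho>) x"
proof -
  define q where "q y = frechet_derivative \<rho> (at y) y / (norm y)\<^sup>2" for y
  have op: "open (UNIV - {0::'a})"
    by (intro open_Diff) auto
  have rad: "partial e i \<rho> y = inner (e i) y * q y" if "y \<noteq> 0" for i y
    unfolding q_def partial_def
    using invariant_derivative_radial[where f=\<rho>, OF onb cutoff_D(2,3)[OF onb \<rho>] that, of "e i"] by (simp add: inner_commute)
  have "smooth_on (UNIV - {0}) (\<lambda>y. (\<Sum>i<d. inner (e i) y * partial e i \<rho> y) * ((norm y)\<^sup>2) powr (- 1))"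
    by (intro smooth_on_mult smooth_on_sum smooth_on_inner smooth_on_powr smooth_on_norm_square[OF onb] op
        smooth_on_subset[OF smooth_on_partial[OF cutoff_D(1)[OF onb \<rho>]]]) auto
  moreover have "q y = (\<Sum>i<d. inner (e i) y * partial e i \<rho> y) * ((norm y)\<^sup>2) powr (- 1)" if "y \<noteq> 0" for y
    unfolding q_def using that frechet_partial_sum[OF onb cutoff_D(3)[OF onb \<rho>, of y], of y]
    by (simp add: powr_minus divide_inverse)
  ultimately have "smooth_on (UNIV - {0}) q"
    using smooth_on_cong[OF op] by (metis (no_types, lifting) DiffD2 singletonI)
  then have dq: "(q has_derivative frechet_derivative q (at x)) (at x)"
    using smooth_on_has_derivative x by blast
  have invq: "\<forall>g\<in>SO d e. \<forall>y. q (g y) = q y"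
    by (simp add: q_def cutoff_partial_SO[OF onb \<rho>] SO_D(4)[OF onb])
  define q' where "q' = frechet_derivative q (at x) x / (norm x)\<^sup>2"
  have "partial e j (partial e i \<rho>) x = inner (e i) (e j) * q x + inner (e i) x * (inner (e j) x * q')" for i j
  proof -
    have "((\<lambda>y. inner (e i) y * q y) has_derivative
        (\<lambda>h. inner (e i) x * frechet_derivative q (at x) h + inner (e i) h * q x)) (at x)"
      by (intro has_derivative_mult dq) (auto intro!: derivative_eq_intros)
    from partial_transform[OF this op, of "partial e i \<rho>" e j] show ?thesis
      using x invariant_derivative_radial[where f=q, OF onb invq dq x, of "e j"]
      by (simp add: rad q'_def inner_commute)
  qed
  then show ?thesis
    by (simp add: inner_commute mult_ac)
qed

section \<open>Forms cut off by an invariant function\<close>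

lemma Pf_half_form_eq: "X \<in> so \<Longrightarrow> Pf_half d e X x I = thom_coeff d e X {} * monom_ext {} I"
  by (simp add: Pf_half_def fun_form_def Pf_half_eq)

lemma ext_d_fun_form:
  assumes "finite K"
  shows "ext_d d e (fun_form f) x K = (\<Sum>k<d. partial e k f x * monom_ext {k} K)"
proof -
  have 0: "partial e k (\<lambda>y. 0) x = 0" for k
    by (rule partial_eqI) simp
  have "partial e k (\<lambda>y. fun_form f y J) x = partial e k f x * monom_ext {} J" for k J
    by (cases "J = {}") (simp_all add: fun_form_def monom_ext_def 0)
  moreover have "gen_wedge k (\<lambda>J. r * monom_ext {} J) K = r * monom_ext {k} K" for k r
    by (auto simp: gen_wedge_def monom_ext_def)
  ultimately show ?thesis
    by (simp add: ext_d_eq[OF assms])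
qed

lemma wedge_ext_d_fun_form:
  assumes "finite I"
  shows "wedge (ext_d d e (fun_form f) x) a I = (\<Sum>k<d. partial e k f x * gen_wedge k a I)"
proof -
  have "wedge (ext_d d e (fun_form f) x) a I = wedge (\<lambda>K. \<Sum>k<d. partial e k f x * monom_ext {k} K) a I"
    unfolding wedge_def
  proof (intro sum.cong refl)
    fix K assume "K \<in> Pow I"
    then have "finite K"
      using assms finite_subset by auto
    then show "shuffle_sign K (I - K) * ext_d d e (fun_form f) x K * a (I - K) =
        shuffle_sign K (I - K) * (\<Sum>k<d. partial e k f x * monom_ext {k} K) * a (I - K)"
      by (simp add: ext_d_fun_form)
  qed
  then show ?thesis
    by (simp add: wedge_gens[OF assms])
qed

text \<open>Reduces the integral of the relative form, for every cutoff, to that of the compactly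
  supported form.\<close>

lemma cut_Th_rel: "cut d e \<rho> (Th_rel d e) = Th_c d e \<rho>"
  by (simp add: cut_def Th_rel_def Th_c_def fun_eq_iff wedge_def sum_divide_distrib add_divide_distrib)

lemma Th_c_eq:
  assumes "X \<in> so" "finite I"
  shows "Th_c d e \<rho> X x I = 1 / eps d * (\<rho> x * (thom_coeff d e X {} * monom_ext {} I)
    + (\<Sum>k<d. partial e k \<rho> x * gen_wedge k (beta_wedge d e X x) I))"
  by (simp add: Th_c_def wedge_ext_d_fun_form[OF assms(2)] Pf_half_form_eq[OF assms(1)])

lemma cutoff_partial_zero:
  assumes "cutoff d e \<rho>"
  obtains U where "open U" "0 \<in> U" "\<And>y. y \<in> U \<Longrightarrow> \<rho> y = 1" "\<And>y k. y \<in> U \<Longrightarrow> partial e k \<rho> y = 0"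
proof -
  obtain U where U: "open U" "0 \<in> U" "\<And>y. y \<in> U \<Longrightarrow> \<rho> y = 1"
    using assms by (auto simp: cutoff_def)
  have "partial e k \<rho> y = 0" if "y \<in> U" for y k
    using partial_transform[OF has_derivative_const[of "1::real"] U(1) that, of \<rho>] U(3) by simp
  with U that show thesis
    by blast
qed

lemma cutoff_outside:
  fixes x :: "'a::real_inner"
  assumes "x \<notin> closure {x. \<rho> x \<noteq> (0::real)}"
  shows "\<rho> x = 0" "partial e k \<rho> x = 0"
proof -
  let ?K = "closure {x. \<rho> x \<noteq> 0}"
  have zero: "\<rho> y = 0" if "y \<in> - ?K" for y
    using that closure_subset[THEN subsetD, of y "{x. \<rho> x \<noteq> 0}"] by blast
  show "\<rho> x = 0"
    by (rule zero) (use assms in simp)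
  show "partial e k \<rho> x = 0"
  proof (rule partial_transform[OF has_derivative_const[of "0::real"]])
    show "open (- ?K)" "x \<in> - ?K"
      using assms by (simp_all add: open_Compl)
  qed (rule zero)
qed

text \<open>
  Below, \<open>v\<close>, \<open>w\<close> are the first and second derivatives of \<open>\<rho>\<close>, \<open>B j\<close> the
  derivative of \<open>a = \<beta>\<close> along \<open>e j\<close>, \<open>y\<close> the vector field and \<open>p = D\<beta>\<close>.
\<close>

lemma cut_closed_algebra:
  assumes I: "I \<subseteq> {..<d}" and w: "\<And>j k. j < d \<Longrightarrow> k < d \<Longrightarrow> w k j = w j k"
    and vy: "(\<Sum>k<d. v k * y k) = 0"
    and p: "\<And>J. J \<subseteq> {..<d} \<Longrightarrow> (\<Sum>j<d. gen_wedge j (B j) J) + contr_along d y a J = p J"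
  shows "(\<Sum>j<d. gen_wedge j (\<lambda>J. v j * p J + (\<Sum>k<d. v k * gen_wedge k (B j) J + w k j * gen_wedge k a J)) I)
    + (\<Sum>l<d. y l * (\<Sum>k<d. v k * gen_contr l (gen_wedge k a) I)) = 0"
proof -
  have fin: "finite I"
    using I finite_subset by auto
  have 1: "(\<Sum>j<d. gen_wedge j (\<lambda>J. v j * p J + (\<Sum>k<d. v k * gen_wedge k (B j) J + w k j * gen_wedge k a J)) I) =
    (\<Sum>k<d. v k * gen_wedge k p I) + (\<Sum>j<d. \<Sum>k<d. v k * gen_wedge j (gen_wedge k (B j)) I)
      + (\<Sum>j<d. \<Sum>k<d. w k j * gen_wedge j (gen_wedge k a) I)"
    by (simp add: gen_linear sum.distrib)
  have 2: "(\<Sum>j<d. \<Sum>k<d. w k j * gen_wedge j (gen_wedge k a) I) = 0"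
  proof -
    have "(\<Sum>j<d. \<Sum>k<d. w k j * gen_wedge j (gen_wedge k a) I) = (\<Sum>k<d. \<Sum>j<d. w k j * gen_wedge j (gen_wedge k a) I)"
      by (rule sum.swap)
    also have "\<dots> = (\<Sum>k<d. \<Sum>j<d. - (w j k * gen_wedge k (gen_wedge j a) I))"
    proof (intro sum.cong refl)
      fix j k assume "k \<in> {..<d}" "j \<in> {..<d}"
      then show "w k j * gen_wedge j (gen_wedge k a) I = - (w j k * gen_wedge k (gen_wedge j a) I)"
        by (subst gen_wedge_antisym[OF fin]) (simp add: w[of j k])
    qed
    finally show ?thesis
      by (simp add: sum_negf)
  qed
  have 3: "(\<Sum>j<d. \<Sum>k<d. v k * gen_wedge j (gen_wedge k (B j)) I) = - (\<Sum>k<d. v k * gen_wedge k (\<lambda>J. \<Sum>j<d. gen_wedge j (B j) J) I)"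
  proof -
    have "(\<Sum>j<d. \<Sum>k<d. v k * gen_wedge j (gen_wedge k (B j)) I) = (\<Sum>k<d. \<Sum>j<d. v k * gen_wedge j (gen_wedge k (B j)) I)"
      by (rule sum.swap)
    also have "\<dots> = (\<Sum>k<d. \<Sum>j<d. - (v k * gen_wedge k (gen_wedge j (B j)) I))"
    proof (intro sum.cong refl)
      fix j k
      show "v k * gen_wedge j (gen_wedge k (B j)) I = - (v k * gen_wedge k (gen_wedge j (B j)) I)"
        by (subst gen_wedge_antisym[OF fin]) simp
    qed
    finally show ?thesis
      by (simp add: sum_negf gen_linear sum_distrib_left)
  qed
  have 4: "(\<Sum>l<d. y l * (\<Sum>k<d. v k * gen_contr l (gen_wedge k a) I)) = - (\<Sum>k<d. v k * gen_wedge k (contr_along d y a) I)"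
  proof -
    have "(\<Sum>l<d. y l * (\<Sum>k<d. v k * gen_contr l (gen_wedge k a) I)) =
        (\<Sum>l<d. \<Sum>k<d. if l = k then v k * y k * a I else 0) - (\<Sum>l<d. \<Sum>k<d. v k * (y l * gen_wedge k (gen_contr l a) I))"
      unfolding sum_subtractf[symmetric] sum_distrib_left
      by (intro sum.cong refl) (auto simp: gen_contr_wedge[OF fin] algebra_simps)
    also have "(\<Sum>l<d. \<Sum>k<d. if l = k then v k * y k * a I else 0) = 0"
      using vy by (simp add: sum_distrib_right[symmetric])
    also have "(\<Sum>l<d. \<Sum>k<d. v k * (y l * gen_wedge k (gen_contr l a) I)) = (\<Sum>k<d. v k * gen_wedge k (contr_along d y a) I)"
      unfolding contr_along_def gen_linear sum_distrib_left by (rule sum.swap)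
    finally show ?thesis
      by simp
  qed
  have 5: "gen_wedge k p I = gen_wedge k (\<lambda>J. \<Sum>j<d. gen_wedge j (B j) J) I + gen_wedge k (contr_along d y a) I" for k
  proof (cases "k \<in> I")
    case True
    have "I - {k} \<subseteq> {..<d}"
      using I by auto
    with True show ?thesis
      by (simp add: gen_wedge_def[of k] p[symmetric] distrib_left)
  qed (simp add: gen_wedge_def[of k])
  show ?thesis
    unfolding 1 2 3 4 5 by (simp add: distrib_left sum.distrib)
qed

lemma so_inner_self: "X \<in> so \<Longrightarrow> inner x (blinfun_apply X x) = 0"
proof -
  assume "X \<in> so"
  then have "inner (blinfun_apply X x) x = - inner x (blinfun_apply X x)"
    unfolding so_def by blast
  then show ?thesis
    by (simp add: inner_commute)
qed

lemma D_Th_c: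
  fixes x :: "'a::real_inner"
  assumes onb: "orthonormal_basis d e" and \<rho>: "cutoff d e \<rho>" and X: "X \<in> so" and I: "I \<subseteq> {..<d}"
  shows "D_eq d e (Th_c d e \<rho>) X x I = 0"
proof -
  let ?c = "thom_coeff d e X {}" and ?y = "\<lambda>k. inner (e k) (blinfun_apply X x)"
  have fin: "finite J" if "J \<subseteq> {..<d}" for J
    using that finite_subset by auto
  show ?thesis
  proof (cases "x = 0")
    case True
    \<comment> \<open>\<beta> is singular at the origin, but near it the cutoff is \<open>1\<close>,
      so the form is the constant Pfaffian there.\<close>
    obtain U where U: "open U" "0 \<in> U" "\<And>y. y \<in> U \<Longrightarrow> \<rho> y = 1" "\<And>y k. y \<in> U \<Longrightarrow> partial e k \<rho> y = 0"
      by (rule cutoff_partial_zero[OF \<rho>]) blast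
    have eq: "Th_c d e \<rho> X y J = 1 / eps d * (?c * monom_ext {} J)" if "y \<in> U" "finite J" for y J
      using that U by (simp add: Th_c_eq[OF X])
    have "partial e k (\<lambda>y. Th_c d e \<rho> X y J) 0 = 0" if "finite J" for k J
      using partial_transform[OF has_derivative_const U(1,2) eq[OF _ that]] by simp
    moreover have "gen_contr k (Th_c d e \<rho> X 0) I = 0" for k
      using fin[OF I] by (simp add: gen_contr_def eq[OF U(2)] monom_ext_def)
    ultimately show ?thesis
      unfolding D_eq_eq[OF onb fin[OF I]] True using fin[OF I] by (simp add: gen_wedge_def contr_along_def cong: if_cong)
  next
    case False
    define v where "v k = partial e k \<rho> x" for k
    define w where "w k j = partial e j (partial e k \<rho>) x" for k j
    define B where "B j J = partial e j (\<lambda>y. beta_wedge d e X y J) x" for j J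
    let ?a = "beta_wedge d e X x"
    have d\<beta>: "((\<lambda>y. beta_wedge d e X y J) has_derivative frechet_derivative (\<lambda>y. beta_wedge d e X y J) (at x)) (at x)" for J
      by (rule frechet_derivative_works[THEN iffD1, OF differentiableI[OF has_derivative_beta_wedge[OF X False]]])
    have dv: "(partial e k \<rho> has_derivative frechet_derivative (partial e k \<rho>) (at x)) (at x)" for k
      by (rule smooth_on_has_derivative[OF smooth_on_partial[OF cutoff_D(1)[OF onb \<rho>]]]) simp
    have dg: "((\<lambda>y. gen_wedge k (beta_wedge d e X y) J) has_derivative
        (\<lambda>h. gen_wedge k (\<lambda>J. frechet_derivative (\<lambda>y. beta_wedge d e X y J) (at x) h) J)) (at x)" for k J
      by (cases "k \<in> J") (auto simp: gen_wedge_def intro!: has_derivative_mult_right d\<beta>)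
    have pd: "partial e j (\<lambda>y. Th_c d e \<rho> X y J) x = 1 / eps d * (v j * (?c * monom_ext {} J) +
        (\<Sum>k<d. v k * gen_wedge k (B j) J + w k j * gen_wedge k ?a J))" if J: "finite J" for j J
    proof -
      have "((\<lambda>y. 1 / eps d * (\<rho> y * (?c * monom_ext {} J) + (\<Sum>k<d. partial e k \<rho> y * gen_wedge k (beta_wedge d e X y) J)))
        has_derivative (\<lambda>h. 1 / eps d * (frechet_derivative \<rho> (at x) h * (?c * monom_ext {} J) +
          (\<Sum>k<d. partial e k \<rho> x * gen_wedge k (\<lambda>J. frechet_derivative (\<lambda>y. beta_wedge d e X y J) (at x) h) J
            + frechet_derivative (partial e k \<rho>) (at x) h * gen_wedge k ?a J)))) (at x)"
        by (intro has_derivative_mult_right has_derivative_add has_derivative_mult_left cutoff_D(3)[OF onb \<rho>]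
            has_derivative_sum has_derivative_mult dv dg)
      from partial_eqI[OF this, of e j] show ?thesis
        by (simp add: Th_c_eq[OF X J] v_def w_def B_def[abs_def] partial_def)
    qed
    have "gen_wedge j (\<lambda>J. partial e j (\<lambda>y. Th_c d e \<rho> X y J) x) I = 1 / eps d *
        gen_wedge j (\<lambda>J. v j * (?c * monom_ext {} J) + (\<Sum>k<d. v k * gen_wedge k (B j) J + w k j * gen_wedge k ?a J)) I" for j
      using fin[OF I] by (simp add: gen_wedge_def pd)
    moreover have "gen_contr l (Th_c d e \<rho> X x) I = 1 / eps d * (\<Sum>k<d. v k * gen_contr l (gen_wedge k ?a) I)" for l
      using fin[OF I] by (auto simp: gen_contr_def[of l] Th_c_eq[OF X] v_def monom_ext_def sum_distrib_left mult_ac)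
    ultimately have "D_eq d e (Th_c d e \<rho>) X x I = 1 / eps d *
      ((\<Sum>j<d. gen_wedge j (\<lambda>J. v j * (?c * monom_ext {} J) + (\<Sum>k<d. v k * gen_wedge k (B j) J + w k j * gen_wedge k ?a J)) I)
        + (\<Sum>l<d. ?y l * (\<Sum>k<d. v k * gen_contr l (gen_wedge k ?a) I)))"
      unfolding D_eq_eq[OF onb fin[OF I]] contr_along_def
      by (simp only: distrib_left sum_distrib_left mult.left_commute)
    also have "\<dots> = 0"
    proof -
      have "(\<Sum>k<d. v k * ?y k) = frechet_derivative \<rho> (at x) (blinfun_apply X x)"
        unfolding frechet_partial_sum[OF onb cutoff_D(3)[OF onb \<rho>], of x "blinfun_apply X x"]
        by (simp add: v_def mult.commute)
      also have "\<dots> = 0"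
        by (rule invariant_derivative_orthogonal[where f=\<rho>, OF onb cutoff_D(2,3)[OF onb \<rho>] so_inner_self[OF X] False])
      finally have vy: "(\<Sum>k<d. v k * ?y k) = 0" .
      have p: "(\<Sum>j<d. gen_wedge j (B j) J) + contr_along d ?y ?a J = ?c * monom_ext {} J" if "J \<subseteq> {..<d}" for J
        using D_beta_wedge[OF onb X that False] D_eq_eq[OF onb fin[OF that], of "beta_wedge d e" X x]
        by (auto simp: B_def[abs_def] monom_ext_def)
      have w: "w k j = w j k" if "j < d" "k < d" for j k
        unfolding w_def by (rule cutoff_symmetric[OF onb \<rho> False that])
      show ?thesis
        using cut_closed_algebra[where p="\<lambda>J. ?c * monom_ext {} J" and w=w, OF I w vy p]
        by (simp only: mult_zero_right)
    qed
    finally show ?thesis .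
  qed
qed

lemma D_Pf_half:
  assumes onb: "orthonormal_basis d e" and X: "X \<in> so" and I: "finite I"
  shows "D_eq d e (\<lambda>X x I. r * Pf_half d e X x I) X x I = 0"
proof -
  have "partial e k (\<lambda>y. r * (thom_coeff d e X {} * monom_ext {} J)) x = 0" for k J
    by (rule partial_eqI) simp
  moreover have "gen_contr k (\<lambda>I. r * Pf_half d e X x I) I = 0" for k
    by (simp add: gen_contr_def Pf_half_form_eq[OF X] monom_ext_def)
  ultimately show ?thesis
    unfolding D_eq_eq[OF onb I] by (simp add: Pf_half_form_eq[OF X] gen_wedge_def contr_along_def cong: if_cong)
qed

lemma D_beta_wedge_scaled:
  assumes onb: "orthonormal_basis d e" and X: "X \<in> so" and I: "I \<subseteq> {..<d}" and x: "x \<noteq> 0"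
  shows "D_eq d e (\<lambda>X x I. r * beta_wedge d e X x I) X x I = r * Pf_half d e X x I"
proof -
  have fin: "finite I"
    using I finite_subset by auto
  have "D_eq d e (\<lambda>X x I. r * beta_wedge d e X x I) X x I = r * D_eq d e (beta_wedge d e) X x I"
    unfolding D_eq_eq[OF onb fin] partial_cmult[OF has_derivative_beta_wedge[OF X x]] contr_along_def gen_linear
    by (simp add: distrib_left sum_distrib_left mult_ac)
  then show ?thesis
    by (simp add: D_beta_wedge[OF assms] Pf_half_form_eq[OF X] monom_ext_def)
qed


section \<open>Equivariance of the explicit forms\<close>

lemma equivariant_Th_MQ:
  assumes onb: "orthonormal_basis d e"
  shows "equivariant d e UNIV (Th_MQ d e)"
proof (rule equivariantI[OF onb])
  fix g and X :: "'a \<Rightarrow>\<^sub>L 'a" and x J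
  assume g: "g \<in> SO d e" and X: "X \<in> so"
  show "Th_MQ d e (Ad g X) x J = (\<Sum>I\<in>Pow {..<d}. Th_MQ d e X (inv g x) I * pull_coeff d (arr e g) I J)"
    unfolding Th_MQ_eq[OF X] Th_MQ_eq[OF Ad_so[OF onb g X]] thom_coeff_Ad[OF onb g] SO_D(9)[OF onb g] sum_distrib_left
    by (simp add: mult_ac)
qed

lemma beta_wedge_Ad:
  assumes onb: "orthonormal_basis d e" and g: "g \<in> SO d e" and X: "X \<in> so"
  shows "beta_wedge d e (Ad g X) x J = (\<Sum>I\<in>Pow {..<d}. beta_wedge d e X (inv g x) I * pull_coeff d (arr e g) I J)"
proof -
  let ?b = "contr_along d (\<lambda>k. inner (e k) (inv g x)) (thom_coeff d e X)"
  have "beta_wedge d e (Ad g X) x J = (\<Sum>I\<in>Pow {..<d}. - (gauss_int (card J) (norm x) * (?b I * pull_coeff d (arr e g) I J)))"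
    using contr_along_Ad[OF onb g, of "inv g x" X J]
    by (simp add: beta_wedge_eq[OF Ad_so[OF onb g X]] SO_D(5)[OF onb g] sum_distrib_left sum_negf)
  \<comment> \<open>The radial factor depends on the degree through \<open>card J\<close>. Pull-back
    preserves degrees, so \<open>card I\<close> may be written for \<open>card J\<close> in every
    nonzero term.\<close>
  also have "\<dots> = (\<Sum>I\<in>Pow {..<d}. beta_wedge d e X (inv g x) I * pull_coeff d (arr e g) I J)"
  proof (intro sum.cong refl)
    fix I
    show "- (gauss_int (card J) (norm x) * (?b I * pull_coeff d (arr e g) I J)) =
        beta_wedge d e X (inv g x) I * pull_coeff d (arr e g) I J"
      using pull_coeff_card[of d "arr e g" I J]
      by (cases "pull_coeff d (arr e g) I J = 0") (auto simp: beta_wedge_eq[OF X] SO_D(9)[OF onb g])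
  qed
  finally show ?thesis .
qed

text \<open>At the empty set only the term of the empty set survives in
  \<open>thom_coeff_Ad\<close>, since pull-back preserves degrees; hence the Pfaffian is
  invariant.\<close>

lemma Pf_half_Ad:
  assumes onb: "orthonormal_basis d e" and g: "g \<in> SO d e" and X: "X \<in> so"
  shows "Pf_half d e (Ad g X) x J = (\<Sum>I\<in>Pow {..<d}. Pf_half d e X (inv g x) I * pull_coeff d (arr e g) I J)"
proof -
  have one: "pull_coeff d (arr e g) {} J = monom_ext {} J" for J
    by (simp add: pull_coeff_def cf_one monom_ext_def)
  have "(\<Sum>I\<in>Pow {..<d}. thom_coeff d e X I * pull_coeff d (arr e g) I {}) =
      (\<Sum>I\<in>Pow {..<d}. if I = {} then thom_coeff d e X {} else 0)"
  proof (intro sum.cong refl)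
    fix I assume "I \<in> Pow {..<d}"
    then have "finite I"
      using finite_subset by auto
    then show "thom_coeff d e X I * pull_coeff d (arr e g) I {} = (if I = {} then thom_coeff d e X {} else 0)"
      using pull_coeff_card[of d "arr e g" I "{}"] one[of "{}"] by (auto simp: monom_ext_def)
  qed
  then have "thom_coeff d e (Ad g X) {} = thom_coeff d e X {}"
    by (simp add: thom_coeff_Ad[OF onb g])
  moreover have "(\<Sum>I\<in>Pow {..<d}. (thom_coeff d e X {} * monom_ext {} I) * pull_coeff d (arr e g) I J) =
      (\<Sum>I\<in>Pow {..<d}. if I = {} then thom_coeff d e X {} * monom_ext {} J else 0)"
    by (intro sum.cong refl) (auto simp: one monom_ext_def)
  ultimately show ?thesis
    by (simp add: Pf_half_form_eq[OF X] Pf_half_form_eq[OF Ad_so[OF onb g X]])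
qed

lemma equivariant_Th_rel:
  assumes onb: "orthonormal_basis d e"
  shows "equivariant d e UNIV (fst (Th_rel d e))" "equivariant d e (UNIV - {0}) (snd (Th_rel d e))"
  by (rule equivariantI[OF onb]; simp add: Th_rel_def beta_wedge_Ad[OF onb] Pf_half_Ad[OF onb] sum_divide_distrib)+

text \<open>The gradient of an invariant function rotates with the point;
  \<open>gen_wedge_pull\<close> passes the rotated gradient through the pull-back of
  \<beta>.\<close>

lemma equivariant_Th_c:
  assumes onb: "orthonormal_basis d e" and \<rho>: "cutoff d e \<rho>"
  shows "equivariant d e UNIV (Th_c d e \<rho>)"
proof (rule equivariantI[OF onb])
  fix g and X :: "'a \<Rightarrow>\<^sub>L 'a" and x J
  assume g: "g \<in> SO d e" and X: "X \<in> so" and J: "J \<subseteq> {..<d}"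
  let ?P = "pull_coeff d (arr e g)" and ?v = "\<lambda>k. partial e k \<rho> (inv g x)"
  have fin: "finite J" if "J \<subseteq> {..<d}" for J
    using that finite_subset by auto
  have v: "partial e j \<rho> x = (\<Sum>k<d. ?v k * arr e g j k)" for j
  proof -
    have "partial e j \<rho> x = frechet_derivative \<rho> (at (inv g x)) (inv g (e j))"
      using cutoff_partial_SO[OF onb \<rho> g, of "inv g x" "inv g (e j)"]
      by (simp add: partial_def SO_D(5)[OF onb g])
    also have "\<dots> = (\<Sum>k<d. inner (e k) (inv g (e j)) * ?v k)"
      by (rule frechet_partial_sum[OF onb cutoff_D(3)[OF onb \<rho>]])
    finally show ?thesis
      by (simp add: arr_def inner_commute[of _ "inv g _"] SO_D(7)[OF onb g] mult.commute)
  qed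
  have \<rho>x: "\<rho> (inv g x) = \<rho> x"
    using cutoff_D(2)[OF onb \<rho>] g SO_D(5)[OF onb g, of x] by metis
  have \<beta>: "beta_wedge d e (Ad g X) x = (\<lambda>J. \<Sum>I\<in>Pow {..<d}. beta_wedge d e X (inv g x) I * ?P I J)"
    using beta_wedge_Ad[OF onb g X] by (simp add: fun_eq_iff)
  have "(\<Sum>j<d. partial e j \<rho> x * gen_wedge j (beta_wedge d e (Ad g X) x) J) =
      (\<Sum>k<d. ?v k * (\<Sum>j<d. arr e g j k * gen_wedge j (beta_wedge d e (Ad g X) x) J))"
    unfolding v sum_distrib_left sum_distrib_right by (subst sum.swap) (simp add: mult_ac)
  also have "\<dots> = (\<Sum>k<d. ?v k * (\<Sum>I\<in>Pow {..<d}. gen_wedge k (beta_wedge d e X (inv g x)) I * ?P I J))"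
    unfolding \<beta> by (intro sum.cong refl) (simp add: gen_wedge_pull)
  also have "\<dots> = (\<Sum>I\<in>Pow {..<d}. (\<Sum>k<d. ?v k * gen_wedge k (beta_wedge d e X (inv g x)) I) * ?P I J)"
    unfolding sum_distrib_left sum_distrib_right by (subst sum.swap) (simp add: mult_ac)
  finally have "Th_c d e \<rho> (Ad g X) x J = 1 / eps d * (\<rho> x * (\<Sum>I\<in>Pow {..<d}. Pf_half d e X (inv g x) I * ?P I J) +
      (\<Sum>I\<in>Pow {..<d}. (\<Sum>k<d. ?v k * gen_wedge k (beta_wedge d e X (inv g x)) I) * ?P I J))"
    by (simp add: Th_c_def wedge_ext_d_fun_form[OF fin[OF J]] Pf_half_Ad[OF onb g X])
  also have "\<dots> = (\<Sum>I\<in>Pow {..<d}. Th_c d e \<rho> X (inv g x) I * ?P I J)"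
    unfolding sum_distrib_left sum.distrib[symmetric]
  proof (intro sum.cong refl)
    fix I assume "I \<in> Pow {..<d}"
    then have "finite I"
      using fin by auto
    then show "1 / eps d * (\<rho> x * (Pf_half d e X (inv g x) I * ?P I J) +
        (\<Sum>k<d. ?v k * gen_wedge k (beta_wedge d e X (inv g x)) I) * ?P I J) = Th_c d e \<rho> X (inv g x) I * ?P I J"
      by (simp add: Th_c_def wedge_ext_d_fun_form \<rho>x algebra_simps add_divide_distrib)
  qed
  finally show "Th_c d e \<rho> (Ad g X) x J = (\<Sum>I\<in>Pow {..<d}. Th_c d e \<rho> X (inv g x) I * ?P I J)" .
qed

section \<open>Membership in the complexes\<close>

lemmas real_polynomial_function_linear = real_polynomial_function.intros(1)
  and real_polynomial_function_const = real_polynomial_function.intros(2)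
  and real_polynomial_function_add = real_polynomial_function.intros(3)
  and real_polynomial_function_mult = real_polynomial_function.intros(4)

text \<open>Lists take the place of the indexed families in \<open>A_pol\<close>, so that a sum of
  two such forms is given by concatenation.\<close>

definition pol_form :: "nat \<Rightarrow> 'a::real_inner set \<Rightarrow> 'a eqform \<Rightarrow> bool" where
  "pol_form d N \<alpha> \<longleftrightarrow> (\<exists>ps. (\<forall>(p, \<omega>)\<in>set ps. real_polynomial_function p \<and> smooth_form d N \<omega>) \<and>
     eq_on d N \<alpha> (\<lambda>X x I. \<Sum>(p, \<omega>)\<leftarrow>ps. p X * \<omega> x I))"

lemma A_polI:
  assumes "equivariant d e N \<alpha>" "pol_form d N \<alpha>"
  shows "\<alpha> \<in> A_pol d e N"
proof -
  obtain ps where ps: "\<forall>(p, \<omega>)\<in>set ps. real_polynomial_function p \<and> smooth_form d N \<omega>"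
    "eq_on d N \<alpha> (\<lambda>X x I. \<Sum>(p, \<omega>)\<leftarrow>ps. p X * \<omega> x I)"
    using assms(2) by (auto simp: pol_form_def)
  have "(\<Sum>(p, \<omega>)\<leftarrow>ps. p X * \<omega> x I) = (\<Sum>j<length ps. fst (ps ! j) X * snd (ps ! j) x I)" for X x I
    by (simp add: sum_list_sum_nth case_prod_beta atLeast0LessThan)
  moreover have "\<forall>j<length ps. real_polynomial_function (fst (ps ! j)) \<and> smooth_form d N (snd (ps ! j))"
    using ps(1) by (auto simp: case_prod_beta)
  ultimately have "\<exists>(m::nat) p \<omega>. (\<forall>j<m. real_polynomial_function (p j) \<and> smooth_form d N (\<omega> j)) \<and>
      eq_on d N \<alpha> (\<lambda>X x I. \<Sum>j<m. p j X * \<omega> j x I)"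
    using ps(2) by (intro exI[of _ "length ps"] exI[of _ "\<lambda>j. fst (ps ! j)"] exI[of _ "\<lambda>j. snd (ps ! j)"]) simp
  with assms(1) show ?thesis
    by (simp add: A_pol_def)
qed

lemma pol_form_cong: "pol_form d N \<beta> \<Longrightarrow> eq_on d N \<alpha> \<beta> \<Longrightarrow> pol_form d N \<alpha>"
  unfolding pol_form_def eq_on_def by fastforce

lemma pol_form_zero: "pol_form d N (\<lambda>X x I. 0)"
  unfolding pol_form_def by (rule exI[of _ "[]"]) (simp add: eq_on_def)

lemma pol_form_add:
  assumes "pol_form d N \<alpha>" "pol_form d N \<beta>"
  shows "pol_form d N (\<lambda>X x I. \<alpha> X x I + \<beta> X x I)"
proof -
  obtain ps qs where "\<forall>(p, \<omega>)\<in>set ps. real_polynomial_function p \<and> smooth_form d N \<omega>"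
    "eq_on d N \<alpha> (\<lambda>X x I. \<Sum>(p, \<omega>)\<leftarrow>ps. p X * \<omega> x I)"
    "\<forall>(p, \<omega>)\<in>set qs. real_polynomial_function p \<and> smooth_form d N \<omega>"
    "eq_on d N \<beta> (\<lambda>X x I. \<Sum>(p, \<omega>)\<leftarrow>qs. p X * \<omega> x I)"
    using assms by (auto simp: pol_form_def)
  then show ?thesis
    unfolding pol_form_def by (intro exI[of _ "ps @ qs"]) (auto simp: eq_on_def)
qed

lemma pol_form_sum: "(\<And>s. s \<in> S \<Longrightarrow> pol_form d N (f s)) \<Longrightarrow> pol_form d N (\<lambda>X x I. \<Sum>s\<in>S. f s X x I)"
  by (induction S rule: infinite_finite_induct) (auto intro: pol_form_zero pol_form_add)

lemma pol_form_single:
  assumes "open N" "real_polynomial_function p" "smooth_on N f"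
  shows "pol_form d N (\<lambda>X x I. if I = J then p X * f x else 0)"
proof -
  have "smooth_on N (\<lambda>x. if I = J then f x else 0)" for I :: "nat set"
    using assms by (cases "I = J") (auto intro: smooth_on_const)
  then have "smooth_form d N (\<lambda>x I. if I = J then f x else 0)"
    by (simp add: smooth_form_def)
  with assms(2) show ?thesis
    unfolding pol_form_def
    by (intro exI[of _ "[(p, \<lambda>x I. if I = J then f x else 0)]"]) (auto simp: eq_on_def)
qed

text \<open>The polynomials in \<open>A_pol\<close> multiply whole forms, but here they vary with
  the coefficient \<open>I\<close>. Each coefficient is therefore turned into a form with a single
  nonzero component.\<close>

lemma pol_formI:
  assumes N: "open N"
    and "\<And>I s. I \<subseteq> {..<d} \<Longrightarrow> s \<in> S \<Longrightarrow> real_polynomial_function (p I s)"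
    and "\<And>I s. I \<subseteq> {..<d} \<Longrightarrow> s \<in> S \<Longrightarrow> smooth_on N (f I s)"
    and \<alpha>: "\<And>X x I. X \<in> so \<Longrightarrow> x \<in> N \<Longrightarrow> I \<subseteq> {..<d} \<Longrightarrow> \<alpha> X x I = (\<Sum>s\<in>S. p I s X * f I s x)"
  shows "pol_form d N \<alpha>"
proof (rule pol_form_cong)
  show "pol_form d N (\<lambda>X x I. \<Sum>J\<in>Pow {..<d}. \<Sum>s\<in>S. if I = J then p J s X * f J s x else 0)"
    by (intro pol_form_sum pol_form_single N assms(2,3)) auto
  have "(\<Sum>J\<in>Pow {..<d}. \<Sum>s\<in>S. if I = J then p J s X * f J s x else 0) =
      (\<Sum>J\<in>Pow {..<d}. if J = I then \<Sum>s\<in>S. p I s X * f I s x else 0)" for X x I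
    by (intro sum.cong refl) auto
  then show "eq_on d N \<alpha> (\<lambda>X x I. \<Sum>J\<in>Pow {..<d}. \<Sum>s\<in>S. if I = J then p J s X * f J s x else 0)"
    by (simp add: eq_on_def \<alpha>)
qed

lemma polynomial_mat_of: "real_polynomial_function (\<lambda>X. mat_of e X k l)"
  unfolding mat_of_def
  by (intro real_polynomial_function_linear bounded_linear_inner_left_comp blinfun.bounded_linear_left)

lemma polynomial_expo_power: "real_polynomial_function (\<lambda>X. cf (expo d t (mat_of e X) ^ n) I J)"
proof (induction n arbitrary: I J)
  case 0
  show ?case
    by (simp add: real_polynomial_function_const)
next
  case (Suc n)
  have 1: "real_polynomial_function (\<lambda>X. cf (dX k * (eE k * expo d t (mat_of e X) ^ n)) I J)" for k
    unfolding cf_dX_mult cf_eE_mult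
    by (cases "k \<in> I"; cases "k \<in> J") (auto intro!: real_polynomial_function_const real_polynomial_function_mult Suc)
  have 2: "real_polynomial_function (\<lambda>X. cf (eE k * (eE l * expo d t (mat_of e X) ^ n)) I J)" for k l
    unfolding cf_eE_mult
    by (cases "k \<in> J"; cases "l \<in> J - {k}") (auto intro!: real_polynomial_function_const real_polynomial_function_mult Suc)
  show ?case
    unfolding power_Suc expo_def[of d t] distrib_right sum_distrib_right mult_scaleR_left mult.assoc cf_add cf_scaleR cf_sum
    by (intro real_polynomial_function_add real_polynomial_function_mult real_polynomial_function_const
        real_polynomial_function_sum polynomial_mat_of 1[unfolded expo_def] 2[unfolded expo_def] finite_lessThan)
qed

lemma polynomial_thom_coeff: "real_polynomial_function (\<lambda>X. thom_coeff d e X I)"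
  unfolding thom_coeff_def expE_def cf_sum cf_scaleR
  by (intro real_polynomial_function_sum real_polynomial_function_mult real_polynomial_function_const
      polynomial_expo_power finite_atMost)

lemma polynomial_contr_thom_coeff: "real_polynomial_function (\<lambda>X. gen_contr k (thom_coeff d e X) I)"
  unfolding gen_contr_def
  by (cases "k \<in> I") (auto intro: real_polynomial_function_const real_polynomial_function_mult polynomial_thom_coeff)

lemma Th_MQ_A_pol:
  fixes e :: "nat \<Rightarrow> 'a::real_inner"
  assumes onb: "orthonormal_basis d e"
  shows "Th_MQ d e \<in> A_pol d e UNIV"
proof (rule A_polI[OF equivariant_Th_MQ[OF onb]])
  show "pol_form d UNIV (Th_MQ d e)"
  proof (rule pol_formI[where S="{()}"])
    show "smooth_on UNIV (\<lambda>x::'a. 1 / eps d * exp (- (norm x)\<^sup>2))"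
      by (intro smooth_on_mult smooth_on_const smooth_on_exp smooth_on_minus smooth_on_norm_square[OF onb]) auto
    show "real_polynomial_function (\<lambda>X. thom_coeff d e X I)" for I
      by (rule polynomial_thom_coeff)
  qed (auto simp: Th_MQ_eq)
qed

lemma open_punctured: "open (UNIV - {0 :: 'a::real_inner})"
  by (intro open_Diff) auto

lemma smooth_on_beta_coeff:
  fixes e :: "nat \<Rightarrow> 'a::real_inner"
  assumes onb: "orthonormal_basis d e"
  shows "smooth_on (UNIV - {0}) (\<lambda>x. inner (e k) x * gauss_int m (norm x))"
  by (intro smooth_on_mult smooth_on_inner smooth_on_gauss_int[OF onb] open_punctured)

lemma Th_rel_A_rel:
  fixes e :: "nat \<Rightarrow> 'a::real_inner"
  assumes onb: "orthonormal_basis d e"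
  shows "Th_rel d e \<in> A_rel d e"
proof -
  have "fst (Th_rel d e) \<in> A_pol d e UNIV"
  proof (rule A_polI[OF equivariant_Th_rel(1)[OF onb]])
    show "pol_form d UNIV (fst (Th_rel d e))"
      by (rule pol_formI[where S="{()}" and p="\<lambda>I s X. thom_coeff d e X {}" and f="\<lambda>I s x. 1 / eps d * monom_ext {} I"])
        (auto simp: Th_rel_def Pf_half_form_eq polynomial_thom_coeff smooth_on_const)
  qed
  moreover have "snd (Th_rel d e) \<in> A_pol d e (UNIV - {0})"
  proof (rule A_polI[OF equivariant_Th_rel(2)[OF onb]])
    show "pol_form d (UNIV - {0}) (snd (Th_rel d e))"
    proof (rule pol_formI[where S="{..<d}"])
      show "real_polynomial_function (\<lambda>X. - (1 / eps d) * gen_contr k (thom_coeff d e X) I)" for I k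
        by (intro real_polynomial_function_mult real_polynomial_function_const polynomial_contr_thom_coeff)
      show "snd (Th_rel d e) X x I = (\<Sum>k<d. - (1 / eps d) * gen_contr k (thom_coeff d e X) I *
          (inner (e k) x * gauss_int (card I) (norm x)))" if "X \<in> so" for X x I
        using that by (simp add: Th_rel_def beta_wedge_eq contr_along_def sum_distrib_left sum_distrib_right
            sum_negf sum_divide_distrib mult_ac)
    qed (rule open_punctured smooth_on_beta_coeff[OF onb])+
  qed
  ultimately show ?thesis
    by (simp add: A_rel_def mem_Times_iff)
qed

text \<open>The singularity of \<beta> lies where the cutoff is constant: the product is zero near
  the origin and smooth away from it, and these two open sets cover the space.\<close>

lemma smooth_on_cutoff_beta_coeff:
  fixes e :: "nat \<Rightarrow> 'a::real_inner"
  assumes onb: "orthonormal_basis d e" and \<rho>: "cutoff d e \<rho>"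
  shows "smooth_on UNIV (\<lambda>x. partial e k \<rho> x * (inner (e l) x * gauss_int m (norm x)))"
proof -
  obtain U where U: "open U" "0 \<in> U" "\<And>y. y \<in> U \<Longrightarrow> \<rho> y = 1" "\<And>y k. y \<in> U \<Longrightarrow> partial e k \<rho> y = 0"
    by (rule cutoff_partial_zero[OF \<rho>]) blast
  let ?f = "\<lambda>x. partial e k \<rho> x * (inner (e l) x * gauss_int m (norm x))"
  have "smooth_on U ?f"
    by (rule smooth_on_cong[OF U(1) smooth_on_const[OF U(1), of 0]]) (simp add: U(4))
  moreover have "smooth_on (UNIV - {0}) ?f"
    by (intro smooth_on_mult smooth_on_beta_coeff[OF onb] open_punctured
        smooth_on_subset[OF smooth_on_partial[OF cutoff_D(1)[OF onb \<rho>]]]) auto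
  moreover have "U \<union> (UNIV - {0}) = UNIV"
    using U(2) by auto
  ultimately show ?thesis
    using smooth_on_Un[OF U(1) open_punctured, of ?f] by simp
qed

lemma Th_c_A_pol:
  fixes e :: "nat \<Rightarrow> 'a::real_inner"
  assumes onb: "orthonormal_basis d e" and \<rho>: "cutoff d e \<rho>"
  shows "Th_c d e \<rho> \<in> A_pol d e UNIV"
proof (rule A_polI[OF equivariant_Th_c[OF onb \<rho>]])
  have "pol_form d UNIV (\<lambda>X x I. 1 / eps d * (\<rho> x * (thom_coeff d e X {} * monom_ext {} I)))"
  proof (rule pol_formI[where S="{()}"])
    show "smooth_on UNIV (\<lambda>x. 1 / eps d * monom_ext {} I * \<rho> x)" for I
      by (intro smooth_on_mult smooth_on_const cutoff_D(1)[OF onb \<rho>]) auto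
    show "real_polynomial_function (\<lambda>X. thom_coeff d e X {})"
      by (rule polynomial_thom_coeff)
  qed auto
  moreover have "pol_form d UNIV (\<lambda>X x I. \<Sum>k<d. 1 / eps d * (partial e k \<rho> x * gen_wedge k (beta_wedge d e X x) I))"
  proof (rule pol_form_sum)
    fix k
    show "pol_form d UNIV (\<lambda>X x I. 1 / eps d * (partial e k \<rho> x * gen_wedge k (beta_wedge d e X x) I))"
    proof (rule pol_formI[where S="{..<d}"])
      show "real_polynomial_function (\<lambda>X. - (1 / eps d * (if k \<in> I then ins_sign k I else 0)) * gen_contr l (thom_coeff d e X) (I - {k}))" for I l
        by (intro real_polynomial_function_mult real_polynomial_function_const polynomial_contr_thom_coeff)
      show "smooth_on UNIV (\<lambda>x. partial e k \<rho> x * (inner (e l) x * gauss_int (card (I - {k})) (norm x)))" for I l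
        by (rule smooth_on_cutoff_beta_coeff[OF onb \<rho>])
      show "1 / eps d * (partial e k \<rho> x * gen_wedge k (beta_wedge d e X x) I) = (\<Sum>l<d.
          - (1 / eps d * (if k \<in> I then ins_sign k I else 0)) * gen_contr l (thom_coeff d e X) (I - {k}) *
          (partial e k \<rho> x * (inner (e l) x * gauss_int (card (I - {k})) (norm x))))" if "X \<in> so" for X x I
      proof (cases "k \<in> I")
        case True
        then show ?thesis
          using that by (simp only: gen_wedge_def beta_wedge_eq contr_along_def if_True sum_distrib_left sum_negf[symmetric])
            (simp add: mult_ac)
      qed (simp add: gen_wedge_def)
    qed auto
  qed
  ultimately have "pol_form d UNIV (\<lambda>X x I. 1 / eps d * (\<rho> x * (thom_coeff d e X {} * monom_ext {} I)) +
      (\<Sum>k<d. 1 / eps d * (partial e k \<rho> x * gen_wedge k (beta_wedge d e X x) I)))"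
    by (rule pol_form_add)
  then show "pol_form d UNIV (Th_c d e \<rho>)"
  proof (rule pol_form_cong)
    show "eq_on d UNIV (Th_c d e \<rho>) (\<lambda>X x I. 1 / eps d * (\<rho> x * (thom_coeff d e X {} * monom_ext {} I)) +
      (\<Sum>k<d. 1 / eps d * (partial e k \<rho> x * gen_wedge k (beta_wedge d e X x) I)))"
      unfolding eq_on_def
    proof (intro ballI allI impI)
      fix X :: "'a \<Rightarrow>\<^sub>L 'a" and x I assume "X \<in> so" "I \<subseteq> {..<d}"
      then show "Th_c d e \<rho> X x I = 1 / eps d * (\<rho> x * (thom_coeff d e X {} * monom_ext {} I)) +
          (\<Sum>k<d. 1 / eps d * (partial e k \<rho> x * gen_wedge k (beta_wedge d e X x) I))"
        using finite_subset[of I "{..<d}"] by (simp add: Th_c_eq sum_divide_distrib add_divide_distrib)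
    qed
  qed
qed

lemma Th_c_A_pol_c:
  fixes e :: "nat \<Rightarrow> 'a::real_inner"
  assumes onb: "orthonormal_basis d e" and \<rho>: "cutoff d e \<rho>"
  shows "Th_c d e \<rho> \<in> A_pol_c d e"
proof -
  let ?S = "{x. \<exists>X\<in>so. \<exists>I\<subseteq>{..<d}. Th_c d e \<rho> X x I \<noteq> 0}" and ?K = "closure {x. \<rho> x \<noteq> 0}"
  have "x \<in> ?K" if "x \<in> ?S" for x
  proof (rule ccontr)
    assume x: "x \<notin> ?K"
    then have "Th_c d e \<rho> X x I = 0" if "X \<in> so" "I \<subseteq> {..<d}" for X I
      using that finite_subset[of I "{..<d}"] by (simp add: Th_c_eq cutoff_outside[OF x])
    with that show False
      by auto
  qed
  then have "closure ?S \<subseteq> ?K"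
    by (intro closure_minimal) auto
  moreover have "compact ?K"
    using \<rho> by (simp add: cutoff_def)
  ultimately have "compact (closure ?S)"
    using compact_Int_closed[of ?K "closure ?S"] by (simp add: Int_absorb1)
  with Th_c_A_pol[OF onb \<rho>] show ?thesis
    by (simp add: A_pol_c_def)
qed

section \<open>Rapid decrease of the Mathai-Quillen form\<close>

lemma polynomial_directional_derivative:
  assumes "real_polynomial_function p"
  shows "\<exists>q. real_polynomial_function q \<and> (\<forall>x. \<exists>p'. (p has_derivative p') (at x) \<and> p' v = q x)"
  using assms
proof (induction p rule: real_polynomial_function.induct)
  case (linear f)
  then show ?case
    by (intro exI[of _ "\<lambda>x. f v"]) (auto intro: bounded_linear_imp_has_derivative)
next
  case (const c)
  then show ?case
    by (intro exI[of _ "\<lambda>x. 0"]) (auto intro: has_derivative_const)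
next
  case (add f g)
  then obtain p q where pq: "real_polynomial_function p" "\<forall>x. \<exists>f'. (f has_derivative f') (at x) \<and> f' v = p x"
    "real_polynomial_function q" "\<forall>x. \<exists>g'. (g has_derivative g') (at x) \<and> g' v = q x"
    by auto
  have "\<exists>h'. ((\<lambda>x. f x + g x) has_derivative h') (at x) \<and> h' v = p x + q x" for x
  proof -
    obtain f' g' where "(f has_derivative f') (at x)" "f' v = p x" "(g has_derivative g') (at x)" "g' v = q x"
      using pq by blast
    then show ?thesis
      by (intro exI[of _ "\<lambda>h. f' h + g' h"]) (auto intro: has_derivative_add)
  qed
  with pq(1,3) show ?case
    by (intro exI[of _ "\<lambda>x. p x + q x"]) auto
next
  case (mult f g)
  then obtain p q where pq: "real_polynomial_function p" "\<forall>x. \<exists>f'. (f has_derivative f') (at x) \<and> f' v = p x"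
    "real_polynomial_function q" "\<forall>x. \<exists>g'. (g has_derivative g') (at x) \<and> g' v = q x"
    by auto
  have "\<exists>h'. ((\<lambda>x. f x * g x) has_derivative h') (at x) \<and> h' v = f x * q x + p x * g x" for x
  proof -
    obtain f' g' where "(f has_derivative f') (at x)" "f' v = p x" "(g has_derivative g') (at x)" "g' v = q x"
      using pq by blast
    then show ?thesis
      by (intro exI[of _ "\<lambda>h. f x * g' h + f' h * g x"]) (auto intro: has_derivative_mult)
  qed
  with mult.hyps pq(1,3) show ?case
    by (intro exI[of _ "\<lambda>x. f x * q x + p x * g x"]) auto
qed

text \<open>A polynomial prefactor is carried along because polynomials times the Gaussian form a
  class stable under partial derivatives, unlike the Gaussian alone.\<close>

lemma iterated_partial_exp_norm_square:
  assumes "real_polynomial_function p"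
  shows "\<exists>q. real_polynomial_function q \<and>
    foldr (partial e) ks (\<lambda>x::'a::real_inner. p x * exp (- (norm x)\<^sup>2)) = (\<lambda>x. q x * exp (- (norm x)\<^sup>2))"
proof (induction ks)
  case Nil
  with assms show ?case
    by auto
next
  case (Cons k ks)
  then obtain q where q: "real_polynomial_function q"
    "foldr (partial e) ks (\<lambda>x. p x * exp (- (norm x)\<^sup>2)) = (\<lambda>x. q x * exp (- (norm x)\<^sup>2))"
    by auto
  obtain q' where q': "real_polynomial_function q'" "\<And>x. \<exists>D. (q has_derivative D) (at x) \<and> D (e k) = q' x"
    using polynomial_directional_derivative[OF q(1), of "e k"] by blast
  have "partial e k (\<lambda>x. q x * exp (- (norm x)\<^sup>2)) x = (q' x + (- 2) * q x * inner x (e k)) * exp (- (norm x)\<^sup>2)" for x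
  proof -
    obtain D where D: "(q has_derivative D) (at x)" "D (e k) = q' x"
      using q'(2) by blast
    show ?thesis
      using partial_eqI[OF has_derivative_mult[OF D(1) has_derivative_exp_norm_square[of x]], of e k] D(2)
      by (simp add: algebra_simps)
  qed
  then have "foldr (partial e) (k # ks) (\<lambda>x. p x * exp (- (norm x)\<^sup>2)) =
      (\<lambda>x. (q' x + (- 2) * q x * inner x (e k)) * exp (- (norm x)\<^sup>2))"
    by (simp add: q(2) fun_eq_iff)
  moreover have "real_polynomial_function (\<lambda>x. q' x + (- 2) * q x * inner x (e k))"
    by (intro real_polynomial_function_add real_polynomial_function_mult q' q real_polynomial_function_const
        real_polynomial_function_linear bounded_linear_inner_left)
  ultimately show ?case
    by blast
qed

lemma polynomial_growth:
  assumes "real_polynomial_function p"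
  shows "\<exists>C M. C \<ge> 0 \<and> (\<forall>x. \<bar>p x\<bar> \<le> C * (1 + norm x) ^ M)"
  using assms
proof (induction p rule: real_polynomial_function.induct)
  case (linear f)
  obtain K where K: "K > 0" "\<And>x. norm (f x) \<le> norm x * K"
    using bounded_linear.pos_bounded[OF linear] by blast
  have "\<bar>f x\<bar> \<le> K * (1 + norm x) ^ 1" for x
    using K(2)[of x] K(1) by (simp add: algebra_simps)
  with K(1) show ?case
    by (intro exI[of _ K] exI[of _ 1]) auto
next
  case (const c)
  show ?case
    by (intro exI[of _ "\<bar>c\<bar>"] exI[of _ 0]) auto
next
  case (add f g)
  then obtain C M C' M' where *: "C \<ge> 0" "\<And>x. \<bar>f x\<bar> \<le> C * (1 + norm x) ^ M" "C' \<ge> 0" "\<And>x. \<bar>g x\<bar> \<le> C' * (1 + norm x) ^ M'"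
    by blast
  have "\<bar>f x + g x\<bar> \<le> (C + C') * (1 + norm x) ^ (M + M')" for x
  proof -
    have "(1 + norm x) ^ M \<le> (1 + norm x) ^ (M + M')" "(1 + norm x) ^ M' \<le> (1 + norm x) ^ (M + M')"
      by (auto intro: power_increasing)
    then have "C * (1 + norm x) ^ M + C' * (1 + norm x) ^ M' \<le> C * (1 + norm x) ^ (M + M') + C' * (1 + norm x) ^ (M + M')"
      using *(1,3) by (intro add_mono mult_left_mono)
    with *(2,4)[of x] show ?thesis
      by (simp add: distrib_right)
  qed
  with *(1,3) show ?case
    by (intro exI[of _ "C + C'"] exI[of _ "M + M'"]) auto
next
  case (mult f g)
  then obtain C M C' M' where *: "C \<ge> 0" "\<And>x. \<bar>f x\<bar> \<le> C * (1 + norm x) ^ M" "C' \<ge> 0" "\<And>x. \<bar>g x\<bar> \<le> C' * (1 + norm x) ^ M'"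
    by blast
  have "\<bar>f x * g x\<bar> \<le> (C * C') * (1 + norm x) ^ (M + M')" for x
  proof -
    have "\<bar>f x * g x\<bar> \<le> (C * (1 + norm x) ^ M) * (C' * (1 + norm x) ^ M')"
      unfolding abs_mult using * by (intro mult_mono) auto
    then show ?thesis
      by (simp add: power_add mult_ac)
  qed
  with *(1,3) show ?case
    by (intro exI[of _ "C * C'"] exI[of _ "M + M'"]) auto
qed

text \<open>A single term of the exponential series bounds \<open>(1 + r) ^ M\<close> by
  \<open>fact M * exp (1 + r)\<close>, and \<open>2 - (1 + r - r^2) = (r - 1)^2 + r\<close> is
  nonnegative.\<close>

lemma power_mult_gaussian_bounded:
  fixes r :: real
  assumes "r \<ge> 0"
  shows "(1 + r) ^ M * exp (- r\<^sup>2) \<le> fact M * exp 2"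
proof -
  have "(1 + r) ^ M /\<^sub>R fact M \<le> exp (1 + r)"
    unfolding exp_def
    using sum_le_suminf[OF summable_exp_generic[of "1 + r"], of "{M}"] assms by simp
  then have "(1 + r) ^ M \<le> fact M * exp (1 + r)"
    by (simp add: field_simps)
  then have "(1 + r) ^ M * exp (- r\<^sup>2) \<le> fact M * (exp (1 + r) * exp (- r\<^sup>2))"
    by simp
  also have "exp (1 + r) * exp (- r\<^sup>2) = exp (1 + r - r\<^sup>2)"
    by (simp flip: exp_add)
  also have "\<dots> \<le> exp 2"
    using zero_le_power2[of "r - 1"] assms by (simp add: power2_eq_square algebra_simps)
  finally show ?thesis
    by simp
qed

lemma rapidly_decreasing_exp_norm_square:
  "rapidly_decreasing d e (\<lambda>x::'a::real_inner. c * exp (- (norm x)\<^sup>2))"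
  unfolding rapidly_decreasing_def
proof (intro allI impI)
  fix ks N
  obtain q where q: "real_polynomial_function q"
    "foldr (partial e) ks (\<lambda>x. c * exp (- (norm x)\<^sup>2)) = (\<lambda>x. q x * exp (- (norm x)\<^sup>2))"
    using iterated_partial_exp_norm_square[OF real_polynomial_function_const[of c], of e ks] by blast
  obtain C M where CM: "C \<ge> 0" "\<And>x. \<bar>q x\<bar> \<le> C * (1 + norm x) ^ M"
    using polynomial_growth[OF q(1)] by blast
  have "(1 + norm x) ^ N * \<bar>q x * exp (- (norm x)\<^sup>2)\<bar> \<le> C * (fact (N + M) * exp 2)" for x
  proof -
    have "(1 + norm x) ^ N * \<bar>q x * exp (- (norm x)\<^sup>2)\<bar> \<le> (1 + norm x) ^ N * (C * (1 + norm x) ^ M * exp (- (norm x)\<^sup>2))"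
      using CM by (intro mult_left_mono) (auto simp: abs_mult intro: mult_right_mono)
    also have "\<dots> = C * ((1 + norm x) ^ (N + M) * exp (- (norm x)\<^sup>2))"
      by (simp add: power_add mult_ac)
    also have "\<dots> \<le> C * (fact (N + M) * exp 2)"
      using CM(1) by (intro mult_left_mono power_mult_gaussian_bounded) auto
    finally show ?thesis .
  qed
  then show "\<exists>C. \<forall>x. (1 + norm x) ^ N * \<bar>foldr (partial e) ks (\<lambda>x. c * exp (- (norm x)\<^sup>2)) x\<bar> \<le> C"
    unfolding q(2) by blast
qed

lemma Th_MQ_A_pol_dec_rap:
  assumes onb: "orthonormal_basis d e"
  shows "Th_MQ d e \<in> A_pol_dec_rap d e"
proof -
  have "rapidly_decreasing d e (\<lambda>x. Th_MQ d e X x I)" if "X \<in> so" for X I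
    using rapidly_decreasing_exp_norm_square[of d e "1 / eps d * thom_coeff d e X I"]
    by (simp add: Th_MQ_eq[OF that] mult_ac)
  with Th_MQ_A_pol[OF onb] show ?thesis
    by (simp add: A_pol_dec_rap_def)
qed

section \<open>Integrals over \<open>V\<close>\<close>

abbreviation coord_measure :: "nat \<Rightarrow> (nat \<Rightarrow> real) measure" where
  "coord_measure d \<equiv> \<Pi>\<^sub>M k\<in>{..<d}. lborel"

definition vec_of :: "nat \<Rightarrow> (nat \<Rightarrow> 'a::real_vector) \<Rightarrow> (nat \<Rightarrow> real) \<Rightarrow> 'a" where
  "vec_of d e c = (\<Sum>k<d. c k *\<^sub>R e k)"

lemma form_integral_eq: "form_integral d e \<omega> = (\<integral>c. \<omega> (vec_of d e c) {..<d} \<partial>coord_measure d)"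
  by (simp add: form_integral_def vec_of_def)

lemma product_sigma_finite_lborel: "product_sigma_finite (\<lambda>k::nat. lborel :: real measure)"
  by (simp add: product_sigma_finite_def lborel.sigma_finite_measure_axioms)

lemma sigma_finite_coord_measure: "sigma_finite_measure (coord_measure d)"
  by (rule product_sigma_finite.sigma_finite[OF product_sigma_finite_lborel]) simp

lemma pair_sigma_finite_coord: "pair_sigma_finite (coord_measure d) (lborel :: real measure)"
  "pair_sigma_finite (lborel :: real measure) (coord_measure d)"
  by (simp_all add: pair_sigma_finite_def sigma_finite_coord_measure lborel.sigma_finite_measure_axioms)

lemma measurable_vec_of:
  fixes e :: "nat \<Rightarrow> 'a::real_normed_vector" and \<phi> :: "'a \<Rightarrow> real"
  assumes "continuous_on UNIV \<phi>"
  shows "(\<lambda>c. \<phi> (vec_of d e c)) \<in> borel_measurable (coord_measure d)"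
proof -
  \<comment> \<open>Points of the product space take a default value outside \<open>{..<d}\<close>.
    Replacing it by \<open>0\<close> gives a Borel map into the space of all sequences, on which
    continuity of \<open>vec_of\<close> yields measurability.\<close>
  define T where "T c i = (if i < d then c i else 0)" for c :: "nat \<Rightarrow> real" and i
  have "T \<in> borel_measurable (coord_measure d)"
  proof (rule measurable_coordinatewise_then_product)
    fix i
    show "(\<lambda>c. T c i) \<in> borel_measurable (coord_measure d)"
      using measurable_component_singleton[of i "{..<d}" "\<lambda>_. lborel :: real measure"]
      by (cases "i < d") (simp_all add: T_def)
  qed
  moreover have "(\<lambda>c. \<phi> (vec_of d e c)) \<in> borel_measurable borel"
    unfolding vec_of_def
    by (intro borel_measurable_continuous_onI continuous_on_compose2[OF assms] continuous_intros
        continuous_on_product_coordinates) auto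
  ultimately have "(\<lambda>c. \<phi> (vec_of d e (T c))) \<in> borel_measurable (coord_measure d)"
    by (rule measurable_compose)
  then show ?thesis
    by (simp add: vec_of_def T_def)
qed

lemma norm_vec_of: "orthonormal_basis d e \<Longrightarrow> (norm (vec_of d e c))\<^sup>2 = (\<Sum>k<d. (c k)\<^sup>2)"
  by (simp add: onb_norm_eq[of d e] vec_of_def onb_coord_sum)

lemma has_integral_exp_square: "has_bochner_integral lborel (\<lambda>x::real. exp (- x\<^sup>2)) (sqrt pi)"
  using has_bochner_integral_even_function[OF gaussian_moment_0] by simp

lemma gaussian_integral:
  assumes "orthonormal_basis d e"
  shows "integrable (coord_measure d) (\<lambda>c. exp (- (norm (vec_of d e c))\<^sup>2))"
    and "(\<integral>c. exp (- (norm (vec_of d e c))\<^sup>2) \<partial>coord_measure d) = sqrt pi ^ d"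
proof -
  have eq: "exp (- (norm (vec_of d e c))\<^sup>2) = (\<Prod>k<d. exp (- (c k)\<^sup>2))" for c
    by (simp add: norm_vec_of[OF assms] exp_sum sum_negf[symmetric])
  have int: "integrable lborel (\<lambda>x::real. exp (- x\<^sup>2))"
    by (rule integrable.intros[OF has_integral_exp_square])
  show "integrable (coord_measure d) (\<lambda>c. exp (- (norm (vec_of d e c))\<^sup>2))"
    unfolding eq by (rule product_sigma_finite.product_integrable_prod[OF product_sigma_finite_lborel]) (use int in auto)
  have "(\<integral>c. exp (- (norm (vec_of d e c))\<^sup>2) \<partial>coord_measure d) = (\<Prod>k<d. \<integral>x. exp (- x\<^sup>2) \<partial>lborel)"
    unfolding eq by (rule product_sigma_finite.product_integral_prod[OF product_sigma_finite_lborel]) (use int in auto)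
  then show "(\<integral>c. exp (- (norm (vec_of d e c))\<^sup>2) \<partial>coord_measure d) = sqrt pi ^ d"
    using has_bochner_integral_integral_eq[OF has_integral_exp_square] by simp
qed

text \<open>The product measure is determined by its values on boxes, where one-dimensional scaling
  gives a factor \<open>t\<close> for each coordinate.\<close>

lemma coord_measure_scale:
  assumes "t > 0"
  shows "coord_measure d = density (distr (coord_measure d) (coord_measure d) (\<lambda>c. \<lambda>k\<in>{..<d}. t * c k)) (\<lambda>_. ennreal (t ^ d))"
proof -
  let ?S = "\<lambda>c. \<lambda>k\<in>{..<d}. t * c k" and ?M = "coord_measure d"
  have meas: "?S \<in> measurable ?M ?M"
    by measurable
  have "density (distr ?M ?M ?S) (\<lambda>_. ennreal (t ^ d)) = ?M"
  proof (rule product_sigma_finite.PiM_eqI[OF product_sigma_finite_lborel])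
    fix A :: "nat \<Rightarrow> real set" assume "\<And>k. k \<in> {..<d} \<Longrightarrow> A k \<in> sets lborel"
    then have A: "A k \<in> sets borel" if "k < d" for k
      using that by simp
    let ?B = "\<lambda>k. (\<lambda>x. t * x) -` A k"
    have B: "?B k \<in> sets borel" if "k < d" for k
      using measurable_sets[of "\<lambda>x. t * x" borel borel "A k"] A[OF that] by simp
    have scale: "emeasure lborel (A k) = ennreal t * emeasure lborel (?B k)" if "k < d" for k
    proof -
      have "emeasure lborel (A k) = emeasure (density (distr lborel borel (\<lambda>x. 0 + t * x)) (\<lambda>_. ennreal \<bar>t\<bar>)) (A k)"
        using lborel_real_affine[of t 0] assms by simp
      then show ?thesis
        using A[OF that] assms by (simp add: emeasure_density_const emeasure_distr)
    qed
    have "?S -` Pi\<^sub>E {..<d} A \<inter> space ?M = Pi\<^sub>E {..<d} ?B"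
      by (auto simp: space_PiM PiE_iff extensional_def)
    then have "emeasure (density (distr ?M ?M ?S) (\<lambda>_. ennreal (t ^ d))) (Pi\<^sub>E {..<d} A) =
        ennreal (t ^ d) * emeasure ?M (Pi\<^sub>E {..<d} ?B)"
      using A meas by (subst emeasure_density_const) (auto simp: emeasure_distr intro!: sets_PiM_I_finite)
    also have "emeasure ?M (Pi\<^sub>E {..<d} ?B) = (\<Prod>k<d. emeasure lborel (?B k))"
      by (rule product_sigma_finite.emeasure_PiM[OF product_sigma_finite_lborel]) (use B in auto)
    also have "ennreal (t ^ d) * \<dots> = (\<Prod>k<d. ennreal t * emeasure lborel (?B k))"
      using assms by (simp add: prod.distrib ennreal_power)
    also have "\<dots> = (\<Prod>k<d. emeasure lborel (A k))"
      by (intro prod.cong refl) (simp add: scale)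
    finally show "emeasure (density (distr ?M ?M ?S) (\<lambda>_. ennreal (t ^ d))) (Pi\<^sub>E {..<d} A) =
        (\<Prod>k<d. emeasure lborel (A k))" .
  qed auto
  then show ?thesis
    by simp
qed

lemma integral_vec_of_scale:
  fixes f :: "'a::real_normed_vector \<Rightarrow> real" and e :: "nat \<Rightarrow> 'a"
  assumes "t > 0" "continuous_on UNIV f"
  shows "(\<integral>c. f (vec_of d e c) \<partial>coord_measure d) = t ^ d * (\<integral>c. f (t *\<^sub>R vec_of d e c) \<partial>coord_measure d)"
proof -
  let ?S = "\<lambda>c. \<lambda>k\<in>{..<d}. t * c k" and ?M = "coord_measure d"
  have meas: "?S \<in> measurable ?M ?M"
    by measurable
  note f = measurable_vec_of[OF assms(2), of d e]
  have S: "vec_of d e (?S c) = t *\<^sub>R vec_of d e c" for c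
    by (simp add: vec_of_def scaleR_sum_right)
  have "(\<integral>c. f (vec_of d e c) \<partial>?M) = (\<integral>c. f (vec_of d e c) \<partial>density (distr ?M ?M ?S) (\<lambda>_. ennreal (t ^ d)))"
    using coord_measure_scale[OF assms(1)] by metis
  also have "\<dots> = (\<integral>c. t ^ d *\<^sub>R f (vec_of d e c) \<partial>distr ?M ?M ?S)"
    by (rule integral_density) (use assms(1) f in auto)
  also have "\<dots> = (\<integral>c. t ^ d *\<^sub>R f (vec_of d e (?S c)) \<partial>?M)"
    by (rule integral_distr[OF meas]) (use f in auto)
  finally show ?thesis
    by (simp add: S)
qed

lemma form_integral_Th_MQ:
  assumes onb: "orthonormal_basis d e" and X: "X \<in> so"
  shows "form_integral d e (Th_MQ d e X) = 1"
proof -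
  have "form_integral d e (Th_MQ d e X) =
      (\<integral>c. (1 / eps d * (-1) ^ (d * (d - 1) div 2)) * exp (- (norm (vec_of d e c))\<^sup>2) \<partial>coord_measure d)"
    by (simp add: form_integral_eq Th_MQ_eq[OF X] thom_coeff_top mult_ac)
  also have "\<dots> = 1 / eps d * ((-1) ^ (d * (d - 1) div 2) * sqrt pi ^ d)"
    by (simp only: integral_mult_right_zero gaussian_integral(2)[OF onb] mult.assoc)
  also have "(-1) ^ (d * (d - 1) div 2) * sqrt pi ^ d = eps d"
    by (simp add: eps_def powr_half_sqrt[symmetric] powr_power mult.commute)
  finally show ?thesis
    by (simp add: eps_def)
qed

section \<open>The integral of the compactly supported form\<close>

lemma Th_c_top:
  assumes onb: "orthonormal_basis d e" and \<rho>: "cutoff d e \<rho>" and X: "X \<in> so" and d: "d > 0"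
  shows "Th_c d e \<rho> X x {..<d} = - (1 / eps d * (-1) ^ (d * (d - 1) div 2)) *
    (gauss_int (d - 1) (norm x) * frechet_derivative \<rho> (at x) x)"
proof -
  let ?c = "thom_coeff d e X"
  have w: "gen_wedge k (beta_wedge d e X x) {..<d} = - (gauss_int (d - 1) (norm x) * inner (e k) x * ?c {..<d})"
    if "k < d" for k
  proof -
    \<comment> \<open>Only one generator is missing, so just the summand that restores
      \<open>k\<close> survives in the contraction; its sign cancels against that of the exterior
      multiplication.\<close>
    have "contr_along d (\<lambda>l. inner (e l) x) ?c ({..<d} - {k}) =
        (\<Sum>l<d. if l = k then inner (e k) x * (ins_sign k {..<d} * ?c {..<d}) else 0)"
      unfolding contr_along_def using that
      by (intro sum.cong refl) (auto simp: gen_contr_def insert_absorb)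
    then show ?thesis
      using that by (simp add: gen_wedge_def beta_wedge_eq[OF X])
  qed
  \<comment> \<open>The Pfaffian term has degree zero and drops out in positive dimension.\<close>
  have "Th_c d e \<rho> X x {..<d} = 1 / eps d * (\<Sum>k<d. partial e k \<rho> x * gen_wedge k (beta_wedge d e X x) {..<d})"
    using d by (simp add: Th_c_eq[OF X] monom_ext_def lessThan_empty_iff)
  also have "(\<Sum>k<d. partial e k \<rho> x * gen_wedge k (beta_wedge d e X x) {..<d}) =
      - (gauss_int (d - 1) (norm x) * ?c {..<d} * (\<Sum>k<d. inner (e k) x * partial e k \<rho> x))"
    by (simp add: w sum_distrib_left sum_negf mult_ac)
  also have "(\<Sum>k<d. inner (e k) x * partial e k \<rho> x) = frechet_derivative \<rho> (at x) x"
    using frechet_partial_sum[OF onb cutoff_D(3)[OF onb \<rho>], of x x] by simp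
  finally show ?thesis
    by (simp add: thom_coeff_top)
qed

lemma cutoff_radii:
  assumes onb: "orthonormal_basis d e" and \<rho>: "cutoff d e \<rho>"
  obtains r R where "0 < r" "0 < R"
    "\<And>x. norm x \<le> r \<Longrightarrow> \<rho> x = 1 \<and> frechet_derivative \<rho> (at x) x = 0"
    "\<And>x. norm x \<ge> R \<Longrightarrow> \<rho> x = 0 \<and> frechet_derivative \<rho> (at x) x = 0"
proof -
  have D: "frechet_derivative \<rho> (at x) v = (\<Sum>k<d. inner (e k) v * partial e k \<rho> x)" for x v
    by (rule frechet_partial_sum[OF onb cutoff_D(3)[OF onb \<rho>]])
  obtain U where U: "open U" "0 \<in> U" "\<And>y. y \<in> U \<Longrightarrow> \<rho> y = 1" "\<And>y k. y \<in> U \<Longrightarrow> partial e k \<rho> y = 0"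
    by (rule cutoff_partial_zero[OF \<rho>]) blast
  obtain r where r: "r > 0" "cball 0 r \<subseteq> U"
    using U(1,2) open_contains_cball by blast
  have near: "\<rho> x = 1 \<and> frechet_derivative \<rho> (at x) x = 0" if "norm x \<le> r" for x
  proof -
    have "x \<in> U"
      using that r(2) by (auto simp: subset_iff)
    then show ?thesis
      by (simp add: U D)
  qed
  let ?K = "closure {x. \<rho> x \<noteq> 0}"
  have "bounded ?K"
    using \<rho> by (auto simp: cutoff_def intro: compact_imp_bounded)
  then obtain R where R: "R > 0" "\<And>x. x \<in> ?K \<Longrightarrow> norm x \<le> R"
    by (auto simp: bounded_pos)
  have far: "\<rho> x = 0 \<and> frechet_derivative \<rho> (at x) x = 0" if "norm x \<ge> R + 1" for x
  proof -
    have "x \<notin> ?K"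
      using R(2)[of x] that by auto
    from cutoff_outside[OF this] show ?thesis
      by (simp add: D)
  qed
  show thesis
    by (rule that[of r "R + 1"]) (use r R near far in auto)
qed

lemma continuous_on_radial_derivative:
  fixes e :: "nat \<Rightarrow> 'a::real_inner"
  assumes onb: "orthonormal_basis d e" and \<rho>: "cutoff d e \<rho>"
  shows "continuous_on UNIV (\<lambda>x. frechet_derivative \<rho> (at x) x)"
    and "continuous_on UNIV (\<lambda>x. gauss_int m (norm x) * frechet_derivative \<rho> (at x) x)"
proof -
  have D: "frechet_derivative \<rho> (at x) x = (\<Sum>k<d. inner (e k) x * partial e k \<rho> x)" for x
    by (rule frechet_partial_sum[OF onb cutoff_D(3)[OF onb \<rho>]])
  have "smooth_on UNIV (\<lambda>x. \<Sum>k<d. inner (e k) x * partial e k \<rho> x)"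
    by (intro smooth_on_sum smooth_on_mult smooth_on_inner smooth_on_partial cutoff_D(1)[OF onb \<rho>]) auto
  then show "continuous_on UNIV (\<lambda>x. frechet_derivative \<rho> (at x) x)"
    unfolding D by (rule smooth_on_continuous)
  have "smooth_on UNIV (\<lambda>x. \<Sum>k<d. partial e k \<rho> x * (inner (e k) x * gauss_int m (norm x)))"
    by (intro smooth_on_sum smooth_on_cutoff_beta_coeff[OF onb \<rho>]) auto
  moreover have "gauss_int m (norm x) * frechet_derivative \<rho> (at x) x =
      (\<Sum>k<d. partial e k \<rho> x * (inner (e k) x * gauss_int m (norm x)))" for x
    by (simp add: D sum_distrib_left mult_ac)
  ultimately show "continuous_on UNIV (\<lambda>x. gauss_int m (norm x) * frechet_derivative \<rho> (at x) x)"
    by (simp add: smooth_on_continuous)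
qed

text \<open>The integrand is the derivative of \<open>- \<rho>\<close> at the point
  \<open>y / t\<close>. As \<open>t\<close> grows the point moves inwards along the ray, from
  outside the support to where the cutoff is \<open>1\<close>.\<close>

lemma ray_integral:
  assumes onb: "orthonormal_basis d e" and \<rho>: "cutoff d e \<rho>" and y: "y \<noteq> 0"
  shows "(\<integral>t. indicator {0<..} t * (frechet_derivative \<rho> (at ((1 / t) *\<^sub>R y)) ((1 / t) *\<^sub>R y) / t) \<partial>lborel) = -1"
proof -
  define h where "h x = frechet_derivative \<rho> (at x) x" for x
  obtain r R where rR: "0 < r" "0 < R" "\<And>x. norm x \<le> r \<Longrightarrow> \<rho> x = 1 \<and> h x = 0"
    "\<And>x. norm x \<ge> R \<Longrightarrow> \<rho> x = 0 \<and> h x = 0"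
    unfolding h_def by (rule cutoff_radii[OF onb \<rho>]) blast
  have ny: "norm y > 0"
    using y by simp
  have "r < R"
  proof (rule ccontr)
    assume "\<not> r < R"
    moreover have "norm ((r / norm y) *\<^sub>R y) = r"
      using ny rR(1) by simp
    ultimately show False
      using rR(3,4)[of "(r / norm y) *\<^sub>R y"] by simp
  qed
  \<comment> \<open>For \<open>t\<close> in this interval the point \<open>y / t\<close> lies in the
    shell between the radii \<open>r\<close> and \<open>R\<close>; outside it the radial derivative
    vanishes.\<close>
  define a b where "a = norm y / R" and "b = norm y / r"
  have ab: "0 < a" "a \<le> b"
    using ny rR(1,2) \<open>r < R\<close> by (auto simp: a_def b_def intro!: divide_left_mono)
  have h_out: "h ((1 / t) *\<^sub>R y) = 0" if "t > 0" "t \<notin> {a..b}" for t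
  proof (cases "t < a")
    case True
    then have "norm ((1 / t) *\<^sub>R y) \<ge> R"
      using that rR(2) by (simp add: a_def field_simps)
    then show ?thesis
      using rR(4) by blast
  next
    case False
    then have "norm ((1 / t) *\<^sub>R y) \<le> r"
      using that rR(1) by (simp add: b_def field_simps)
    then show ?thesis
      using rR(3) by blast
  qed
  define \<phi> where "\<phi> t = - \<rho> ((1 / t) *\<^sub>R y)" for t
  have "(\<integral>t. (h ((1 / t) *\<^sub>R y) / t) * indicator {a..b} t \<partial>lborel) = \<phi> b - \<phi> a"
  proof (rule integral_FTC_Icc_real[OF ab(2)])
    fix t assume "a \<le> t" "t \<le> b"
    then have t: "t > 0"
      using ab by simp
    have inv: "((\<lambda>t. (1 / t) *\<^sub>R y) has_derivative (\<lambda>s. s *\<^sub>R (- (1 / t\<^sup>2)) *\<^sub>R y)) (at t)"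
    proof -
      have "((\<lambda>t. 1 / t) has_field_derivative - (1 / t\<^sup>2)) (at t)"
        using t by (auto intro!: derivative_eq_intros simp: power2_eq_square)
      from has_derivative_scaleR_left[OF this[unfolded has_field_derivative_def], of y]
      show ?thesis
        by (simp add: mult.commute)
    qed
    let ?D = "frechet_derivative \<rho> (at ((1 / t) *\<^sub>R y))"
    have lin: "linear ?D"
      by (rule has_derivative_linear[OF cutoff_D(3)[OF onb \<rho>]])
    have "((\<lambda>t. \<rho> ((1 / t) *\<^sub>R y)) has_derivative (\<lambda>s. ?D (s *\<^sub>R (- (1 / t\<^sup>2)) *\<^sub>R y))) (at t)"
      by (rule has_derivative_compose[OF inv cutoff_D(3)[OF onb \<rho>]])
    then have "(\<phi> has_derivative (\<lambda>s. - ?D (s *\<^sub>R (- (1 / t\<^sup>2)) *\<^sub>R y))) (at t)"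
      unfolding \<phi>_def[abs_def] by (rule has_derivative_minus)
    moreover have "- ?D (s *\<^sub>R (- (1 / t\<^sup>2)) *\<^sub>R y) = (h ((1 / t) *\<^sub>R y) / t) * s" for s
      using t by (simp only: linear_scale[OF lin] h_def) (simp add: power2_eq_square)
    ultimately have "(\<phi> has_derivative (\<lambda>s. (h ((1 / t) *\<^sub>R y) / t) * s)) (at t)"
      by simp
    then show "DERIV \<phi> t :> h ((1 / t) *\<^sub>R y) / t"
      by (simp only: has_field_derivative_def)
    have "isCont h ((1 / t) *\<^sub>R y)"
      using continuous_on_radial_derivative(1)[OF onb \<rho>]
      unfolding h_def[abs_def] continuous_on_eq_continuous_at[OF open_UNIV] by blast
    with has_derivative_continuous[OF inv] have "isCont (\<lambda>t. h ((1 / t) *\<^sub>R y)) t"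
      by (rule isCont_o2)
    then show "isCont (\<lambda>t. h ((1 / t) *\<^sub>R y) / t) t"
      using t by (intro isCont_divide continuous_ident) auto
  qed
  moreover have "\<phi> b = -1" "\<phi> a = 0"
    using rR(3)[of "(1 / b) *\<^sub>R y"] rR(4)[of "(1 / a) *\<^sub>R y"] ny rR(1,2) by (simp_all add: \<phi>_def a_def b_def)
  moreover have "indicator {0<..} t * (h ((1 / t) *\<^sub>R y) / t) = (h ((1 / t) *\<^sub>R y) / t) * indicator {a..b} t" for t
    using h_out[of t] ab(1) by (auto simp: indicator_def)
  then have "(\<integral>t. indicator {0<..} t * (h ((1 / t) *\<^sub>R y) / t) \<partial>lborel) =
      (\<integral>t. (h ((1 / t) *\<^sub>R y) / t) * indicator {a..b} t \<partial>lborel)"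
    by (intro Bochner_Integration.integral_cong refl)
  ultimately show ?thesis
    by (simp only: h_def)
qed

text \<open>On the compact set the Gaussian is bounded below by a positive constant, so a multiple
  of it dominates the function.\<close>

lemma integrable_vec_of:
  fixes e :: "nat \<Rightarrow> 'a::real_inner"
  assumes onb: "orthonormal_basis d e" and cont: "continuous_on UNIV \<psi>"
    and K: "compact K" "\<And>x. x \<notin> K \<Longrightarrow> \<psi> x = (0::real)"
  shows "integrable (coord_measure d) (\<lambda>c. \<psi> (vec_of d e c))"
proof -
  have "bounded (\<psi> ` K)"
    using compact_continuous_image[OF continuous_on_subset[OF cont] K(1)] by (auto intro: compact_imp_bounded)
  then obtain B where B: "B > 0" "\<And>x. x \<in> K \<Longrightarrow> \<bar>\<psi> x\<bar> \<le> B"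
    by (auto simp: bounded_pos)
  obtain R where R: "R > 0" "\<And>x. x \<in> K \<Longrightarrow> norm x \<le> R"
    using compact_imp_bounded[OF K(1)] by (auto simp: bounded_pos)
  have bound: "\<bar>\<psi> x\<bar> \<le> B * exp (R\<^sup>2) * exp (- (norm x)\<^sup>2)" for x
  proof (cases "x \<in> K")
    case True
    have "(norm x)\<^sup>2 \<le> R\<^sup>2"
      using R(2)[OF True] by (intro power_mono) auto
    then have "B * 1 \<le> B * exp (R\<^sup>2 - (norm x)\<^sup>2)"
      using B(1) by (intro mult_left_mono) auto
    moreover have "B * exp (R\<^sup>2 - (norm x)\<^sup>2) = B * exp (R\<^sup>2) * exp (- (norm x)\<^sup>2)"
      by (simp add: exp_diff exp_minus divide_inverse)
    ultimately show ?thesis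
      using B(2)[OF True] by linarith
  qed (use B(1) K(2) in auto)
  show ?thesis
  proof (rule Bochner_Integration.integrable_bound)
    show "integrable (coord_measure d) (\<lambda>c. B * exp (R\<^sup>2) * exp (- (norm (vec_of d e c))\<^sup>2))"
      by (intro integrable_mult_right gaussian_integral(1)[OF onb])
    show "(\<lambda>c. \<psi> (vec_of d e c)) \<in> borel_measurable (coord_measure d)"
      by (rule measurable_vec_of[OF cont])
    show "AE c in coord_measure d. norm (\<psi> (vec_of d e c)) \<le> norm (B * exp (R\<^sup>2) * exp (- (norm (vec_of d e c))\<^sup>2))"
      using bound B(1) by (simp add: abs_mult)
  qed
qed

lemma AE_vec_of_nonzero:
  assumes onb: "orthonormal_basis d e" and d: "d > 0"
  shows "AE c in coord_measure d. vec_of d e c \<noteq> 0"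
proof -
  let ?N = "Pi\<^sub>E {..<d} (\<lambda>k. if k = 0 then {0::real} else UNIV)"
  have "emeasure (coord_measure d) ?N = (\<Prod>k<d. emeasure lborel (if k = 0 then {0::real} else UNIV))"
    by (rule product_sigma_finite.emeasure_PiM[OF product_sigma_finite_lborel]) auto
  also have "\<dots> = 0"
    using d by (intro prod_zero) auto
  finally have "?N \<in> null_sets (coord_measure d)"
    by (intro null_setsI sets_PiM_I_finite) auto
  moreover have "c \<in> ?N" if "c \<in> space (coord_measure d)" "vec_of d e c = 0" for c
  proof -
    have "c 0 = 0"
      using onb_coord_sum[OF onb d, of c] that(2) by (simp add: vec_of_def)
    with that(1) show ?thesis
      by (auto simp: space_PiM PiE_iff)
  qed
  ultimately show ?thesis
    by (intro AE_I'[of ?N]) auto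
qed

text \<open>The half line is opened at \<open>0\<close> because the substitution below divides by
  \<open>t\<close>.\<close>

lemma integral_gauss_open:
  "(\<integral>t. indicator {0<..} t * (exp (- (t\<^sup>2 * r\<^sup>2)) * t ^ m) \<partial>lborel) = gauss_int m r"
  unfolding gauss_int_def set_lebesgue_integral_def
proof (rule integral_cong_AE)
  show "AE t in lborel. indicator {0<..} t * (exp (- (t\<^sup>2 * r\<^sup>2)) * t ^ m) =
      indicat_real {0..} t *\<^sub>R (exp (- (t\<^sup>2 * r\<^sup>2)) * t ^ m)"
    using AE_lborel_singleton[of 0] by eventually_elim (auto simp: indicator_def)
qed auto

lemma integrable_gauss_open:
  fixes r :: real
  assumes "r > 0"
  shows "integrable lborel (\<lambda>t. indicator {0<..} t * (exp (- (t\<^sup>2 * r\<^sup>2)) * t ^ m))"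
proof (rule Bochner_Integration.integrable_bound[OF integrable.intros[OF has_integral_gauss_int[OF assms, of m]]])
  show "AE t in lborel. norm (indicator {0<..} t * (exp (- (t\<^sup>2 * r\<^sup>2)) * t ^ m)) \<le>
      norm (indicat_real {0..} t *\<^sub>R (exp (- (t\<^sup>2 * r\<^sup>2)) * t ^ m))"
    by (auto simp: indicator_def)
qed auto

text \<open>
  After writing the radial factor as an integral over \<open>t\<close> and substituting \<open>x = y / t\<close>, the integral over \<open>t\<close>
  becomes that of the derivative of \<open>\<rho>\<close> along a ray, so no polar coordinates are needed.
\<close>

lemma radial_integral:
  fixes e :: "nat \<Rightarrow> 'a::real_inner"
  assumes onb: "orthonormal_basis d e" and \<rho>: "cutoff d e \<rho>" and d: "d > 0"
  shows "(\<integral>c. gauss_int (d - 1) (norm (vec_of d e c)) * frechet_derivative \<rho> (at (vec_of d e c)) (vec_of d e c) \<partial>coord_measure d)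
    = - (sqrt pi ^ d)"
proof -
  let ?M = "coord_measure d" and ?V = "vec_of d e"
  define h where "h x = frechet_derivative \<rho> (at x) x" for x
  define m where "m = d - 1"
  have dm: "d = Suc m"
    using d by (simp add: m_def)
  note cont_h = continuous_on_radial_derivative(1)[OF onb \<rho>, folded h_def]
  note cont_Gh = continuous_on_radial_derivative(2)[OF onb \<rho>, folded h_def]
  have h0: "h 0 = 0"
    using linear_0[OF has_derivative_linear[OF cutoff_D(3)[OF onb \<rho>]]] by (simp add: h_def)
  have h_out: "h x = 0" if "x \<notin> closure {x. \<rho> x \<noteq> 0}" for x
    unfolding h_def frechet_partial_sum[OF onb cutoff_D(3)[OF onb \<rho>], of x x]
    by (simp add: cutoff_outside[OF that])
  define H Q where "H c = h (?V c)" and "Q c = (norm (?V c))\<^sup>2" for c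
  have [measurable]: "H \<in> borel_measurable ?M" "Q \<in> borel_measurable ?M"
    unfolding H_def[abs_def] Q_def[abs_def]
    by (intro measurable_vec_of cont_h continuous_intros)+
  define F1 where "F1 c t = indicator {0<..} t * (H c * (exp (- (t\<^sup>2 * Q c)) * t ^ m))" for c and t :: real
  \<comment> \<open>The rescaled point enters through its coordinates, restricted to
    \<open>{..<d}\<close> to stay in the product space; joint measurability then follows from that
    of \<open>H\<close>.\<close>
  define F2 where "F2 c t = indicator {0<..} t * (H (\<lambda>k\<in>{..<d}. c k / t) / t * exp (- Q c))" for c and t :: real
  have H_scale: "H (\<lambda>k\<in>{..<d}. c k / t) = h ((1 / t) *\<^sub>R ?V c)" for c t
    by (simp add: H_def vec_of_def scaleR_sum_right)
  interpret P: pair_sigma_finite ?M "lborel :: real measure"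
    by (rule pair_sigma_finite_coord)
  interpret P': pair_sigma_finite "lborel :: real measure" ?M
    by (rule pair_sigma_finite_coord)
  have G0: "gauss_int m s \<ge> 0" for s
    unfolding gauss_int_def set_lebesgue_integral_def
    by (rule Bochner_Integration.integral_nonneg) (auto simp: indicator_def)
  have int_F1: "(\<integral>t. F1 c t \<partial>lborel) = H c * gauss_int m (norm (?V c))" for c
    by (simp only: F1_def Q_def mult.left_commute[of "indicator _ _" "H c"] integral_mult_right_zero integral_gauss_open)
  have int_abs_F1: "(\<integral>t. \<bar>F1 c t\<bar> \<partial>lborel) = \<bar>H c\<bar> * gauss_int m (norm (?V c))" for c
  proof -
    have "\<bar>F1 c t\<bar> = \<bar>H c\<bar> * (indicator {0<..} t * (exp (- (t\<^sup>2 * (norm (?V c))\<^sup>2)) * t ^ m))" for t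
      by (auto simp: F1_def Q_def abs_mult indicator_def)
    then show ?thesis
      by (simp only: integral_mult_right_zero integral_gauss_open)
  qed
  \<comment> \<open>The Jacobian \<open>(1 / t) ^ d\<close> and the factor \<open>t ^ m\<close>
    combine to \<open>1 / t\<close>, as \<open>d = Suc m\<close>.\<close>
  have scale: "(\<integral>c. \<phi> (?V c) * (exp (- (t\<^sup>2 * Q c)) * t ^ m) \<partial>?M) = (\<integral>c. \<phi> ((1 / t) *\<^sub>R ?V c) / t * exp (- Q c) \<partial>?M)"
    if t: "t > 0" and \<phi>: "continuous_on UNIV \<phi>" for t \<phi>
  proof -
    have "(\<integral>c. \<phi> (?V c) * (exp (- (t\<^sup>2 * Q c)) * t ^ m) \<partial>?M) =
        (1 / t) ^ d * (\<integral>c. \<phi> ((1 / t) *\<^sub>R ?V c) * (exp (- (t\<^sup>2 * (norm ((1 / t) *\<^sub>R ?V c))\<^sup>2)) * t ^ m) \<partial>?M)"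
      unfolding Q_def
      by (rule integral_vec_of_scale[where f="\<lambda>x. \<phi> x * (exp (- (t\<^sup>2 * (norm x)\<^sup>2)) * t ^ m)"])
        (use t \<phi> in \<open>auto intro!: continuous_intros\<close>)
    also have "\<dots> = (\<integral>c. (1 / t) ^ d * (\<phi> ((1 / t) *\<^sub>R ?V c) * (exp (- (t\<^sup>2 * (norm ((1 / t) *\<^sub>R ?V c))\<^sup>2)) * t ^ m)) \<partial>?M)"
      by (rule integral_mult_right_zero[symmetric])
    also have "\<dots> = (\<integral>c. \<phi> ((1 / t) *\<^sub>R ?V c) / t * exp (- Q c) \<partial>?M)"
    proof (intro Bochner_Integration.integral_cong refl)
      fix c
      have "t\<^sup>2 * (norm ((1 / t) *\<^sub>R ?V c))\<^sup>2 = Q c"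
        using t by (simp add: Q_def power_divide)
      then show "(1 / t) ^ d * (\<phi> ((1 / t) *\<^sub>R ?V c) * (exp (- (t\<^sup>2 * (norm ((1 / t) *\<^sub>R ?V c))\<^sup>2)) * t ^ m)) =
          \<phi> ((1 / t) *\<^sub>R ?V c) / t * exp (- Q c)"
        using t by (simp add: dm power_divide)
    qed
    finally show ?thesis .
  qed
  \<comment> \<open>The version with absolute values carries integrability over from
    \<open>F1\<close> to \<open>F2\<close>, which justifies the second exchange of
    integrals.\<close>
  have F12: "(\<integral>c. F1 c t \<partial>?M) = (\<integral>c. F2 c t \<partial>?M)" "(\<integral>c. \<bar>F1 c t\<bar> \<partial>?M) = (\<integral>c. \<bar>F2 c t\<bar> \<partial>?M)" for t
  proof -
    have "(\<integral>c. F1 c t \<partial>?M) = (\<integral>c. F2 c t \<partial>?M) \<and> (\<integral>c. \<bar>F1 c t\<bar> \<partial>?M) = (\<integral>c. \<bar>F2 c t\<bar> \<partial>?M)"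
    proof (cases "t > 0")
      case True
      have 1: "F1 c t = h (?V c) * (exp (- (t\<^sup>2 * Q c)) * t ^ m)" "F2 c t = h ((1 / t) *\<^sub>R ?V c) / t * exp (- Q c)" for c
        using True by (simp_all add: F1_def F2_def H_scale) (simp add: H_def)
      have 2: "\<bar>F1 c t\<bar> = \<bar>h (?V c)\<bar> * (exp (- (t\<^sup>2 * Q c)) * t ^ m)"
        "\<bar>F2 c t\<bar> = \<bar>h ((1 / t) *\<^sub>R ?V c)\<bar> / t * exp (- Q c)" for c
        using True by (simp_all add: 1 abs_mult)
      have "(\<integral>c. F1 c t \<partial>?M) = (\<integral>c. F2 c t \<partial>?M)"
        unfolding 1 by (rule scale[OF True cont_h])
      moreover have "(\<integral>c. \<bar>F1 c t\<bar> \<partial>?M) = (\<integral>c. \<bar>F2 c t\<bar> \<partial>?M)"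
        unfolding 2 by (rule scale[OF True continuous_on_rabs[OF cont_h]])
      ultimately show ?thesis ..
    qed (simp add: F1_def F2_def)
    then show "(\<integral>c. F1 c t \<partial>?M) = (\<integral>c. F2 c t \<partial>?M)" "(\<integral>c. \<bar>F1 c t\<bar> \<partial>?M) = (\<integral>c. \<bar>F2 c t\<bar> \<partial>?M)"
      by auto
  qed
  have integ1: "integrable (?M \<Otimes>\<^sub>M lborel) (\<lambda>(c, t). F1 c t)"
  proof (rule P.Fubini_integrable)
    show "(\<lambda>(c, t). F1 c t) \<in> borel_measurable (?M \<Otimes>\<^sub>M lborel)"
      unfolding F1_def by measurable
    have "integrable ?M (\<lambda>c. gauss_int m (norm (?V c)) * h (?V c))"
      by (rule integrable_vec_of[OF onb cont_Gh, of "closure {x. \<rho> x \<noteq> 0}"])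
        (use \<rho> h_out in \<open>auto simp: cutoff_def\<close>)
    then have "integrable ?M (\<lambda>c. \<bar>gauss_int m (norm (?V c)) * h (?V c)\<bar>)"
      by simp
    then show "integrable ?M (\<lambda>c. \<integral>t. norm (case (c, t) of (c, t) \<Rightarrow> F1 c t) \<partial>lborel)"
      by (simp add: int_abs_F1 abs_mult G0 H_def mult.commute)
    have "integrable lborel (F1 c)" for c
    proof (cases "?V c = 0")
      case True
      then show ?thesis
        by (simp add: F1_def[abs_def] H_def h0)
    next
      case False
      then have "integrable lborel (\<lambda>t. H c * (indicator {0<..} t * (exp (- (t\<^sup>2 * (norm (?V c))\<^sup>2)) * t ^ m)))"
        by (intro integrable_mult_right integrable_gauss_open) simp
      then show ?thesis
        by (simp add: F1_def[abs_def] Q_def mult_ac)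
    qed
    then show "AE c in ?M. integrable lborel (\<lambda>t. case (c, t) of (c, t) \<Rightarrow> F1 c t)"
      by simp
  qed
  have meas2: "(\<lambda>(t, c). F2 c t) \<in> borel_measurable (lborel \<Otimes>\<^sub>M ?M)"
    unfolding F2_def by measurable
  have integ2: "integrable (lborel \<Otimes>\<^sub>M ?M) (\<lambda>(t, c). F2 c t)"
  proof (rule P'.Fubini_integrable[OF meas2])
    have "integrable (?M \<Otimes>\<^sub>M lborel) (\<lambda>(c, t). \<bar>F1 c t\<bar>)"
      using integrable_abs[OF integ1] by (simp add: split_beta')
    from P.integrable_snd[OF this]
    show "integrable lborel (\<lambda>t. \<integral>c. norm (case (t, c) of (t, c) \<Rightarrow> F2 c t) \<partial>?M)"
      by (simp add: F12(2))
    \<comment> \<open>For fixed \<open>t\<close> the radial derivative is bounded, so a multiple of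
      the Gaussian dominates.\<close>
    have "integrable ?M (\<lambda>c. F2 c t)" for t
    proof (cases "t > 0")
      case True
      have cont: "continuous_on UNIV (\<lambda>x. h ((1 / t) *\<^sub>R x))"
        by (intro continuous_on_compose2[OF cont_h] continuous_intros) auto
      obtain B where B: "\<And>x. \<bar>h x\<bar> \<le> B"
      proof -
        have "bounded (h ` closure {x. \<rho> x \<noteq> 0})"
          using compact_continuous_image[OF continuous_on_subset[OF cont_h]] \<rho>
          by (auto intro: compact_imp_bounded simp: cutoff_def)
        then obtain B where "B > 0" "\<And>x. x \<in> closure {x. \<rho> x \<noteq> 0} \<Longrightarrow> \<bar>h x\<bar> \<le> B"
          by (auto simp: bounded_pos)
        then have "\<bar>h x\<bar> \<le> B" for x
          using h_out[of x] by (cases "x \<in> closure {x. \<rho> x \<noteq> 0}") auto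
        then show thesis
          by (rule that)
      qed
      show ?thesis
      proof (rule Bochner_Integration.integrable_bound)
        show "integrable ?M (\<lambda>c. B / t * exp (- Q c))"
          unfolding Q_def by (intro integrable_mult_right gaussian_integral(1)[OF onb])
        show "(\<lambda>c. F2 c t) \<in> borel_measurable ?M"
          unfolding F2_def H_scale using measurable_vec_of[OF cont, of d e] by measurable
        have "\<bar>F2 c t\<bar> \<le> \<bar>B / t * exp (- Q c)\<bar>" for c
        proof -
          have "\<bar>F2 c t\<bar> = \<bar>h ((1 / t) *\<^sub>R ?V c)\<bar> / t * exp (- Q c)"
            using True by (simp add: F2_def H_scale abs_mult)
          also have "\<dots> \<le> B / t * exp (- Q c)"
            using True B by (intro mult_right_mono divide_right_mono) auto
          finally show ?thesis
            by linarith
        qed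
        then show "AE c in ?M. norm (F2 c t) \<le> norm (B / t * exp (- Q c))"
          by simp
      qed
    qed (simp add: F2_def)
    then show "AE t in lborel. integrable ?M (\<lambda>c. case (t, c) of (t, c) \<Rightarrow> F2 c t)"
      by simp
  qed
  have ray: "AE c in ?M. (\<integral>t. F2 c t \<partial>lborel) = - exp (- (norm (?V c))\<^sup>2)"
    using AE_vec_of_nonzero[OF onb d]
  proof eventually_elim
    case (elim c)
    have "F2 c t = exp (- Q c) * (indicator {0<..} t * (h ((1 / t) *\<^sub>R ?V c) / t))" for t
      by (simp add: F2_def H_scale)
    then show ?case
      using ray_integral[OF onb \<rho> elim] by (simp only: integral_mult_right_zero h_def) (simp add: Q_def)
  qed
  have "(\<integral>c. gauss_int m (norm (?V c)) * h (?V c) \<partial>?M) = (\<integral>c. (\<integral>t. F1 c t \<partial>lborel) \<partial>?M)"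
    by (simp add: int_F1 H_def mult.commute)
  also have "\<dots> = (\<integral>t. (\<integral>c. F1 c t \<partial>?M) \<partial>lborel)"
    by (rule P.Fubini_integral[OF integ1, symmetric])
  also have "\<dots> = (\<integral>t. (\<integral>c. F2 c t \<partial>?M) \<partial>lborel)"
    by (simp only: F12)
  also have "\<dots> = (\<integral>c. (\<integral>t. F2 c t \<partial>lborel) \<partial>?M)"
    by (rule P'.Fubini_integral[OF integ2, symmetric])
  also have "\<dots> = (\<integral>c. - exp (- (norm (?V c))\<^sup>2) \<partial>?M)"
  proof (rule integral_cong_AE)
    show "(\<lambda>c. \<integral>t. F2 c t \<partial>lborel) \<in> borel_measurable ?M"
      using P'.integrable_snd[OF integ2] by (rule borel_measurable_integrable)
    show "(\<lambda>c. - exp (- (norm (?V c))\<^sup>2)) \<in> borel_measurable ?M"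
      using borel_measurable_integrable[OF gaussian_integral(1)[OF onb]] by simp
  qed (rule ray)
  also have "\<dots> = - (sqrt pi ^ d)"
    by (simp add: gaussian_integral(2)[OF onb])
  finally show ?thesis
    by (simp add: h_def m_def)
qed

text \<open>In dimension zero the space is a point and the top degree is zero, so the Pfaffian term,
  here \<open>1\<close>, is the whole integral. In positive dimension only the term with the
  differential of the cutoff counts.\<close>

lemma form_integral_Th_c:
  assumes onb: "orthonormal_basis d e" and \<rho>: "cutoff d e \<rho>" and X: "X \<in> so"
  shows "form_integral d e (Th_c d e \<rho> X) = 1"
proof (cases "d = 0")
  case True
  have "\<rho> 0 = 1"
    using \<rho> by (auto simp: cutoff_def)
  then have "Th_c d e \<rho> X (vec_of d e c) {..<d} = 1" for c
    using thom_coeff_top[of d e X] True by (simp add: Th_c_eq[OF X] vec_of_def monom_ext_def eps_def)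
  moreover have "(\<integral>c. 1 \<partial>coord_measure 0) = (1::real)"
    using product_sigma_finite.product_integral_prod[OF product_sigma_finite_lborel, of "{}" "\<lambda>_ _. 1 :: real"] by simp
  ultimately show ?thesis
    using True by (simp add: form_integral_eq)
next
  case False
  then have d: "d > 0"
    by simp
  have "form_integral d e (Th_c d e \<rho> X) = - (1 / eps d * (-1) ^ (d * (d - 1) div 2)) * - (sqrt pi ^ d)"
    unfolding form_integral_eq Th_c_top[OF onb \<rho> X d]
    by (simp only: integral_mult_right_zero radial_integral[OF onb \<rho> d])
  also have "\<dots> = 1 / eps d * ((-1) ^ (d * (d - 1) div 2) * sqrt pi ^ d)"
    by simp
  also have "(-1) ^ (d * (d - 1) div 2) * sqrt pi ^ d = eps d"
    by (simp add: eps_def powr_half_sqrt[symmetric] powr_power mult.commute)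
  finally show ?thesis
    by (simp add: eps_def)
qed

theorem theorem4p7:
  fixes d :: nat and e :: "nat \<Rightarrow> 'a::real_inner"
  assumes "orthonormal_basis d e"
  shows "(thom_form_rel d e (Th_rel d e)
          \<and> thom_class_rel d e (cohomologous_rel d e `` {Th_rel d e}))
       \<and> (\<forall>\<rho>. cutoff d e \<rho> \<longrightarrow>
            thom_form d e (A_pol_c d e) (Th_c d e \<rho>)
          \<and> thom_class d e (A_pol_c d e) (cohomologous d e (A_pol_c d e) `` {Th_c d e \<rho>}))
       \<and> (thom_form d e (A_pol_dec_rap d e) (Th_MQ d e)
          \<and> thom_class d e (A_pol_dec_rap d e)
              (cohomologous d e (A_pol_dec_rap d e) `` {Th_MQ d e}))"
proof -
  have cls: "thom_class d e A (cohomologous d e A `` {\<alpha>})" if "thom_form d e A \<alpha>" for A \<alpha>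
    using that by (auto simp: thom_class_def thom_form_def cohomology_def intro: quotientI)
  have fin: "finite I" if "I \<subseteq> {..<d}" for I
    using that finite_subset by auto
  have "thom_form d e (A_pol_dec_rap d e) (Th_MQ d e)"
    using Th_MQ_A_pol_dec_rap[OF assms] form_integral_Th_MQ[OF assms] D_Th_MQ[OF assms] fin
    by (simp add: thom_form_def closed_eq_def eq_on_def)
  moreover have "thom_form d e (A_pol_c d e) (Th_c d e \<rho>)" if "cutoff d e \<rho>" for \<rho>
    using Th_c_A_pol_c[OF assms that] form_integral_Th_c[OF assms that] D_Th_c[OF assms that]
    by (simp add: thom_form_def closed_eq_def eq_on_def)
  moreover have "thom_form_rel d e (Th_rel d e)"
  proof -
    have "fst (Th_rel d e) = (\<lambda>X x I. 1 / eps d * Pf_half d e X x I)"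
      "snd (Th_rel d e) = (\<lambda>X x I. 1 / eps d * beta_wedge d e X x I)"
      by (simp_all add: Th_rel_def)
    moreover have "D_rel d e (Th_rel d e) = (D_eq d e (fst (Th_rel d e)),
        \<lambda>X x I. fst (Th_rel d e) X x I - D_eq d e (snd (Th_rel d e)) X x I)"
      by (simp add: D_rel_def case_prod_beta)
    ultimately have "eq_rel d (D_rel d e (Th_rel d e)) (zero_eq, zero_eq)"
      by (simp add: eq_rel_def eq_on_def D_Pf_half[OF assms _ fin] D_beta_wedge_scaled[OF assms]
          del: times_divide_eq_left)
    then show ?thesis
      by (simp add: thom_form_rel_def closed_rel_def Th_rel_A_rel[OF assms] cut_Th_rel form_integral_Th_c[OF assms])
  qed
  moreover from this have "thom_class_rel d e (cohomologous_rel d e `` {Th_rel d e})"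
    unfolding thom_class_rel_def cohomology_rel_def
    by (intro conjI quotientI exI[of _ "Th_rel d e"]) (simp_all add: thom_form_rel_def)
  ultimately show ?thesis
    using cls by blast
qed

end
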